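(* Let $k>0$, let $B_m=\{x\in\mathbb{R}^2:|x|<R_m\}$ for $m=1,2$, let $D\subset\mathbb{R}^2$ be an open simply connected domain with $C^2$ boundary, and let $\Gamma_1=\partial\Omega_1$, $\Gamma_2=\partial\Omega_2$ be two non-intersecting smooth closed curves contained in $D$ with $B_1\subset\Omega_1\subset\Omega_2\subset D\subseteq B_2$. Assume that $k^2$ is not a Dirichlet eigenvalue of $-\Delta$ in $B_1$, in $D$, or in $\Omega_2\setminus\Omega_1$. Let $z_j\in B_1$ be a source point, and write $X=L^2(\partial B_1)\times L^2(\partial B_2)$ and $Y=L^2(\Gamma_1)\times L^2(\Gamma_2)$. Let $\boldsymbol{u}_j\in Y$ be the exact data, $\mathcal{S}:X\to Y$ the single-layer operator, and $\boldsymbol{\varphi}_j^*\in X$, $\boldsymbol{u}_j^*=\mathcal{S}\boldsymbol{\varphi}_j^*$ and $\varepsilon>0$ with $\|\boldsymbol{u}_j^*-\boldsymbol{u}_j\|_Y<\varepsilon$, all as defined in the context. Let $\delta_0\in(0,1]$ and, for each $\delta\in(0,\delta_0)$, let $\boldsymbol{u}_j^\delta\in Y$ satisfy $\|\boldsymbol{u}_j-\boldsymbol{u}_j^\delta\|_Y\le\delta$ and $\delta+\varepsilon\le\|\boldsymbol{u}_j^\delta\|_Y$, and let $\alpha(\delta)>0$ be such that the solution $\boldsymbol{\varphi}_j^{\alpha(\delta),\delta}\in X$ of $$\alpha(\delta)\boldsymbol{\varphi}+\mathcal{S}^*\mathcal{S}\boldsymbol{\varphi}=\mathcal{S}^*\boldsymbol{u}_j^\delta$$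 satisfies $\|\mathcal{S}\boldsymbol{\varphi}_j^{\alpha(\delta),\delta}-\boldsymbol{u}_j^\delta\|_Y=\delta+\varepsilon$. Then: (a) There exists $\boldsymbol{h}_j\in Y$ such that $\|\boldsymbol{\varphi}_j^*-\mathcal{S}^*\boldsymbol{h}_j\|_X<\varepsilon$. (b) If $\boldsymbol{h}_j$ is as in (a) and $\|\boldsymbol{h}_j\|_Y\le E_j$, then for every $\delta\in(0,\delta_0)$ $$\big\|\boldsymbol{\varphi}_j^{\alpha(\delta),\delta}-\boldsymbol{\varphi}_j^*\big\|_X\le2\varepsilon+2\sqrt{(\delta+\varepsilon)E_j}.$$
   Context: Let $\Phi(x,y)=\frac{\mathrm{i}}{4}H_0^{(1)}(k|x-y|)$ ($H_0^{(1)}$ the Hankel function of the first kind of order zero). The incident field is $u^i(x;z_j)=\Phi(x,z_j)$; the scattered field $u^s(\cdot;z_j)$ is the unique solution of $\Delta u^s+k^2u^s=0$ in $D$ with $u^i+u^s=0$ on $\partial D$; the total field is $u=u^i+u^s$. The exact data are $\boldsymbol{u}_j=(u(\cdot;z_j)|_{\Gamma_1},u(\cdot;z_j)|_{\Gamma_2})^\top$. The operator $\mathcal{S}:X\to Y$ is $\mathcal{S}(\psi_1,\psi_2)^\top=(\mathcal{S}_{11}\psi_1+\mathcal{S}_{21}\psi_2,\ \mathcal{S}_{12}\psi_1+\mathcal{S}_{22}\psi_2)^\top$ with $(\mathcal{S}_{m\ell}\psi)(x)=\int_{\partial B_m}\Phi(x,y)\psi(y)\,\mathrm{d}s(y)$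 for $x\in\Gamma_\ell$; $\mathcal{S}^*:Y\to X$ is its $L^2$-adjoint. The spaces $X,Y$ are complex Hilbert spaces with the product $L^2$ norms. Approximate densities: for a fixed small $\varepsilon_0$ ($0<\varepsilon_0\ll1$), $\boldsymbol{\varphi}_j^*=(\varphi_{j,1}^*,\varphi_{j,2}^* )^\top\in X$ is a fixed pair of densities such that $$\Big\|\int_{\partial B_1}\Phi(\cdot,y)\varphi_{j,1}^*(y)\,\mathrm{d}s(y)-u^i(\cdot;z_j)\Big\|_{L^2(\Gamma_1)}<\varepsilon_0,\qquad\Big\|\int_{\partial B_2}\Phi(\cdot,y)\varphi_{j,2}^*(y)\,\mathrm{d}s(y)-u^s(\cdot;z_j)\Big\|_{L^2(\partial D)}<\varepsilon_0.$$ Put $\boldsymbol{u}_j^*=\mathcal{S}\boldsymbol{\varphi}_j^*$ and $\varepsilon:=C_0\varepsilon_0$, where $C_0>0$ is a constant (from continuous dependence on boundary values) for which $\|\boldsymbol{u}_j^*-\boldsymbol{u}_j\|_Y<C_0\varepsilon_0$. *)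

theory Defs
  imports "HOL-Analysis.Analysis"
begin

text \<open>
  The plane \<open>\<real>\<^sup>2\<close> is identified with the type \<^typ>\<open>complex\<close>: \<open>|x - y|\<close> is \<^term>\<open>cmod (x - y)\<close>, and the
  two real coordinate directions are \<open>1\<close> and \<open>\<i>\<close>.
\<close>

section \<open>The Hankel function and the fundamental solution\<close>

definition bessel_J0 :: "real \<Rightarrow> real" where
  "bessel_J0 x = (\<Sum>m. (-1) ^ m / (fact m)\<^sup>2 * (x / 2) ^ (2 * m))"

text \<open>The classical series of the Bessel function of the second kind, for positive arguments.\<close>

definition bessel_Y0 :: "real \<Rightarrow> real" where
  "bessel_Y0 x = 2 / pi * ((ln (x / 2) + euler_mascheroni) * bessel_J0 x
                 - (\<Sum>m. (-1) ^ m * harm m / (fact m)\<^sup>2 * (x / 2) ^ (2 * m)))"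

definition hankel_H10 :: "real \<Rightarrow> complex" where
  "hankel_H10 x = of_real (bessel_J0 x) + \<i> * of_real (bessel_Y0 x)"

definition Phi :: "real \<Rightarrow> complex \<Rightarrow> complex \<Rightarrow> complex" where
  "Phi k x y = \<i> / 4 * hankel_H10 (k * cmod (x - y))"

section \<open>The Helmholtz equation\<close>

definition partial_deriv :: "complex \<Rightarrow> (complex \<Rightarrow> complex) \<Rightarrow> complex \<Rightarrow> complex" where
  "partial_deriv e u x = vector_derivative (\<lambda>t. u (x + of_real t * e)) (at 0)"

definition C1_on :: "complex set \<Rightarrow> (complex \<Rightarrow> complex) \<Rightarrow> bool" where
  "C1_on G u \<longleftrightarrow> (\<forall>e\<in>{1, \<i>}.
     (\<forall>x\<in>G. (\<lambda>t::real. u (x + of_real t * e)) differentiable (at 0)) \<and>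
     continuous_on G (partial_deriv e u))"

definition C2_on :: "complex set \<Rightarrow> (complex \<Rightarrow> complex) \<Rightarrow> bool" where
  "C2_on G u \<longleftrightarrow> C1_on G u \<and> (\<forall>e\<in>{1, \<i>}. C1_on G (partial_deriv e u))"

definition laplacian :: "(complex \<Rightarrow> complex) \<Rightarrow> complex \<Rightarrow> complex" where
  "laplacian u x = partial_deriv 1 (partial_deriv 1 u) x + partial_deriv \<i> (partial_deriv \<i> u) x"

text \<open>
  Classical solutions, for an open set \<open>G\<close>: twice continuously differentiable in \<open>G\<close>,
  continuous up to the boundary. Values outside \<^term>\<open>closure G\<close> are irrelevant.
\<close>

definition helmholtz_solution :: "real \<Rightarrow> complex set \<Rightarrow> (complex \<Rightarrow> complex) \<Rightarrow> bool" where
  "helmholtz_solution lam G u \<longleftrightarrow>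
     C2_on G u \<and> continuous_on (closure G) u \<and>
     (\<forall>x\<in>G. laplacian u x + of_real lam * u x = 0)"

definition dirichlet_eigenvalue :: "real \<Rightarrow> complex set \<Rightarrow> bool" where
  "dirichlet_eigenvalue lam G \<longleftrightarrow>
     (\<exists>u. helmholtz_solution lam G u \<and> (\<forall>x\<in>frontier G. u x = 0) \<and> (\<exists>x\<in>G. u x \<noteq> 0))"

definition scattered_field :: "real \<Rightarrow> complex set \<Rightarrow> complex \<Rightarrow> (complex \<Rightarrow> complex) \<Rightarrow> bool" where
  "scattered_field k D z us \<longleftrightarrow>
     helmholtz_solution (k\<^sup>2) D us \<and> (\<forall>x\<in>frontier D. Phi k x z + us x = 0)"

section \<open>Closed curves and arc length\<close>

definition curve_deriv :: "(real \<Rightarrow> complex) \<Rightarrow> real \<Rightarrow> complex" where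
  "curve_deriv g t = vector_derivative g (at t)"

definition Ck_curve :: "nat \<Rightarrow> (real \<Rightarrow> complex) \<Rightarrow> bool" where
  "Ck_curve n g \<longleftrightarrow> (\<forall>j<n. \<forall>t. (curve_deriv ^^ j) g differentiable (at t)) \<and>
                    continuous_on UNIV ((curve_deriv ^^ n) g)"

text \<open>
  A regular parametrisation of a simple closed curve is a \<open>1\<close>-periodic function on the whole line, so that
  differentiability also holds where the curve closes up. The curve itself is \<^term>\<open>range g\<close>.
\<close>

definition regular_jordan_curve :: "(real \<Rightarrow> complex) \<Rightarrow> bool" where
  "regular_jordan_curve g \<longleftrightarrow>
     (\<forall>t. g (t + 1) = g t) \<and> inj_on g {0..<1} \<and> (\<forall>t. curve_deriv g t \<noteq> 0)"

definition circle_curve :: "real \<Rightarrow> real \<Rightarrow> complex" where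
  "circle_curve R t = of_real R * cis (2 * pi * t)"

lemma range_circle_curve:
  assumes "R > 0"
  shows "range (circle_curve R) = frontier (ball 0 R)"
proof
  show "range (circle_curve R) \<subseteq> frontier (ball 0 R)"
    using assms by (auto simp: circle_curve_def norm_mult)
  show "frontier (ball 0 R) \<subseteq> range (circle_curve R)"
  proof
    fix x :: complex assume "x \<in> frontier (ball 0 R)"
    then have "x = of_real R * cis (Arg x)"
      using assms rcis_cmod_Arg[of x] by (simp add: rcis_def)
    then have "x = circle_curve R (Arg x / (2 * pi))"
      by (simp add: circle_curve_def)
    then show "x \<in> range (circle_curve R)" by blast
  qed
qed

text \<open>
  The measure \<open>ds\<close> on the curve \<^term>\<open>range g\<close>. The curve is also the underlying space of the measure, so
  that for a function on the plane only its restriction to the curve matters.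
\<close>

definition arclength :: "(real \<Rightarrow> complex) \<Rightarrow> complex measure" where
  "arclength g = distr (density lborel (\<lambda>t. ennreal (indicator {0..<1} t * cmod (curve_deriv g t))))
                       (restrict_space borel (range g)) g"

section \<open>Complex \<open>L\<^sup>2\<close> spaces\<close>

text \<open>
  Elements are represented by square integrable functions; equality in the Hilbert space is
  equality almost everywhere.
\<close>

definition L2 :: "'a measure \<Rightarrow> ('a \<Rightarrow> complex) set" where
  "L2 M = {f \<in> borel_measurable M. integrable M (\<lambda>x. (cmod (f x))\<^sup>2)}"

definition L2_inner :: "'a measure \<Rightarrow> ('a \<Rightarrow> complex) \<Rightarrow> ('a \<Rightarrow> complex) \<Rightarrow> complex" where
  "L2_inner M f g = (LINT x|M. f x * cnj (g x))"

definition L2_norm :: "'a measure \<Rightarrow> ('a \<Rightarrow> complex) \<Rightarrow> real" where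
  "L2_norm M f = sqrt (LINT x|M. (cmod (f x))\<^sup>2)"

type_synonym 'a fun_pair = "('a \<Rightarrow> complex) \<times> ('a \<Rightarrow> complex)"

text \<open>The product \<open>L\<^sup>2(M\<^sub>1) \<times> L\<^sup>2(M\<^sub>2)\<close> is given by the pair of measures \<open>(M\<^sub>1, M\<^sub>2)\<close>.\<close>

definition prod_L2 :: "'a measure \<times> 'a measure \<Rightarrow> 'a fun_pair set" where
  "prod_L2 X = L2 (fst X) \<times> L2 (snd X)"

definition prod_inner :: "'a measure \<times> 'a measure \<Rightarrow> 'a fun_pair \<Rightarrow> 'a fun_pair \<Rightarrow> complex" where
  "prod_inner X f g = L2_inner (fst X) (fst f) (fst g) + L2_inner (snd X) (snd f) (snd g)"

definition prod_norm :: "'a measure \<times> 'a measure \<Rightarrow> 'a fun_pair \<Rightarrow> real" where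
  "prod_norm X f = sqrt ((L2_norm (fst X) (fst f))\<^sup>2 + (L2_norm (snd X) (snd f))\<^sup>2)"

text \<open>
  The adjoint of a bounded operator \<open>T\<close> from \<open>X\<close> to \<open>Y\<close>; its values are determined up to
  equality almost everywhere.
\<close>

definition L2_adjoint ::
  "'a measure \<times> 'a measure \<Rightarrow> 'a measure \<times> 'a measure \<Rightarrow> ('a fun_pair \<Rightarrow> 'a fun_pair) \<Rightarrow>
   'a fun_pair \<Rightarrow> 'a fun_pair" where
  "L2_adjoint X Y T h =
     (SOME g. g \<in> prod_L2 X \<and> (\<forall>f\<in>prod_L2 X. prod_inner Y (T f) h = prod_inner X f g))"

text \<open>The equation \<open>\<alpha> \<phi> + T\<^sup>* T \<phi> = T\<^sup>* v\<close> in \<open>X\<close>.\<close>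

definition tikhonov_solution ::
  "'a measure \<times> 'a measure \<Rightarrow> 'a measure \<times> 'a measure \<Rightarrow> ('a fun_pair \<Rightarrow> 'a fun_pair) \<Rightarrow>
   real \<Rightarrow> 'a fun_pair \<Rightarrow> 'a fun_pair \<Rightarrow> bool" where
  "tikhonov_solution X Y T \<alpha> v \<phi> \<longleftrightarrow>
     \<phi> \<in> prod_L2 X \<and>
     (AE x in fst X. of_real \<alpha> * fst \<phi> x + fst (L2_adjoint X Y T (T \<phi>)) x = fst (L2_adjoint X Y T v) x) \<and>
     (AE x in snd X. of_real \<alpha> * snd \<phi> x + snd (L2_adjoint X Y T (T \<phi>)) x = snd (L2_adjoint X Y T v) x)"

section \<open>The single-layer operator\<close>

definition single_layer :: "real \<Rightarrow> (real \<Rightarrow> complex) \<Rightarrow> (complex \<Rightarrow> complex) \<Rightarrow> complex \<Rightarrow> complex" where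
  "single_layer k g \<psi> x = (LINT y|arclength g. Phi k x y * \<psi> y)"

definition space_X :: "real \<Rightarrow> real \<Rightarrow> complex measure \<times> complex measure" where
  "space_X R\<^sub>1 R\<^sub>2 = (arclength (circle_curve R\<^sub>1), arclength (circle_curve R\<^sub>2))"

definition space_Y :: "(real \<Rightarrow> complex) \<Rightarrow> (real \<Rightarrow> complex) \<Rightarrow> complex measure \<times> complex measure" where
  "space_Y g\<^sub>1 g\<^sub>2 = (arclength g\<^sub>1, arclength g\<^sub>2)"

text \<open>
  Both components are given by the same formula; the first is regarded as a function on \<open>\<Gamma>\<^sub>1\<close>,
  the second as a function on \<open>\<Gamma>\<^sub>2\<close>. Likewise for the data below.
\<close>

definition S_op :: "real \<Rightarrow> real \<Rightarrow> real \<Rightarrow> complex fun_pair \<Rightarrow> complex fun_pair" where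
  "S_op k R\<^sub>1 R\<^sub>2 \<psi> =
     (\<lambda>x. single_layer k (circle_curve R\<^sub>1) (fst \<psi>) x + single_layer k (circle_curve R\<^sub>2) (snd \<psi>) x,
      \<lambda>x. single_layer k (circle_curve R\<^sub>1) (fst \<psi>) x + single_layer k (circle_curve R\<^sub>2) (snd \<psi>) x)"

definition exact_data :: "real \<Rightarrow> complex \<Rightarrow> (complex \<Rightarrow> complex) \<Rightarrow> complex fun_pair" where
  "exact_data k z us = (\<lambda>x. Phi k x z + us x, \<lambda>x. Phi k x z + us x)"

end

theory Submission
  imports Defs "HOL-Complex_Analysis.Complex_Analysis" "HOL-Library.Function_Algebras"
begin

text \<open>
  By the projection theorem in \<open>X\<close>, the range of \<open>S\<^sup>*\<close> is dense as soon as \<open>S\<close> is injective. If \<open>S \<psi> = 0\<close>,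
  the field \<open>v\<close> generated by the two densities vanishes on \<open>\<Gamma>\<^sub>1 \<union> \<Gamma>\<^sub>2\<close>, hence between these curves, because
  \<open>k\<^sup>2\<close> is not a Dirichlet eigenvalue there, hence by analytic continuation in the annulus between the
  circles \<open>|x| = R\<^sub>1\<close> and \<open>|x| = R\<^sub>2\<close>. These are concentric, so \<open>v\<close> splits into Fourier modes; by Graf's
  addition theorem the \<open>n\<close>-th mode is \<open>p J\<^sub>n(k R\<^sub>1) H\<^sub>n(k r) + q H\<^sub>n(k R\<^sub>2) J\<^sub>n(k r)\<close> with multiples \<open>p\<close>, \<open>q\<close> of the
  \<open>n\<close>-th Fourier coefficients of the densities. The Wronskian of \<open>J\<^sub>n\<close> and \<open>Y\<^sub>n\<close> never vanishes,
  \<open>J\<^sub>n(k R\<^sub>1) \<noteq> 0\<close> because \<open>k\<^sup>2\<close> is not an eigenvalue of the inner disc, and \<open>H\<^sub>n\<close> has no positive zero, so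
  \<open>p = q = 0\<close>.

  Only \<open>J\<^sub>0\<close> and \<open>Y\<^sub>0\<close> are needed: in the variable \<open>w = r\<^sup>2\<close>, the functions \<open>J\<^sub>n(k r)\<close> and \<open>H\<^sub>n(k r)\<close> are, up to
  constants, \<open>r\<^sup>n\<close> times the \<open>n\<close>-th derivatives of \<open>J\<^sub>0(k \<surd>w)\<close> and \<open>H\<^sub>0(k \<surd>w)\<close>, and differentiating the
  Bessel equation \<open>w y'' + c y' + (k\<^sup>2/4) y = 0\<close> only raises \<open>c\<close> by one.
\<close>


section \<open>Real semi-inner product spaces\<close>

text \<open>Elements of L^2 are plain functions, so norms vanish on null functions and
  \<open>L2_adjoint\<close> picks an arbitrary representative. This is why the projection theorem is
  proved for semi-inner products and why the dense subspace consists of all representatives of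
  adjoint values. The potentials depend on |x - y|, which is not holomorphic in x, and yet they must
  be continued and expanded. The variable w = |x - y|^2 = (x - y) (cnj x - cnj y) makes both
  explicit: once cnj x is replaced by an independent complex variable, the kernel is holomorphic up
  to the branch of one logarithm. This serves three times: for Graf's coefficients (cnj a becomes q
  / a), for the Helmholtz equation (the mixed derivative of F(w) is w F'' + F'), and for the
  continuation (x = exp a, cnj x = exp b). Part (b) is algebra in two semi-inner product spaces: it
  rests on the adjoint identity, the weak form of the Tikhonov equation and the two residual
  bounds.\<close>

lemma quadratic_nonneg_imp:
  fixes a b c :: real
  assumes "\<And>t. 0 \<le> a - 2 * t * b + t\<^sup>2 * c" "0 \<le> c"
  shows "b\<^sup>2 \<le> a * c"
proof (cases "c = 0")
  case True
  show ?thesis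
  proof (cases "b = 0")
    case False
    \<comment> \<open>With c = 0 the form is affine in t; this choice of t makes its value
      -1.\<close>
    have "0 \<le> a - 2 * ((a + 1) / (2 * b)) * b"
      using assms(1)[of "(a + 1) / (2 * b)"] True by simp
    also have "\<dots> = -1" using False by (simp add: field_simps)
    finally show ?thesis by simp
  qed (use True in simp)
next
  case False
  then have c: "c > 0" using assms(2) by simp
  have "0 \<le> a - 2 * (b / c) * b + (b / c)\<^sup>2 * c" by (rule assms(1))
  also have "\<dots> = (a * c - b\<^sup>2) / c" using c by (simp add: field_simps power2_eq_square)
  finally show ?thesis using c by (simp add: zero_le_divide_iff)
qed

text \<open>Real scalars and the real part of a complex inner product are enough for the projection
  argument. Definiteness is absent because distinct functions may agree almost everywhere.
  \<open>ip_sym\<close> and \<open>ip_nonneg\<close> carry no membership condition: the Bochner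
  integral of a non-integrable function is 0, so they hold for all functions.\<close>

locale real_semi_inner =
  fixes V :: "'v::ab_group_add set" and sc :: "real \<Rightarrow> 'v \<Rightarrow> 'v" and ip :: "'v \<Rightarrow> 'v \<Rightarrow> real"
  assumes add_mem: "f \<in> V \<Longrightarrow> g \<in> V \<Longrightarrow> f + g \<in> V"
    and diff_mem: "f \<in> V \<Longrightarrow> g \<in> V \<Longrightarrow> f - g \<in> V"
    and sc_mem: "f \<in> V \<Longrightarrow> sc c f \<in> V"
    and ip_add: "f \<in> V \<Longrightarrow> g \<in> V \<Longrightarrow> h \<in> V \<Longrightarrow> ip (f + g) h = ip f h + ip g h"
    and ip_diff: "f \<in> V \<Longrightarrow> g \<in> V \<Longrightarrow> h \<in> V \<Longrightarrow> ip (f - g) h = ip f h - ip g h"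
    and ip_sc: "f \<in> V \<Longrightarrow> g \<in> V \<Longrightarrow> ip (sc c f) g = c * ip f g"
    and ip_sym: "ip f g = ip g f"
    and ip_nonneg: "0 \<le> ip f f"
begin

definition nrm :: "'v \<Rightarrow> real" where "nrm f = sqrt (ip f f)"

lemma nrm_nonneg: "0 \<le> nrm f"
  by (simp add: nrm_def ip_nonneg)

lemma nrm_sq: "(nrm f)\<^sup>2 = ip f f"
  by (simp add: nrm_def ip_nonneg)

lemma ip_add_right: "f \<in> V \<Longrightarrow> g \<in> V \<Longrightarrow> h \<in> V \<Longrightarrow> ip h (f + g) = ip h f + ip h g"
  using ip_add[of f g h] by (simp add: ip_sym)

lemma ip_diff_right: "f \<in> V \<Longrightarrow> g \<in> V \<Longrightarrow> h \<in> V \<Longrightarrow> ip h (f - g) = ip h f - ip h g"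
  using ip_diff[of f g h] by (simp add: ip_sym)

lemma ip_sc_right: "f \<in> V \<Longrightarrow> g \<in> V \<Longrightarrow> ip g (sc c f) = c * ip g f"
  using ip_sc[of f g c] by (simp add: ip_sym)

lemma ip_diff_scale:
  assumes "f \<in> V" "g \<in> V"
  shows "ip (f - sc t g) (f - sc t g) = ip f f - 2 * t * ip f g + t\<^sup>2 * ip g g"
  using assms ip_sym[of g f] by (simp add: ip_diff ip_diff_right ip_sc ip_sc_right diff_mem sc_mem
      power2_eq_square algebra_simps)

lemma ip_cauchy_schwarz:
  assumes "f \<in> V" "g \<in> V"
  shows "\<bar>ip f g\<bar> \<le> nrm f * nrm g"
proof -
  have "(ip f g)\<^sup>2 \<le> ip f f * ip g g"
    by (rule quadratic_nonneg_imp) (use ip_diff_scale[OF assms] ip_nonneg in metis)+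
  then have "\<bar>ip f g\<bar> \<le> sqrt (ip f f * ip g g)"
    by (metis real_sqrt_abs real_sqrt_le_iff)
  then show ?thesis by (simp add: nrm_def real_sqrt_mult)
qed

lemma nrm_triangle:
  assumes "f \<in> V" "g \<in> V"
  shows "nrm (f + g) \<le> nrm f + nrm g"
proof (rule power2_le_imp_le)
  have "(nrm (f + g))\<^sup>2 = ip f f + 2 * ip f g + ip g g"
    using assms ip_sym[of g f] by (simp add: nrm_sq ip_add ip_add_right add_mem)
  also have "\<dots> \<le> ip f f + 2 * (nrm f * nrm g) + ip g g"
    using ip_cauchy_schwarz[OF assms] by linarith
  also have "\<dots> = (nrm f + nrm g)\<^sup>2" by (simp add: power2_sum nrm_sq)
  finally show "(nrm (f + g))\<^sup>2 \<le> (nrm f + nrm g)\<^sup>2" .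
qed (simp add: nrm_nonneg)

lemma nrm_triangle_diff:
  assumes "f \<in> V" "g \<in> V" "h \<in> V"
  shows "nrm (f - h) \<le> nrm (f - g) + nrm (g - h)"
  using nrm_triangle[of "f - g" "g - h"] assms by (simp add: diff_mem)

lemma nrm_diff_commute:
  assumes "f \<in> V" "g \<in> V"
  shows "nrm (f - g) = nrm (g - f)"
  using assms by (simp add: nrm_def ip_diff ip_diff_right diff_mem ip_sym)

lemma parallelogram:
  assumes "f \<in> V" "a \<in> V" "b \<in> V"
  shows "ip (a - b) (a - b) = 2 * ip (f - a) (f - a) + 2 * ip (f - b) (f - b)
            - 4 * ip (f - sc (1/2) (a + b)) (f - sc (1/2) (a + b))"
  using assms by (simp add: ip_diff ip_diff_right ip_sc ip_sc_right ip_add ip_add_right diff_mem add_mem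
      sc_mem ip_sym[of b f] ip_sym[of a f] ip_sym[of b a] algebra_simps)

text \<open>A minimising sequence in \<open>W\<close> is Cauchy by the parallelogram law, because
  midpoints stay in \<open>W\<close>. Its limit \<open>h\<close> may leave \<open>W\<close>, but f -
  h still has minimal length along every direction of \<open>W\<close>; hence it is orthogonal to
  \<open>W\<close> and null. A late member of the sequence is then the approximant.\<close>

lemma dense_if_orthogonal_null:
  assumes W: "W \<subseteq> V" "W \<noteq> {}" "\<And>f g. f \<in> W \<Longrightarrow> g \<in> W \<Longrightarrow> f + g \<in> W" "\<And>f c. f \<in> W \<Longrightarrow> sc c f \<in> W"
    and complete: "\<And>s. (\<And>n. s n \<in> V) \<Longrightarrow> (\<And>e. e > 0 \<Longrightarrow> \<exists>N. \<forall>m\<ge>N. \<forall>n\<ge>N. nrm (s m - s n) < e) \<Longrightarrow>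
        \<exists>h\<in>V. (\<lambda>n::nat. nrm (s n - h)) \<longlonglongrightarrow> 0"
    and orth: "\<And>f. f \<in> V \<Longrightarrow> (\<And>g. g \<in> W \<Longrightarrow> ip f g = 0) \<Longrightarrow> nrm f = 0"
    and f: "f \<in> V" and e: "e > 0"
  shows "\<exists>g\<in>W. nrm (f - g) < e"
proof -
  define d where "d = (INF g\<in>W. nrm (f - g))"
  have bdd: "bdd_below ((\<lambda>g. nrm (f - g)) ` W)"
    by (rule bdd_belowI[where m=0]) (auto simp: nrm_nonneg)
  have d_le: "d \<le> nrm (f - g)" if "g \<in> W" for g
    unfolding d_def by (rule cINF_lower[OF bdd that])
  have d0: "0 \<le> d"
    unfolding d_def by (rule cINF_greatest) (use W nrm_nonneg in auto)
  have "\<exists>g\<in>W. nrm (f - g) < d + 1 / real (Suc n)" for n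
    using cINF_less_iff[OF W(2) bdd, of "d + 1 / real (Suc n)"] by (simp add: d_def)
  then obtain s where s: "\<And>n. s n \<in> W" "\<And>n. nrm (f - s n) < d + 1 / real (Suc n)"
    by metis
  have sV: "s n \<in> V" for n using s W by blast
  \<comment> \<open>Since 1 / (N + 1)^2 is at most 1 / (N + 1), the square of d + 1 / (N + 1)
    exceeds d^2 by at most (2 d + 1) / (N + 1).\<close>
  have sq: "ip (f - s n) (f - s n) \<le> d\<^sup>2 + (2 * d + 1) / real (Suc N)" if "n \<ge> N" for n N
  proof -
    have "1 / real (Suc n) \<le> 1 / real (Suc N)" using that by (simp add: frac_le)
    then have "nrm (f - s n) \<le> d + 1 / real (Suc N)" using s(2)[of n] by linarith
    then have "(nrm (f - s n))\<^sup>2 \<le> (d + 1 / real (Suc N))\<^sup>2" by (intro power_mono nrm_nonneg)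
    also have "\<dots> = d\<^sup>2 + 2 * d / real (Suc N) + (1 / real (Suc N))\<^sup>2"
      by (simp add: power2_sum)
    also have "(1 / real (Suc N))\<^sup>2 \<le> 1 / real (Suc N)"
      by (intro power_decreasing[where n=1 and N=2, simplified]) auto
    finally show ?thesis by (simp add: nrm_sq add_divide_distrib)
  qed
  have cauchy: "\<exists>N. \<forall>m\<ge>N. \<forall>n\<ge>N. nrm (s m - s n) < r" if "r > 0" for r
  proof -
    obtain N where N: "(4 * (2 * d + 1)) / r\<^sup>2 < real N" using reals_Archimedean2 by blast
    have bound: "4 * ((2 * d + 1) / real (Suc N)) < r\<^sup>2"
    proof -
      have "(4 * (2 * d + 1)) / r\<^sup>2 < real (Suc N)" using N by simp
      then show ?thesis using that by (simp add: divide_less_eq mult.commute del: of_nat_Suc)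
    qed
    have "nrm (s m - s n) < r" if mn: "m \<ge> N" "n \<ge> N" for m n
    proof -
      have "sc (1/2) (s m + s n) \<in> W" using s W by blast
      then have "d\<^sup>2 \<le> (nrm (f - sc (1/2) (s m + s n)))\<^sup>2" using d_le d0 by (intro power_mono) auto
      then have "ip (s m - s n) (s m - s n) \<le> 4 * ((2 * d + 1) / real (Suc N))"
        using parallelogram[OF f sV sV, of m n] sq[OF mn(1)] sq[OF mn(2)] unfolding nrm_sq by linarith
      then have "(nrm (s m - s n))\<^sup>2 < r\<^sup>2" using bound by (simp add: nrm_sq)
      then show ?thesis by (rule power2_less_imp_less) (use \<open>r > 0\<close> in auto)
    qed
    then show ?thesis by blast
  qed
  obtain h where h: "h \<in> V" "(\<lambda>n. nrm (s n - h)) \<longlonglongrightarrow> 0"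
    using complete[of s, OF sV cauchy] by blast
  define p where "p = f - h"
  have pV: "p \<in> V" using f h by (simp add: p_def diff_mem)
  have lim_inv: "(\<lambda>n. d + 1 / real (Suc n)) \<longlonglongrightarrow> d"
    using tendsto_add[OF tendsto_const[of d] LIMSEQ_inverse_real_of_nat] by (simp add: inverse_eq_divide)
  have p_le: "nrm p \<le> d"
  proof (rule LIMSEQ_le_const)
    show "(\<lambda>n. (d + 1 / real (Suc n)) + nrm (s n - h)) \<longlonglongrightarrow> d"
      using tendsto_add[OF lim_inv h(2)] by simp
    have "nrm p \<le> d + 1 / real (Suc n) + nrm (s n - h)" for n
      using nrm_triangle_diff[OF f sV h(1), of n] s(2)[of n] unfolding p_def by linarith
    then show "\<exists>N. \<forall>n\<ge>N. nrm p \<le> d + 1 / real (Suc n) + nrm (s n - h)" by blast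
  qed
  have p_orth: "ip p g = 0" if g: "g \<in> W" for g
  proof -
    have gV: "g \<in> V" using g W by blast
    \<comment> \<open>\<open>h\<close> itself need not lie in \<open>W\<close>, so the bound by
      \<open>d\<close> is taken at \<open>s n + sc t g\<close> and passed to the limit.\<close>
    have ge: "d \<le> nrm (p - sc t g)" for t
    proof (rule LIMSEQ_le_const)
      show "(\<lambda>n. nrm (p - sc t g) + nrm (s n - h)) \<longlonglongrightarrow> nrm (p - sc t g)"
        using tendsto_add[OF tendsto_const h(2)] by simp
      have "d \<le> nrm (p - sc t g) + nrm (s n - h)" for n
      proof -
        have "d \<le> nrm (f - (s n + sc t g))" by (rule d_le) (use s g W in blast)
        also have "f - (s n + sc t g) = (p - sc t g) + (h - s n)" by (simp add: p_def algebra_simps)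
        also have "nrm \<dots> \<le> nrm (p - sc t g) + nrm (h - s n)"
          by (intro nrm_triangle diff_mem sc_mem pV gV h sV)
        finally show ?thesis using nrm_diff_commute[OF h(1) sV] by simp
      qed
      then show "\<exists>N. \<forall>n\<ge>N. d \<le> nrm (p - sc t g) + nrm (s n - h)" by blast
    qed
    have "0 \<le> 0 - 2 * t * ip p g + t\<^sup>2 * ip g g" for t
    proof -
      have "(nrm p)\<^sup>2 \<le> d\<^sup>2" using p_le nrm_nonneg by (intro power_mono) auto
      also have "\<dots> \<le> (nrm (p - sc t g))\<^sup>2" using ge d0 by (intro power_mono) auto
      finally show ?thesis using ip_diff_scale[OF pV gV, of t] by (simp add: nrm_sq)
    qed
    then have "(ip p g)\<^sup>2 \<le> 0 * ip g g" by (rule quadratic_nonneg_imp) (rule ip_nonneg)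
    then show ?thesis by simp
  qed
  have p0: "nrm p = 0" by (rule orth[OF pV p_orth])
  obtain n where "nrm (s n - h) < e"
    using order_tendstoD(2)[OF h(2) e] by (auto simp: eventually_sequentially)
  moreover have "nrm (f - s n) \<le> nrm (f - h) + nrm (h - s n)" by (rule nrm_triangle_diff[OF f h(1) sV])
  ultimately have "nrm (f - s n) < e" using p0 nrm_diff_commute[OF h(1) sV] by (simp add: p_def)
  then show ?thesis using s(1) by blast
qed

end

text \<open>
  The discrepancy principle makes the Tikhonov solution \<open>\<phi>\<close> at most as long as \<open>\<phi>s\<close>, so
  \<open>\<parallel>\<phi> - \<phi>s\<parallel>\<^sup>2 \<le> 2 \<langle>\<phi>s - \<phi>, \<phi>s\<rangle>\<close>; splitting \<open>\<phi>s = (\<phi>s - T\<^sup>* h) + T\<^sup>* h\<close> gives a quadratic inequality.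
\<close>

lemma tikhonov_source_bound:
  fixes T :: "'v::ab_group_add \<Rightarrow> 'w::ab_group_add"
  assumes X: "real_semi_inner VX scX ipX" and Y: "real_semi_inner VY scY ipY"
    and T: "\<And>f. f \<in> VX \<Longrightarrow> T f \<in> VY" "\<And>f g. f \<in> VX \<Longrightarrow> g \<in> VX \<Longrightarrow> T (f - g) = T f - T g"
    and mem: "\<phi> \<in> VX" "\<phi>s \<in> VX" "v \<in> VY" "h \<in> VY" "g \<in> VX"
    and adj: "\<And>f. f \<in> VX \<Longrightarrow> ipY (T f) h = ipX f g"
    and eq: "\<And>f. f \<in> VX \<Longrightarrow> \<alpha> * ipX f \<phi> + ipY (T f) (T \<phi> - v) = 0" and "\<alpha> > 0"
    and disc: "real_semi_inner.nrm ipY (T \<phi> - v) = \<eta>"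
    and err: "real_semi_inner.nrm ipY (T \<phi>s - v) \<le> \<eta>"
    and src: "real_semi_inner.nrm ipX (\<phi>s - g) \<le> \<epsilon>"
    and h: "real_semi_inner.nrm ipY h \<le> E"
  shows "real_semi_inner.nrm ipX (\<phi> - \<phi>s) \<le> 2 * \<epsilon> + 2 * sqrt (\<eta> * E)"
proof -
  interpret X: real_semi_inner VX scX ipX by fact
  interpret Y: real_semi_inner VY scY ipY by fact
  define f where "f = \<phi>s - \<phi>"
  have f: "f \<in> VX" using mem by (simp add: f_def X.diff_mem)
  define r where "r = T \<phi> - v"
  have r: "r \<in> VY" using mem T by (simp add: r_def Y.diff_mem)
  have Tf: "T f \<in> VY" using T f by blast
  have split: "T \<phi>s - v = T f + r" using mem by (simp add: f_def r_def T)
  have \<eta>: "0 \<le> \<eta>" using disc Y.nrm_nonneg by metis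
  have E: "0 \<le> E" using h Y.nrm_nonneg order_trans by blast
  have eps: "0 \<le> \<epsilon>" using src X.nrm_nonneg order_trans by blast
  have "(Y.nrm (T \<phi>s - v))\<^sup>2 \<le> \<eta>\<^sup>2" using err Y.nrm_nonneg by (intro power_mono) auto
  moreover have "(Y.nrm r)\<^sup>2 = \<eta>\<^sup>2" using disc by (simp add: r_def)
  moreover have "(Y.nrm (T \<phi>s - v))\<^sup>2 = Y.nrm (T f)^2 + 2 * ipY (T f) r + (Y.nrm r)\<^sup>2"
    using Tf r Y.ip_sym[of r "T f"] by (simp add: split Y.nrm_sq Y.ip_add Y.ip_add_right Y.add_mem)
  \<comment> \<open>The residual of \<open>\<phi>s\<close> is \<open>T f + r\<close> and is no
    longer than \<open>r\<close>, so \<open>T f\<close> cannot have a positive component along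
    \<open>r\<close>. The Tikhonov equation tested with \<open>f\<close> turns this into a sign for
    \<open>ipX f \<phi>\<close>.\<close>
  ultimately have "ipY (T f) r \<le> 0"
    using zero_le_power2[of "Y.nrm (T f)"] by linarith
  then have "\<alpha> * ipX f \<phi> \<ge> 0" using eq[OF f] by (simp add: r_def)
  then have pos: "ipX f \<phi> \<ge> 0" using \<open>\<alpha> > 0\<close> by (simp add: zero_le_mult_iff)
  define x where "x = X.nrm f"
  have x0: "0 \<le> x" by (simp add: x_def X.nrm_nonneg)
  \<comment> \<open>The sign just found allows \<open>ipX f \<phi>\<close> to be dropped, which
    leaves the bound by \<open>ipX f \<phi>s\<close> with factor 1.\<close>
  have "x\<^sup>2 = ipX f \<phi>s - ipX f \<phi>"
    using f mem by (simp add: x_def X.nrm_sq f_def X.ip_diff_right X.diff_mem)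
  also have "\<dots> \<le> ipX f \<phi>s" using pos by simp
  also have "\<dots> = ipX f (\<phi>s - g) + ipY (T f) h"
    using f mem adj by (simp add: X.ip_diff_right)
  also have "ipX f (\<phi>s - g) \<le> x * \<epsilon>"
    using X.ip_cauchy_schwarz[OF f X.diff_mem[OF mem(2,5)]] src x0
    by (smt (verit) mult_left_mono x_def)
  \<comment> \<open>\<open>T f\<close> is the difference of two residuals of norm at most \<eta>,
    which is the origin of the factor 2.\<close>
  also have "ipY (T f) h \<le> (2 * \<eta>) * E"
  proof -
    have "T f = (T \<phi>s - v) - r" by (simp add: split)
    moreover have "Y.nrm ((T \<phi>s - v) - r) \<le> Y.nrm (T \<phi>s - v) + Y.nrm r"
    proof -
      have z: "T \<phi>s - v \<in> VY" "0 \<in> VY" using mem T Y.diff_mem[of v v] by (auto intro: Y.diff_mem)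
      show ?thesis using Y.nrm_triangle_diff[OF z r] Y.nrm_diff_commute[OF z(2) r] by simp
    qed
    ultimately have "Y.nrm (T f) \<le> 2 * \<eta>" using err disc by (simp add: r_def)
    then have "Y.nrm (T f) * Y.nrm h \<le> (2 * \<eta>) * E"
      using h \<eta> Y.nrm_nonneg by (intro mult_mono) auto
    then show ?thesis using Y.ip_cauchy_schwarz[OF Tf mem(4)] by linarith
  qed
  finally have quad: "x\<^sup>2 \<le> x * \<epsilon> + (2 * \<eta>) * E" by simp
  define s where "s = sqrt (\<eta> * E)"
  have s: "0 \<le> s" "s\<^sup>2 = \<eta> * E" using \<eta> E by (auto simp: s_def)
  have "x \<le> 2 * \<epsilon> + 2 * s"
  proof (rule ccontr)
    assume "\<not> ?thesis"
    then have gt: "2 * \<epsilon> + 2 * s < x" by simp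
    \<comment> \<open>Above the threshold, x is at least 2 s, so x \<epsilon> + 2 s^2 is at most x
      (\<epsilon> + s) < x^2, against \<open>quad\<close>.\<close>
    have "(2 * s) * s \<le> x * s" using s(1) gt eps by (intro mult_right_mono) auto
    then have "x * \<epsilon> + 2 * s\<^sup>2 \<le> x * \<epsilon> + x * s" by (simp add: power2_eq_square)
    also have "\<dots> = x * (\<epsilon> + s)" by (simp add: algebra_simps)
    also have "\<dots> < x * x" using gt eps s by (intro mult_strict_left_mono) auto
    finally show False using quad s(2) by (simp add: power2_eq_square)
  qed
  then show ?thesis
    using X.nrm_diff_commute[OF mem(1,2)] by (simp add: x_def f_def s_def)
qed


section \<open>Square integrable functions\<close>

lemma borel_measurable_cnj[measurable (raw)]:
  "f \<in> borel_measurable M \<Longrightarrow> (\<lambda>x. cnj (f x)) \<in> borel_measurable M"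
  by (erule measurable_compose, rule borel_measurable_continuous_onI) (intro continuous_intros)

lemma L2_borel[measurable_dest]: "f \<in> L2 M \<Longrightarrow> f \<in> borel_measurable M"
  by (simp add: L2_def)

lemma L2_integrable_square: "f \<in> L2 M \<Longrightarrow> integrable M (\<lambda>x. (cmod (f x))\<^sup>2)"
  by (simp add: L2_def)

lemma integrable_mult_of_squares:
  fixes f g :: "'a \<Rightarrow> complex"
  assumes [measurable]: "f \<in> borel_measurable M" "g \<in> borel_measurable M"
    and "integrable M (\<lambda>x. (cmod (f x))\<^sup>2)" "integrable M (\<lambda>x. (cmod (g x))\<^sup>2)"
  shows "integrable M (\<lambda>x. f x * g x)"
proof (rule Bochner_Integration.integrable_bound)
  show "integrable M (\<lambda>x. (cmod (f x))\<^sup>2 + (cmod (g x))\<^sup>2)" using assms by simp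
  show "AE x in M. norm (f x * g x) \<le> norm ((cmod (f x))\<^sup>2 + (cmod (g x))\<^sup>2)"
  proof (rule AE_I2)
    fix x
    have "2 * (cmod (f x) * cmod (g x)) \<le> (cmod (f x))\<^sup>2 + (cmod (g x))\<^sup>2"
      using sum_squares_bound[of "cmod (f x)" "cmod (g x)"] by simp
    then show "norm (f x * g x) \<le> norm ((cmod (f x))\<^sup>2 + (cmod (g x))\<^sup>2)"
      by (simp add: norm_mult) (smt (verit) mult_nonneg_nonneg norm_ge_zero)
  qed
qed simp

lemma L2_mult_integrable: "f \<in> L2 M \<Longrightarrow> g \<in> L2 M \<Longrightarrow> integrable M (\<lambda>x. f x * g x)"
  by (auto simp: L2_def intro: integrable_mult_of_squares)

lemma L2_cnj: "f \<in> L2 M \<Longrightarrow> (\<lambda>x. cnj (f x)) \<in> L2 M"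
  by (auto simp: L2_def)

lemma L2_mult_cnj_integrable: "f \<in> L2 M \<Longrightarrow> g \<in> L2 M \<Longrightarrow> integrable M (\<lambda>x. f x * cnj (g x))"
  by (rule L2_mult_integrable) (auto intro: L2_cnj)

lemma L2_scale: "f \<in> L2 M \<Longrightarrow> (\<lambda>x. c * f x) \<in> L2 M"
  by (auto simp: L2_def norm_mult power_mult_distrib)

lemma L2_add:
  assumes "f \<in> L2 M" "g \<in> L2 M"
  shows "(\<lambda>x. f x + g x) \<in> L2 M"
proof -
  have [measurable]: "f \<in> borel_measurable M" "g \<in> borel_measurable M"
    using assms by (auto simp: L2_def)
  have "integrable M (\<lambda>x. (cmod (f x + g x))\<^sup>2)"
  proof (rule Bochner_Integration.integrable_bound)
    show "integrable M (\<lambda>x. 2 * (cmod (f x))\<^sup>2 + 2 * (cmod (g x))\<^sup>2)"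
      using assms by (simp add: L2_def)
    show "AE x in M. norm ((cmod (f x + g x))\<^sup>2) \<le> norm (2 * (cmod (f x))\<^sup>2 + 2 * (cmod (g x))\<^sup>2)"
    proof (rule AE_I2)
      fix x
      have "(cmod (f x + g x))\<^sup>2 \<le> (cmod (f x) + cmod (g x))\<^sup>2"
        by (intro power_mono norm_triangle_ineq) simp
      also have "\<dots> \<le> 2 * (cmod (f x))\<^sup>2 + 2 * (cmod (g x))\<^sup>2"
        using sum_squares_bound[of "cmod (f x)" "cmod (g x)"] by (simp add: power2_sum)
      finally show "norm ((cmod (f x + g x))\<^sup>2) \<le> norm (2 * (cmod (f x))\<^sup>2 + 2 * (cmod (g x))\<^sup>2)"
        by simp
    qed
  qed simp
  then show ?thesis by (simp add: L2_def)
qed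

lemma L2_diff: "f \<in> L2 M \<Longrightarrow> g \<in> L2 M \<Longrightarrow> (\<lambda>x. f x - g x) \<in> L2 M"
  using L2_add[of f M "\<lambda>x. -1 * g x"] L2_scale[of g M "-1"] by simp

lemma L2_bounded:
  assumes "finite_measure M" "f \<in> borel_measurable M" "\<And>x. x \<in> space M \<Longrightarrow> cmod (f x) \<le> B"
  shows "f \<in> L2 M"
proof -
  interpret finite_measure M by fact
  note assms(2)[measurable]
  have "integrable M (\<lambda>x. (cmod (f x))\<^sup>2)"
  proof (rule integrable_const_bound[where B="B\<^sup>2"])
    show "AE x in M. norm ((cmod (f x))\<^sup>2) \<le> B\<^sup>2"
      using assms(3) by (intro AE_I2) (simp add: power_mono)
  qed simp
  then show ?thesis using assms by (simp add: L2_def)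
qed

lemma L2_integrable:
  assumes "finite_measure M" "f \<in> L2 M"
  shows "integrable M f"
  using L2_mult_integrable[OF assms(2) L2_bounded[OF assms(1), of "\<lambda>_. 1" 1]] by simp

lemma integral_Cauchy_Schwarz:
  fixes a b :: "'a \<Rightarrow> real"
  assumes a: "integrable M (\<lambda>x. (a x)\<^sup>2)" and b: "integrable M (\<lambda>x. (b x)\<^sup>2)"
    and ab: "integrable M (\<lambda>x. a x * b x)"
  shows "(LINT x|M. a x * b x)\<^sup>2 \<le> (LINT x|M. (a x)\<^sup>2) * (LINT x|M. (b x)\<^sup>2)"
proof (rule quadratic_nonneg_imp)
  fix t :: real
  have "0 \<le> (LINT x|M. (a x - t * b x)\<^sup>2)" by (rule integral_nonneg_AE) simp
  also have "(\<lambda>x. (a x - t * b x)\<^sup>2) = (\<lambda>x. (a x)\<^sup>2 - (2 * t) * (a x * b x) + t\<^sup>2 * (b x)\<^sup>2)"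
    by (simp add: power2_diff power_mult_distrib fun_eq_iff)
  also have "(LINT x|M. (a x)\<^sup>2 - (2 * t) * (a x * b x) + t\<^sup>2 * (b x)\<^sup>2) =
      (LINT x|M. (a x)\<^sup>2) - 2 * t * (LINT x|M. a x * b x) + t\<^sup>2 * (LINT x|M. (b x)\<^sup>2)"
    using assms by (simp add: mult.assoc)
  finally show "0 \<le> (LINT x|M. (a x)\<^sup>2) - 2 * t * (LINT x|M. a x * b x) + t\<^sup>2 * (LINT x|M. (b x)\<^sup>2)" .
qed (rule integral_nonneg_AE, simp)

lemma L2_norm_sq: "(L2_norm M f)\<^sup>2 = (LINT x|M. (cmod (f x))\<^sup>2)"
  by (simp add: L2_norm_def integral_nonneg_AE)

lemma L2_norm_eq_0_iff:
  assumes "f \<in> L2 M"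
  shows "L2_norm M f = 0 \<longleftrightarrow> (AE x in M. f x = 0)"
  using integral_nonneg_eq_0_iff_AE[OF L2_integrable_square[OF assms]]
  by (simp add: L2_norm_def)

lemma L2_inner_self: "L2_inner M f f = of_real (LINT x|M. (cmod (f x))\<^sup>2)"
  unfolding L2_inner_def complex_norm_square[symmetric] by (rule integral_complex_of_real)

lemma L2_inner_cnj: "L2_inner M g f = cnj (L2_inner M f g)"
proof -
  have eq: "(\<lambda>x. g x * cnj (f x)) = (\<lambda>x. cnj (f x * cnj (g x)))" by (simp add: mult.commute)
  show ?thesis unfolding L2_inner_def eq by (rule Bochner_Integration.integral_cnj)
qed

lemma L2_inner_add:
  "f \<in> L2 M \<Longrightarrow> g \<in> L2 M \<Longrightarrow> h \<in> L2 M \<Longrightarrow> L2_inner M (\<lambda>x. f x + g x) h = L2_inner M f h + L2_inner M g h"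
  by (simp add: L2_inner_def distrib_right L2_mult_cnj_integrable)

lemma L2_inner_diff:
  "f \<in> L2 M \<Longrightarrow> g \<in> L2 M \<Longrightarrow> h \<in> L2 M \<Longrightarrow> L2_inner M (\<lambda>x. f x - g x) h = L2_inner M f h - L2_inner M g h"
  by (simp add: L2_inner_def left_diff_distrib L2_mult_cnj_integrable)

lemma L2_inner_scale: "L2_inner M (\<lambda>x. c * f x) g = c * L2_inner M f g"
  by (simp add: L2_inner_def mult.assoc)

lemma L2_inner_cong:
  assumes "AE x in M. f x = f' x" "f \<in> L2 M" "f' \<in> L2 M" "h \<in> L2 M"
  shows "L2_inner M h f = L2_inner M h f'"
  unfolding L2_inner_def
  by (rule integral_cong_AE) (use assms in \<open>auto intro: borel_measurable_integrable L2_mult_cnj_integrable\<close>)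

text \<open>On a finite measure, an \<open>L\<^sup>2\<close>-Cauchy sequence is \<open>L\<^sup>1\<close>-Cauchy, hence has an almost everywhere
  convergent subsequence; Fatou's lemma transfers the limit back to \<open>L\<^sup>2\<close>.\<close>

lemma L2_complete:
  assumes fin: "finite_measure M" and s: "\<And>n. s n \<in> L2 M"
    and cauchy: "\<And>e. e > 0 \<Longrightarrow> \<exists>N. \<forall>m\<ge>N. \<forall>n\<ge>N. L2_norm M (\<lambda>x. s m x - s n x) < e"
  shows "\<exists>h\<in>L2 M. (\<lambda>n. L2_norm M (\<lambda>x. s n x - h x)) \<longlonglongrightarrow> 0"
proof -
  interpret finite_measure M by fact
  have [measurable]: "\<And>n. s n \<in> borel_measurable M" using s by (auto simp: L2_def)
  have si: "integrable M (s n)" for n by (rule L2_integrable[OF fin s])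
  have sd: "integrable M (\<lambda>x. (cmod (s m x - s n x))\<^sup>2)" for m n
    by (rule L2_integrable_square[OF L2_diff[OF s s]])
  define \<mu> where "\<mu> = measure M (space M)"
  have \<mu>: "0 \<le> \<mu>" by (simp add: \<mu>_def)
  have cauchy1: "\<exists>N. \<forall>i\<ge>N. \<forall>j\<ge>N. LINT x|M. norm (s i x - s j x) < e" if e: "e > 0" for e
  proof -
    \<comment> \<open>The L^1 norm is estimated through |z| <= c + |z|^2 / c. With this
      \<open>c\<close> the first part integrates to at most e / 2, and \<open>r\<close> is chosen so
      that the second stays below e / 2. The summand 1 in \<open>\<mu> + 1\<close> keeps the
      denominator positive for a null measure.\<close>
    define c where "c = e / (2 * (\<mu> + 1))"
    have c: "c > 0" using e \<mu> by (simp add: c_def)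
    define r where "r = sqrt (e * c / 2)"
    have r: "r > 0" "r\<^sup>2 = e * c / 2" using e c by (auto simp: r_def)
    obtain N where N: "\<And>m n. m \<ge> N \<Longrightarrow> n \<ge> N \<Longrightarrow> L2_norm M (\<lambda>x. s m x - s n x) < r"
      using cauchy[OF r(1)] by blast
    have "(LINT x|M. norm (s i x - s j x)) < e" if ij: "i \<ge> N" "j \<ge> N" for i j
    proof -
      have "(LINT x|M. (cmod (s i x - s j x))\<^sup>2) = (L2_norm M (\<lambda>x. s i x - s j x))\<^sup>2"
        by (simp add: L2_norm_sq)
      also have "\<dots> < r\<^sup>2" using N[OF ij] by (intro power_strict_mono) (auto simp: L2_norm_def)
      finally have sq: "(LINT x|M. (cmod (s i x - s j x))\<^sup>2) < e * c / 2" by (simp add: r(2))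
      have "(LINT x|M. norm (s i x - s j x)) \<le> (LINT x|M. c + (cmod (s i x - s j x))\<^sup>2 / c)"
      proof (rule integral_mono)
        show "integrable M (\<lambda>x. norm (s i x - s j x))"
          using si by (intro integrable_norm Bochner_Integration.integrable_diff)
        show "integrable M (\<lambda>x. c + (cmod (s i x - s j x))\<^sup>2 / c)" using sd by simp
        fix x
        show "norm (s i x - s j x) \<le> c + (cmod (s i x - s j x))\<^sup>2 / c"
        proof (cases "norm (s i x - s j x) \<le> c")
          case True
          then show ?thesis using c by (smt (verit) divide_nonneg_pos zero_le_power2)
        next
          case False
          then have "norm (s i x - s j x) * c \<le> (norm (s i x - s j x))\<^sup>2"
            unfolding power2_eq_square by (intro mult_left_mono) auto
          then have "norm (s i x - s j x) \<le> (norm (s i x - s j x))\<^sup>2 / c" using c by (simp add: le_divide_eq)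
          then show ?thesis using c by linarith
        qed
      qed
      also have "\<dots> = c * \<mu> + (LINT x|M. (cmod (s i x - s j x))\<^sup>2) / c"
        using sd by (simp add: \<mu>_def)
      also have "\<dots> < c * \<mu> + (e * c / 2) / c"
        using sq c by (intro add_strict_left_mono divide_strict_right_mono)
      also have "\<dots> \<le> e"
      proof -
        have "c * \<mu> \<le> e / 2"
        proof -
          have "e * \<mu> \<le> e * (\<mu> + 1)" using e by (intro mult_left_mono) auto
          then have "e * \<mu> / (2 * (\<mu> + 1)) \<le> e * (\<mu> + 1) / (2 * (\<mu> + 1))"
            using \<mu> by (intro divide_right_mono) auto
          also have "\<dots> = e / 2" using \<mu> by (simp add: field_simps)
          finally show ?thesis by (simp add: c_def)
        qed
        then show ?thesis using c by simp
      qed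
      finally show ?thesis .
    qed
    then show ?thesis by blast
  qed
  obtain q where q: "strict_mono q" and ae: "AE x in M. Cauchy (\<lambda>i. s (q i) x)"
    using cauchy_L1_AE_cauchy_subseq[OF si cauchy1] by blast
  define h where "h = (\<lambda>x. lim (\<lambda>i. s (q i) x))"
  have [measurable]: "h \<in> borel_measurable M" unfolding h_def by measurable
  have lim: "AE x in M. (\<lambda>i. s (q i) x) \<longlonglongrightarrow> h x"
    using ae by eventually_elim (simp add: h_def Cauchy_convergent convergent_LIMSEQ_iff[symmetric])
  have fatou: "(\<integral>\<^sup>+x. ennreal ((cmod (s n x - h x))\<^sup>2) \<partial>M) \<le> ennreal (e\<^sup>2)"
    if "e > 0" and N: "\<And>m n. m \<ge> N \<Longrightarrow> n \<ge> N \<Longrightarrow> L2_norm M (\<lambda>x. s m x - s n x) < e" and n: "n \<ge> N" for e N n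
  proof -
    have "(\<integral>\<^sup>+x. ennreal ((cmod (s n x - h x))\<^sup>2) \<partial>M)
        = (\<integral>\<^sup>+x. liminf (\<lambda>i. ennreal ((cmod (s n x - s (q i) x))\<^sup>2)) \<partial>M)"
    proof (rule nn_integral_cong_AE, use lim in eventually_elim)
      case (elim x)
      have "(\<lambda>i. ennreal ((cmod (s n x - s (q i) x))\<^sup>2)) \<longlonglongrightarrow> ennreal ((cmod (s n x - h x))\<^sup>2)"
        by (intro tendsto_intros elim)
      then show ?case by (rule lim_imp_Liminf[OF sequentially_bot, symmetric])
    qed
    also have "\<dots> \<le> liminf (\<lambda>i. \<integral>\<^sup>+x. ennreal ((cmod (s n x - s (q i) x))\<^sup>2) \<partial>M)"
      by (rule nn_integral_liminf) simp
    also have "\<dots> \<le> ennreal (e\<^sup>2)"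
    proof -
      have "\<forall>\<^sub>F i in sequentially. (\<integral>\<^sup>+x. ennreal ((cmod (s n x - s (q i) x))\<^sup>2) \<partial>M) \<le> ennreal (e\<^sup>2)"
      proof (rule eventually_sequentiallyI)
        fix i assume "i \<ge> N"
        then have "q i \<ge> N" using strict_mono_imp_increasing[OF q, of i] by linarith
        have "(\<integral>\<^sup>+x. ennreal ((cmod (s n x - s (q i) x))\<^sup>2) \<partial>M) = ennreal (LINT x|M. (cmod (s n x - s (q i) x))\<^sup>2)"
          by (rule nn_integral_eq_integral[OF sd]) simp
        also have "\<dots> = ennreal ((L2_norm M (\<lambda>x. s n x - s (q i) x))\<^sup>2)" by (simp add: L2_norm_sq)
        also have "\<dots> \<le> ennreal (e\<^sup>2)"
          using N[OF n \<open>q i \<ge> N\<close>] by (intro ennreal_leI power_mono) (auto simp: L2_norm_def)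
        finally show "(\<integral>\<^sup>+x. ennreal ((cmod (s n x - s (q i) x))\<^sup>2) \<partial>M) \<le> ennreal (e\<^sup>2)" .
      qed
      then have "limsup (\<lambda>i. \<integral>\<^sup>+x. ennreal ((cmod (s n x - s (q i) x))\<^sup>2) \<partial>M) \<le> ennreal (e\<^sup>2)"
        by (rule Limsup_bounded)
      then show ?thesis using Liminf_le_Limsup[of sequentially] by (meson order_trans sequentially_bot)
    qed
    finally show ?thesis .
  qed
  obtain N1 where N1: "\<And>m n. m \<ge> N1 \<Longrightarrow> n \<ge> N1 \<Longrightarrow> L2_norm M (\<lambda>x. s m x - s n x) < 1"
    using cauchy[of 1] by auto
  \<comment> \<open>One tail member at finite distance puts \<open>h\<close> into L^2, as a
    difference of two L^2 functions.\<close>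
  have "integrable M (\<lambda>x. (cmod (s N1 x - h x))\<^sup>2)"
    using fatou[of 1 N1 N1] N1 by (intro integrableI_bounded) (auto simp: le_less_trans)
  then have "(\<lambda>x. s N1 x - h x) \<in> L2 M" by (simp add: L2_def)
  then have hL2: "h \<in> L2 M" using L2_diff[OF s[of N1], of "\<lambda>x. s N1 x - h x"] by simp
  have "(\<lambda>n. L2_norm M (\<lambda>x. s n x - h x)) \<longlonglongrightarrow> 0"
  proof (rule LIMSEQ_I)
    fix r :: real assume r: "r > 0"
    obtain N where N: "\<And>m n. m \<ge> N \<Longrightarrow> n \<ge> N \<Longrightarrow> L2_norm M (\<lambda>x. s m x - s n x) < r / 2"
      using cauchy[of "r / 2"] r by (auto)
    have "L2_norm M (\<lambda>x. s n x - h x) < r" if n: "n \<ge> N" for n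
    proof -
      have "ennreal (LINT x|M. (cmod (s n x - h x))\<^sup>2) = (\<integral>\<^sup>+x. ennreal ((cmod (s n x - h x))\<^sup>2) \<partial>M)"
        by (rule nn_integral_eq_integral[symmetric]) (use L2_integrable_square[OF L2_diff[OF s hL2]] in auto)
      also have "\<dots> \<le> ennreal ((r / 2)\<^sup>2)" by (rule fatou[OF _ N n]) (use r in auto)
      finally have "(L2_norm M (\<lambda>x. s n x - h x))\<^sup>2 \<le> (r / 2)\<^sup>2"
        using r by (simp add: L2_norm_sq ennreal_le_iff)
      then have "L2_norm M (\<lambda>x. s n x - h x) \<le> r / 2" by (rule power2_le_imp_le) (use r in auto)
      then show ?thesis using r by linarith
    qed
    then show "\<exists>no. \<forall>n\<ge>no. norm (L2_norm M (\<lambda>x. s n x - h x) - 0) < r"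
      by (auto simp: L2_norm_def)
  qed
  then show ?thesis using hL2 by blast
qed

section \<open>Products of two L^2 spaces\<close>

definition pair_scale :: "real \<Rightarrow> 'a fun_pair \<Rightarrow> 'a fun_pair" where
  "pair_scale c f = (\<lambda>x. of_real c * fst f x, \<lambda>x. of_real c * snd f x)"

lemma real_semi_inner_prod_L2:
  "real_semi_inner (prod_L2 M) pair_scale (\<lambda>f g. Re (prod_inner M f g))"
proof
  show "0 \<le> Re (prod_inner M f f)" for f
    by (simp add: prod_inner_def L2_inner_self integral_nonneg_AE)
  show "Re (prod_inner M f g) = Re (prod_inner M g f)" for f g
    using L2_inner_cnj[of _ "fst f" "fst g"] L2_inner_cnj[of _ "snd f" "snd g"]
    by (simp add: prod_inner_def)
qed (auto simp: prod_L2_def prod_inner_def pair_scale_def plus_fun_def fun_diff_def L2_add L2_diff L2_scale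
      L2_inner_add L2_inner_diff L2_inner_scale distrib_left)

lemma nrm_prod_L2: "real_semi_inner.nrm (\<lambda>f g. Re (prod_inner M f g)) f = prod_norm M f"
proof -
  interpret real_semi_inner "prod_L2 M" pair_scale "\<lambda>f g. Re (prod_inner M f g)"
    by (rule real_semi_inner_prod_L2)
  show ?thesis unfolding nrm_def prod_norm_def by (simp add: prod_inner_def L2_inner_self L2_norm_sq)
qed

lemma prod_L2_complete:
  assumes fin: "finite_measure (fst M)" "finite_measure (snd M)" and s: "\<And>n. s n \<in> prod_L2 M"
    and cauchy: "\<And>e. e > 0 \<Longrightarrow> \<exists>N. \<forall>m\<ge>N. \<forall>n\<ge>N. prod_norm M (s m - s n) < e"
  shows "\<exists>h\<in>prod_L2 M. (\<lambda>n::nat. prod_norm M (s n - h)) \<longlonglongrightarrow> 0"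
proof -
  have le1: "L2_norm (fst M) (fst f) \<le> prod_norm M f" for f
    unfolding prod_norm_def by (rule real_le_rsqrt) simp
  have le2: "L2_norm (snd M) (snd f) \<le> prod_norm M f" for f
    unfolding prod_norm_def by (rule real_le_rsqrt) simp
  have "\<exists>h\<in>L2 (fst M). (\<lambda>n. L2_norm (fst M) (\<lambda>x. fst (s n) x - h x)) \<longlonglongrightarrow> 0"
  proof (rule L2_complete[OF fin(1)])
    show "fst (s n) \<in> L2 (fst M)" for n using s[of n] by (auto simp: prod_L2_def)
    show "\<exists>N. \<forall>m\<ge>N. \<forall>n\<ge>N. L2_norm (fst M) (\<lambda>x. fst (s m) x - fst (s n) x) < e" if "e > 0" for e
    proof -
      have "L2_norm (fst M) (\<lambda>x. fst (s m) x - fst (s n) x) \<le> prod_norm M (s m - s n)" for m n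
        using le1[of "s m - s n"] by (simp add: fun_diff_def)
      then show ?thesis using cauchy[OF that] by (meson le_less_trans)
    qed
  qed
  then obtain h1 where h1: "h1 \<in> L2 (fst M)" "(\<lambda>n. L2_norm (fst M) (\<lambda>x. fst (s n) x - h1 x)) \<longlonglongrightarrow> 0" by blast
  have "\<exists>h\<in>L2 (snd M). (\<lambda>n. L2_norm (snd M) (\<lambda>x. snd (s n) x - h x)) \<longlonglongrightarrow> 0"
  proof (rule L2_complete[OF fin(2)])
    show "snd (s n) \<in> L2 (snd M)" for n using s[of n] by (auto simp: prod_L2_def)
    show "\<exists>N. \<forall>m\<ge>N. \<forall>n\<ge>N. L2_norm (snd M) (\<lambda>x. snd (s m) x - snd (s n) x) < e" if "e > 0" for e
    proof -
      have "L2_norm (snd M) (\<lambda>x. snd (s m) x - snd (s n) x) \<le> prod_norm M (s m - s n)" for m n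
        using le2[of "s m - s n"] by (simp add: fun_diff_def)
      then show ?thesis using cauchy[OF that] by (meson le_less_trans)
    qed
  qed
  then obtain h2 where h2: "h2 \<in> L2 (snd M)" "(\<lambda>n. L2_norm (snd M) (\<lambda>x. snd (s n) x - h2 x)) \<longlonglongrightarrow> 0" by blast
  have "(\<lambda>n. prod_norm M (s n - (h1, h2))) \<longlonglongrightarrow> sqrt (0\<^sup>2 + 0\<^sup>2)"
    unfolding prod_norm_def using h1(2) h2(2)
    by (intro tendsto_intros) (simp_all add: fun_diff_def)
  moreover have "(h1, h2) \<in> prod_L2 M" using h1 h2 by (simp add: prod_L2_def)
  ultimately show ?thesis by auto
qed

section \<open>Integral operators with a square integrable kernel\<close>

text \<open>The square bound is uniform in the target point x, which suits a kernel with a weak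
  singularity on the source curve. The asymmetry shows in the results: images under
  \<open>op\<close> are bounded functions, while \<open>adj h\<close> is controlled only in
  L^2.\<close>

locale L2_kernel =
  M: finite_measure M + N: finite_measure N
  for M :: "'a measure" and N :: "'b measure" +
  fixes K :: "'b \<Rightarrow> 'a \<Rightarrow> complex" and C :: real
  assumes K_borel[measurable]: "(\<lambda>(x, y). K x y) \<in> borel_measurable (N \<Otimes>\<^sub>M M)"
    and K_sq: "\<And>x. x \<in> space N \<Longrightarrow> integrable M (\<lambda>y. (cmod (K x y))\<^sup>2)"
    and K_bound: "\<And>x. x \<in> space N \<Longrightarrow> (LINT y|M. (cmod (K x y))\<^sup>2) \<le> C"
begin

sublocale NM: pair_sigma_finite N M ..

definition op :: "('a \<Rightarrow> complex) \<Rightarrow> 'b \<Rightarrow> complex" where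
  "op f x = (LINT y|M. K x y * f y)"

definition adj :: "('b \<Rightarrow> complex) \<Rightarrow> 'a \<Rightarrow> complex" where
  "adj h y = (LINT x|N. cnj (K x y) * h x)"

lemma K_borel_section[measurable]: "x \<in> space N \<Longrightarrow> K x \<in> borel_measurable M"
  using measurable_compose[OF measurable_Pair1' K_borel, of x] by simp

lemma K_L2: "x \<in> space N \<Longrightarrow> K x \<in> L2 M"
  by (simp add: L2_def K_sq)

lemma op_integrable: "f \<in> L2 M \<Longrightarrow> x \<in> space N \<Longrightarrow> integrable M (\<lambda>y. K x y * f y)"
  by (intro L2_mult_integrable K_L2)

text \<open>The inequality a b <= a^2 + b^2 yields a bound that is not homogeneous in
  \<open>f\<close> but uniform in \<open>x\<close>, as membership in L^2 and Fubini's theorem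
  require.\<close>

lemma abs_op_bound:
  assumes f: "f \<in> L2 M" and x: "x \<in> space N"
  shows "(LINT y|M. cmod (K x y * f y)) \<le> C + (L2_norm M f)\<^sup>2"
proof -
  have "(LINT y|M. cmod (K x y * f y)) \<le> (LINT y|M. (cmod (K x y))\<^sup>2 + (cmod (f y))\<^sup>2)"
  proof (rule integral_mono)
    show "integrable M (\<lambda>y. cmod (K x y * f y))" by (intro integrable_norm op_integrable f x)
    show "integrable M (\<lambda>y. (cmod (K x y))\<^sup>2 + (cmod (f y))\<^sup>2)"
      using K_sq[OF x] f by (auto simp: L2_def)
    fix y
    have "2 * (cmod (K x y) * cmod (f y)) \<le> (cmod (K x y))\<^sup>2 + (cmod (f y))\<^sup>2"
      using sum_squares_bound[of "cmod (K x y)" "cmod (f y)"] by simp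
    moreover have "0 \<le> cmod (K x y) * cmod (f y)" by simp
    ultimately show "cmod (K x y * f y) \<le> (cmod (K x y))\<^sup>2 + (cmod (f y))\<^sup>2"
      unfolding norm_mult by linarith
  qed
  also have "\<dots> = (LINT y|M. (cmod (K x y))\<^sup>2) + (L2_norm M f)\<^sup>2"
    using K_sq[OF x] f by (simp add: L2_def L2_norm_sq)
  finally show ?thesis using K_bound[OF x] by simp
qed

lemma op_L2:
  assumes f: "f \<in> L2 M"
  shows "op f \<in> L2 N"
proof (rule L2_bounded)
  show "finite_measure N" by (rule N.finite_measure_axioms)
  have [measurable]: "f \<in> borel_measurable M" using f by (simp add: L2_def)
  show "op f \<in> borel_measurable N" unfolding op_def by measurable
  show "cmod (op f x) \<le> C + (L2_norm M f)\<^sup>2" if "x \<in> space N" for x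
    unfolding op_def by (rule order_trans[OF integral_norm_bound abs_op_bound[OF f that]])
qed

lemma K_sq_integrable: "integrable (N \<Otimes>\<^sub>M M) (\<lambda>(x, y). (cmod (K x y))\<^sup>2)"
proof (rule NM.Fubini_integrable)
  show "integrable N (\<lambda>x. LINT y|M. norm (case (x, y) of (x, y) \<Rightarrow> (cmod (K x y))\<^sup>2))"
    using K_bound by (intro N.integrable_const_bound[where B=C] AE_I2) (auto simp: integral_nonneg_AE)
qed (use K_sq in \<open>auto intro: AE_I2\<close>)

lemma kernel_integrable:
  assumes f: "f \<in> L2 M" and h: "h \<in> L2 N"
  shows "integrable (N \<Otimes>\<^sub>M M) (\<lambda>(x, y). K x y * f y * cnj (h x))"
proof (rule NM.Fubini_integrable)
  have [measurable]: "f \<in> borel_measurable M" "h \<in> borel_measurable N" using f h by (auto simp: L2_def)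
  show "(\<lambda>(x, y). K x y * f y * cnj (h x)) \<in> borel_measurable (N \<Otimes>\<^sub>M M)" by measurable
  show "integrable N (\<lambda>x. LINT y|M. norm (case (x, y) of (x, y) \<Rightarrow> K x y * f y * cnj (h x)))"
  proof (rule Bochner_Integration.integrable_bound)
    show "integrable N (\<lambda>x. (C + (L2_norm M f)\<^sup>2) * cmod (h x))"
      using L2_integrable[OF N.finite_measure_axioms h] by simp
    show "AE x in N. norm (LINT y|M. norm (case (x, y) of (x, y) \<Rightarrow> K x y * f y * cnj (h x)))
        \<le> norm ((C + (L2_norm M f)\<^sup>2) * cmod (h x))"
    proof (rule AE_I2)
      fix x assume x: "x \<in> space N"
      have "(LINT y|M. norm (K x y * f y * cnj (h x))) = (LINT y|M. norm (K x y * f y)) * cmod (h x)"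
        by (simp add: norm_mult)
      also have "\<dots> \<le> (C + (L2_norm M f)\<^sup>2) * cmod (h x)"
        using abs_op_bound[OF f x] by (intro mult_right_mono) auto
      finally show "norm (LINT y|M. norm (case (x, y) of (x, y) \<Rightarrow> K x y * f y * cnj (h x)))
        \<le> norm ((C + (L2_norm M f)\<^sup>2) * cmod (h x))" by (simp add: integral_nonneg_AE)
    qed
  qed measurable
  show "AE x in N. integrable M (\<lambda>y. case (x, y) of (x, y) \<Rightarrow> K x y * f y * cnj (h x))"
    using op_integrable[OF f] by (intro AE_I2) simp
qed

text \<open>The locale bounds the sections of the kernel in y, whereas the adjoint integrates over
  x. Fubini makes almost every section in x square integrable; for such y, Cauchy-Schwarz bounds
  |adj h y|^2 by an integrable function of y.\<close>

lemma adj_L2: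
  assumes h: "h \<in> L2 N"
  shows "adj h \<in> L2 M"
proof -
  have [measurable]: "h \<in> borel_measurable N" using h by (simp add: L2_def)
  have swap[measurable]: "(\<lambda>(y, x). K x y) \<in> borel_measurable (M \<Otimes>\<^sub>M N)"
    using measurable_compose[OF measurable_pair_swap' K_borel] by (simp add: case_prod_beta')
  have [measurable]: "adj h \<in> borel_measurable M" unfolding adj_def by measurable
  have int: "integrable (M \<Otimes>\<^sub>M N) (\<lambda>(y, x). (cmod (K x y))\<^sup>2)"
    using NM.integrable_product_swap[OF K_sq_integrable] by (simp add: case_prod_beta')
  interpret MN: pair_sigma_finite M N ..
  have ae: "AE y in M. integrable N (\<lambda>x. (cmod (K x y))\<^sup>2)"
    using MN.AE_integrable_fst'[OF int] by simp
  have "integrable M (\<lambda>y. (cmod (adj h y))\<^sup>2)"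
  proof (rule Bochner_Integration.integrable_bound)
    show "integrable M (\<lambda>y. (LINT x|N. (cmod (K x y))\<^sup>2) * (LINT x|N. (cmod (h x))\<^sup>2))"
      using MN.integrable_fst'[OF int] by simp
    show "AE y in M. norm ((cmod (adj h y))\<^sup>2) \<le> norm ((LINT x|N. (cmod (K x y))\<^sup>2) * (LINT x|N. (cmod (h x))\<^sup>2))"
      using ae AE_space
    proof eventually_elim
      case (elim y)
      have [measurable]: "(\<lambda>x. K x y) \<in> borel_measurable N"
        using measurable_compose[OF measurable_Pair2'[OF elim(2)] K_borel] by simp
      have prod: "integrable N (\<lambda>x. cnj (K x y) * h x)"
        by (rule integrable_mult_of_squares) (use elim L2_integrable_square[OF h] in auto)
      have "(cmod (adj h y))\<^sup>2 \<le> (LINT x|N. cmod (cnj (K x y) * h x))\<^sup>2"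
        unfolding adj_def by (intro power_mono integral_norm_bound) simp
      also have "(\<lambda>x. cmod (cnj (K x y) * h x)) = (\<lambda>x. cmod (K x y) * cmod (h x))"
        by (simp add: norm_mult)
      also have "(LINT x|N. cmod (K x y) * cmod (h x))\<^sup>2 \<le> (LINT x|N. (cmod (K x y))\<^sup>2) * (LINT x|N. (cmod (h x))\<^sup>2)"
        by (rule integral_Cauchy_Schwarz)
          (use elim(1) L2_integrable_square[OF h] integrable_norm[OF prod] in \<open>auto simp: norm_mult\<close>)
      finally show ?case by (simp add: integral_nonneg_AE)
    qed
  qed measurable
  then show ?thesis by (simp add: L2_def)
qed

lemma inner_adj:
  assumes f: "f \<in> L2 M" and h: "h \<in> L2 N"
  shows "L2_inner N (op f) h = L2_inner M f (adj h)"
proof -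
  have "L2_inner N (op f) h = (LINT x|N. LINT y|M. K x y * f y * cnj (h x))"
    unfolding L2_inner_def op_def
    by (rule Bochner_Integration.integral_cong) auto
  also have "\<dots> = (LINT y|M. LINT x|N. K x y * f y * cnj (h x))"
    by (rule NM.Fubini_integral[symmetric]) (rule kernel_integrable[OF f h])
  also have "\<dots> = (LINT y|M. f y * cnj (LINT x|N. cnj (K x y) * h x))"
  proof (rule Bochner_Integration.integral_cong)
    fix y
    have "(LINT x|N. K x y * f y * cnj (h x)) = (LINT x|N. f y * cnj (cnj (K x y) * h x))"
      by (simp add: mult_ac)
    also have "\<dots> = f y * cnj (LINT x|N. cnj (K x y) * h x)"
      by (simp only: integral_mult_right_zero Bochner_Integration.integral_cnj[of N "\<lambda>x. cnj (K x y) * h x"])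
    finally show "(LINT x|N. K x y * f y * cnj (h x)) = f y * cnj (LINT x|N. cnj (K x y) * h x)" .
  qed simp
  finally show ?thesis by (simp add: L2_inner_def adj_def)
qed

end


section \<open>Bessel functions in the variable \<open>w = r\<^sup>2\<close>\<close>

subsection \<open>Everywhere convergent power series\<close>

text \<open>The operator w y'' + y' is (w y')', which acts on monomials by sending w^(n+1) to
  (n+1)^2 w^n.\<close>

lemma power_series_operator:
  fixes c :: "nat \<Rightarrow> complex"
  assumes c: "\<And>w. summable (\<lambda>n. c n * w ^ n)"
  shows "w * (\<Sum>n. diffs (diffs c) n * w ^ n) + (\<Sum>n. diffs c n * w ^ n)
      = (\<Sum>n. (of_nat (Suc n))\<^sup>2 * c (Suc n) * w ^ n)"
proof -
  have s1: "summable (\<lambda>n. diffs c n * w ^ n)" for w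
    by (rule termdiff_converges_all[OF c])
  have s2: "summable (\<lambda>n. diffs (diffs c) n * w ^ n)" for w
    by (rule termdiff_converges_all[OF s1])
  \<comment> \<open>\<open>g 0 = 0\<close>, so an index shift absorbs the factor \<open>w\<close> in
    front of the second derivative.\<close>
  define g where "g n = of_nat n * of_nat (Suc n) * c (Suc n) * w ^ n" for n
  have g_Suc: "g (Suc n) = w * (diffs (diffs c) n * w ^ n)" for n
    by (simp add: g_def diffs_def mult_ac)
  have "summable g"
    using summable_mult[OF s2[of w], of w] by (subst summable_Suc_iff[symmetric]) (simp add: g_Suc)
  then have "(\<Sum>n. g n) = (\<Sum>n. g (Suc n))"
    by (subst suminf_split_head) (auto simp: g_def)
  also have "\<dots> = w * (\<Sum>n. diffs (diffs c) n * w ^ n)"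
    unfolding g_Suc by (rule suminf_mult[OF s2])
  finally have "w * (\<Sum>n. diffs (diffs c) n * w ^ n) + (\<Sum>n. diffs c n * w ^ n) = (\<Sum>n. g n) + (\<Sum>n. diffs c n * w ^ n)"
    by simp
  also have "\<dots> = (\<Sum>n. g n + diffs c n * w ^ n)" by (rule suminf_add[OF \<open>summable g\<close> s1])
  also have "\<dots> = (\<Sum>n. (of_nat (Suc n))\<^sup>2 * c (Suc n) * w ^ n)"
    by (rule arg_cong[of _ _ suminf]) (auto simp: g_def diffs_def power2_eq_square algebra_simps)
  finally show ?thesis .
qed

lemma deriv_deriv_eqI:
  assumes "open U" "w \<in> U"
    and "\<And>w. w \<in> U \<Longrightarrow> (f has_field_derivative f1 w) (at w)"
    and "\<And>w. w \<in> U \<Longrightarrow> (f1 has_field_derivative f2 w) (at w)"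
  shows "deriv f w = f1 w" "deriv (deriv f) w = f2 w"
proof -
  show d1: "deriv f w = f1 w" by (rule DERIV_imp_deriv) (use assms in blast)
  have "(deriv f has_field_derivative f2 w) (at w)"
  proof (rule has_field_derivative_transform_within_open[OF assms(4)[OF assms(2)] assms(1,2)])
    show "f1 x = deriv f x" if "x \<in> U" for x
      using DERIV_imp_deriv[OF assms(3)[OF that]] by simp
  qed
  then show "deriv (deriv f) w = f2 w" by (rule DERIV_imp_deriv)
qed

subsection \<open>The series of \<open>J\<^sub>0\<close> and \<open>Y\<^sub>0\<close>\<close>

text \<open>With \<open>\<kappa> = k\<^sup>2 / 4\<close>, \<open>bes_A \<kappa> (r\<^sup>2)\<close> is \<open>J\<^sub>0(k r)\<close> and \<open>bes_B\<close> is the second series in \<open>Y\<^sub>0\<close>.\<close>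

definition coeff_A :: "real \<Rightarrow> nat \<Rightarrow> complex" where
  "coeff_A \<kappa> m = of_real ((-\<kappa>) ^ m / (fact m)\<^sup>2)"

definition coeff_B :: "real \<Rightarrow> nat \<Rightarrow> complex" where
  "coeff_B \<kappa> m = of_real ((-\<kappa>) ^ m * harm m / (fact m)\<^sup>2)"

definition bes_A :: "real \<Rightarrow> complex \<Rightarrow> complex" where
  "bes_A \<kappa> w = (\<Sum>m. coeff_A \<kappa> m * w ^ m)"

definition bes_B :: "real \<Rightarrow> complex \<Rightarrow> complex" where
  "bes_B \<kappa> w = (\<Sum>m. coeff_B \<kappa> m * w ^ m)"

lemma harm_le_fact: "harm m \<le> (fact m :: real)"
proof -
  have "harm m \<le> real m" for m
  proof (induction m)
    case (Suc m)
    have "inverse (real (Suc m)) \<le> 1" by (simp add: field_simps)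
    then show ?case using Suc by (simp add: harm_Suc)
  qed (simp add: harm_def)
  then show ?thesis using fact_ge_self[of m] by (metis of_nat_fact of_nat_mono order_trans)
qed

text \<open>The factor \<open>h\<close> is 1 for J_0 and the harmonic number for Y_0. A bound by the
  factorial cancels one of the two factorials and leaves an exponential series as majorant.\<close>

lemma summable_coeff_bound:
  assumes "\<And>m. 0 \<le> h m" "\<And>m. h m \<le> fact m"
  shows "summable (\<lambda>m. of_real ((-\<kappa>) ^ m * h m / (fact m)\<^sup>2) * (w::complex) ^ m)"
proof (rule summable_comparison_test')
  show "summable (\<lambda>m. inverse (fact m) * (\<bar>\<kappa>\<bar> * cmod w) ^ m)" by (rule summable_exp)
  fix m :: nat assume "m \<ge> 0"
  have "h m / (fact m)\<^sup>2 \<le> fact m / (fact m)\<^sup>2"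
    by (intro divide_right_mono assms) simp
  also have "\<dots> = inverse (fact m)" by (simp add: power2_eq_square field_simps)
  finally have le: "h m / (fact m)\<^sup>2 \<le> inverse (fact m)" .
  have "norm (of_real ((-\<kappa>) ^ m * h m / (fact m)\<^sup>2) * w ^ m) = h m / (fact m)\<^sup>2 * (\<bar>\<kappa>\<bar> * cmod w) ^ m"
    using assms(1)[of m]
    by (simp add: norm_mult norm_power norm_divide abs_mult power_abs power_mult_distrib)
  also have "\<dots> \<le> inverse (fact m) * (\<bar>\<kappa>\<bar> * cmod w) ^ m" using le by (intro mult_right_mono) auto
  finally show "norm (of_real ((-\<kappa>) ^ m * h m / (fact m)\<^sup>2) * w ^ m) \<le> inverse (fact m) * (\<bar>\<kappa>\<bar> * cmod w) ^ m" .
qed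

lemma summable_coeff_A: "summable (\<lambda>m. coeff_A \<kappa> m * w ^ m)"
  using summable_coeff_bound[of "\<lambda>_. 1" \<kappa> w] by (simp add: coeff_A_def)

lemma summable_coeff_B: "summable (\<lambda>m. coeff_B \<kappa> m * w ^ m)"
  using summable_coeff_bound[of harm \<kappa> w] by (simp add: coeff_B_def harm_le_fact harm_nonneg)

lemma bes_deriv_series:
  fixes c :: "nat \<Rightarrow> complex"
  assumes "\<And>w. summable (\<lambda>m. c m * w ^ m)" and f: "f = (\<lambda>w. \<Sum>m. c m * w ^ m)"
  shows "f holomorphic_on S" "deriv f w = (\<Sum>m. diffs c m * w ^ m)"
    "deriv (deriv f) w = (\<Sum>m. diffs (diffs c) m * w ^ m)"
proof -
  have d: "(f has_field_derivative (\<Sum>m. diffs c m * w ^ m)) (at w)" for w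
    unfolding f by (rule termdiffs_strong_converges_everywhere[OF assms(1)])
  have d2: "((\<lambda>w. \<Sum>m. diffs c m * w ^ m) has_field_derivative (\<Sum>m. diffs (diffs c) m * w ^ m)) (at w)" for w
    by (rule termdiffs_strong_converges_everywhere[OF termdiff_converges_all[OF assms(1)]])
  show "f holomorphic_on S"
    using d unfolding holomorphic_on_def by (metis field_differentiable_def field_differentiable_at_within)
  show "deriv f w = (\<Sum>m. diffs c m * w ^ m)"
    by (rule deriv_deriv_eqI(1)[OF open_UNIV _ d d2]) simp
  show "deriv (deriv f) w = (\<Sum>m. diffs (diffs c) m * w ^ m)"
    by (rule deriv_deriv_eqI(2)[OF open_UNIV _ d d2]) simp
qed

lemma bes_A_holomorphic: "bes_A \<kappa> holomorphic_on S"
  by (rule bes_deriv_series(1)[of "coeff_A \<kappa>"], rule summable_coeff_A) (simp add: bes_A_def fun_eq_iff)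

lemma bes_B_holomorphic: "bes_B \<kappa> holomorphic_on S"
  by (rule bes_deriv_series(1)[of "coeff_B \<kappa>"], rule summable_coeff_B) (simp add: bes_B_def fun_eq_iff)

text \<open>In the variable w = r^2 and with \<kappa> = k^2 / 4, the value c = n + 1 gives Bessel's
  equation of order n for r^n y(r^2).\<close>

definition bessel_eq :: "complex \<Rightarrow> real \<Rightarrow> complex set \<Rightarrow> (complex \<Rightarrow> complex) \<Rightarrow> bool" where
  "bessel_eq c \<kappa> U y \<longleftrightarrow> (\<forall>w\<in>U. w * deriv (deriv y) w + c * deriv y w + of_real \<kappa> * y w = 0)"

lemma coeff_A_Suc: "(of_nat (Suc m))\<^sup>2 * coeff_A \<kappa> (Suc m) = - of_real \<kappa> * coeff_A \<kappa> m"
proof -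
  have "(real (Suc m))\<^sup>2 * ((-\<kappa>) ^ Suc m / (fact (Suc m))\<^sup>2) = - \<kappa> * ((-\<kappa>) ^ m / (fact m)\<^sup>2)"
    by (simp add: power_mult_distrib del: of_nat_Suc)
  from arg_cong[OF this, of complex_of_real] show ?thesis
    by (simp only: coeff_A_def of_real_mult of_real_power of_real_of_nat_eq of_real_minus)
qed

text \<open>The increment 1 / (m + 1) of the harmonic numbers is what separates this recurrence from
  that of \<open>coeff_A\<close>; it produces the derivative series.\<close>

lemma coeff_B_Suc:
  "(of_nat (Suc m))\<^sup>2 * coeff_B \<kappa> (Suc m) = - of_real \<kappa> * coeff_B \<kappa> m + diffs (coeff_A \<kappa>) m"
proof -
  have B: "coeff_B \<kappa> m = coeff_A \<kappa> m * of_real (harm m)" for m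
    by (simp add: coeff_A_def coeff_B_def)
  have "(of_nat (Suc m))\<^sup>2 * coeff_B \<kappa> (Suc m)
      = ((of_nat (Suc m))\<^sup>2 * coeff_A \<kappa> (Suc m)) * of_real (harm m)
        + of_nat (Suc m) * coeff_A \<kappa> (Suc m) * (of_nat (Suc m) * of_real (inverse (real (Suc m))))"
    by (simp add: B harm_Suc power2_eq_square algebra_simps del: of_nat_Suc)
  also have "of_nat (Suc m) * of_real (inverse (real (Suc m))) = (1::complex)"
    by (simp del: of_nat_Suc)
  finally show ?thesis unfolding coeff_A_Suc by (simp add: B diffs_def)
qed

lemma bes_A_ode: "bessel_eq 1 \<kappa> U (bes_A \<kappa>)"
  unfolding bessel_eq_def
proof
  fix w assume "w \<in> U"
  have A: "bes_A \<kappa> = (\<lambda>w. \<Sum>m. coeff_A \<kappa> m * w ^ m)" by (simp add: bes_A_def fun_eq_iff)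
  have "w * deriv (deriv (bes_A \<kappa>)) w + 1 * deriv (bes_A \<kappa>) w = (\<Sum>m. (of_nat (Suc m))\<^sup>2 * coeff_A \<kappa> (Suc m) * w ^ m)"
    unfolding bes_deriv_series(2,3)[OF summable_coeff_A A] mult_1
    by (rule power_series_operator[OF summable_coeff_A])
  also have "\<dots> = (\<Sum>m. - of_real \<kappa> * (coeff_A \<kappa> m * w ^ m))"
    unfolding coeff_A_Suc by (simp add: mult.assoc)
  also have "\<dots> = - of_real \<kappa> * bes_A \<kappa> w"
    unfolding bes_A_def by (rule suminf_mult[OF summable_coeff_A])
  finally show "w * deriv (deriv (bes_A \<kappa>)) w + 1 * deriv (bes_A \<kappa>) w + of_real \<kappa> * bes_A \<kappa> w = 0" by simp
qed

text \<open>The forcing term is made for the logarithm: applying the Bessel operator to Ln w times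
  \<open>bes_A\<close> leaves 2 \<open>deriv (bes_A \<kappa>)\<close>, which -2 \<open>bes_B\<close>
  removes.\<close>

lemma bes_B_ode:
  "w * deriv (deriv (bes_B \<kappa>)) w + deriv (bes_B \<kappa>) w + of_real \<kappa> * bes_B \<kappa> w = deriv (bes_A \<kappa>) w"
proof -
  have A: "bes_A \<kappa> = (\<lambda>w. \<Sum>m. coeff_A \<kappa> m * w ^ m)" by (simp add: bes_A_def fun_eq_iff)
  have B: "bes_B \<kappa> = (\<lambda>w. \<Sum>m. coeff_B \<kappa> m * w ^ m)" by (simp add: bes_B_def fun_eq_iff)
  have "w * deriv (deriv (bes_B \<kappa>)) w + deriv (bes_B \<kappa>) w = (\<Sum>m. (of_nat (Suc m))\<^sup>2 * coeff_B \<kappa> (Suc m) * w ^ m)"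
    unfolding bes_deriv_series(2,3)[OF summable_coeff_B B]
    by (rule power_series_operator[OF summable_coeff_B])
  also have "\<dots> = (\<Sum>m. - of_real \<kappa> * (coeff_B \<kappa> m * w ^ m) + diffs (coeff_A \<kappa>) m * w ^ m)"
    unfolding coeff_B_Suc by (simp add: algebra_simps)
  also have "\<dots> = (\<Sum>m. - of_real \<kappa> * (coeff_B \<kappa> m * w ^ m)) + (\<Sum>m. diffs (coeff_A \<kappa>) m * w ^ m)"
    by (rule suminf_add[symmetric]) (intro summable_mult summable_coeff_B termdiff_converges_all summable_coeff_A)+
  also have "\<dots> = - of_real \<kappa> * bes_B \<kappa> w + deriv (bes_A \<kappa>) w"
    unfolding bes_deriv_series(2)[OF summable_coeff_A A] bes_B_def
    by (subst suminf_mult[OF summable_coeff_B]) simp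
  finally show ?thesis by simp
qed

lemma bessel_eq_deriv:
  assumes "open U" "y holomorphic_on U" "bessel_eq c \<kappa> U y"
  shows "bessel_eq (c + 1) \<kappa> U (deriv y)"
  unfolding bessel_eq_def
proof
  fix w assume w: "w \<in> U"
  have d0: "(y has_field_derivative deriv y w) (at w)"
    by (rule holomorphic_derivI[OF assms(2,1) w])
  have h1: "deriv y holomorphic_on U" by (rule holomorphic_deriv[OF assms(2,1)])
  have d1: "(deriv y has_field_derivative deriv (deriv y) w) (at w)"
    by (rule holomorphic_derivI[OF h1 assms(1) w])
  have d2: "(deriv (deriv y) has_field_derivative deriv (deriv (deriv y)) w) (at w)"
    by (rule holomorphic_derivI[OF holomorphic_deriv[OF h1 assms(1)] assms(1) w])
  have "((\<lambda>w. w * deriv (deriv y) w + c * deriv y w + of_real \<kappa> * y w) has_field_derivative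
      (1 * deriv (deriv y) w + deriv (deriv (deriv y)) w * w + c * deriv (deriv y) w + of_real \<kappa> * deriv y w)) (at w)"
    by (intro DERIV_add DERIV_mult DERIV_cmult DERIV_ident d0 d1 d2)
  moreover have "((\<lambda>w. w * deriv (deriv y) w + c * deriv y w + of_real \<kappa> * y w) has_field_derivative 0) (at w)"
    by (rule has_field_derivative_transform_within_open[OF DERIV_const[of 0] assms(1) w])
      (use assms(3) in \<open>simp add: bessel_eq_def\<close>)
  ultimately have "1 * deriv (deriv y) w + deriv (deriv (deriv y)) w * w + c * deriv (deriv y) w + of_real \<kappa> * deriv y w = 0"
    by (rule DERIV_unique)
  then show "w * deriv (deriv (deriv y)) w + (c + 1) * deriv (deriv y) w + of_real \<kappa> * deriv y w = 0"
    by (simp add: algebra_simps)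
qed

lemma bessel_eq_higher_deriv:
  assumes "open U" "y holomorphic_on U" "bessel_eq c \<kappa> U y"
  shows "bessel_eq (c + of_nat n) \<kappa> U ((deriv ^^ n) y)"
proof (induction n)
  case (Suc n)
  then show ?case
    using bessel_eq_deriv[OF assms(1) holomorphic_higher_deriv[OF assms(2,1)] Suc]
    by (simp add: add_ac)
qed (use assms in simp)

text \<open>The leading coefficient vanishes at w = 0. There the m times differentiated equation
  expresses the derivative of order m + 1 through the one of order m, with the nonzero factor n + 1
  + m, so the value at 0 determines the whole Taylor series.\<close>

lemma bessel_eq_unique:
  assumes y: "y holomorphic_on ball 0 \<rho>" and eq: "bessel_eq (of_nat (Suc n)) \<kappa> (ball 0 \<rho>) y"
    and y0: "y 0 = 0" and w: "w \<in> ball 0 \<rho>"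
  shows "y w = 0"
proof (rule holomorphic_fun_eq_0_on_ball[OF y w])
  have 0: "0 \<in> ball (0::complex) \<rho>" using w by (metis mem_ball dist_self zero_le_dist le_less_trans)
  show "(deriv ^^ m) y 0 = 0" for m
  proof (induction m)
    case (Suc m)
    have "(of_nat (Suc n) + of_nat m) * (deriv ^^ Suc m) y 0 = (0::complex)"
      using bessel_eq_higher_deriv[OF open_ball y eq, of m] 0 Suc unfolding bessel_eq_def by fastforce
    moreover have "of_nat (Suc n) + of_nat m \<noteq> (0::complex)"
      by (metis Suc_neq_Zero add_Suc of_nat_add of_nat_eq_0_iff)
    ultimately show ?case by (metis mult_eq_0_iff)
  qed (use y0 in simp)
qed

lemma bes_A_0: "bes_A \<kappa> 0 = 1"
  unfolding bes_A_def by (subst suminf_finite[of "{0}"]) (auto simp: coeff_A_def)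

text \<open>At w = 0 the differentiated equation is a two-term recursion between consecutive
  derivatives, started at the value 1.\<close>

lemma bes_A_deriv_0_nonzero:
  assumes "\<kappa> > 0"
  shows "(deriv ^^ n) (bes_A \<kappa>) 0 \<noteq> 0"
proof (induction n)
  case (Suc n)
  have "(1 + of_nat n) * (deriv ^^ Suc n) (bes_A \<kappa>) 0 + of_real \<kappa> * (deriv ^^ n) (bes_A \<kappa>) 0 = 0"
    using bspec[OF bessel_eq_higher_deriv[OF open_UNIV bes_A_holomorphic[of \<kappa>] bes_A_ode[of \<kappa>], of n,
          unfolded bessel_eq_def], of 0] by simp
  then show ?case using Suc assms by auto
qed (simp add: bes_A_0)

subsection \<open>The singular solution\<close>

abbreviation slit :: "complex set" where "slit \<equiv> - \<real>\<^sub>\<le>\<^sub>0"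

lemma open_slit: "open slit"
  by (simp add: open_Compl closed_nonpos_Reals_complex)

text \<open>With w = r^2 one has Ln w = 2 ln r, so this is pi Y_0(k r) minus the multiple 2 (ln (k /
  2) + Euler's constant) of J_0(k r).\<close>

definition bes_Y :: "real \<Rightarrow> complex \<Rightarrow> complex" where
  "bes_Y \<kappa> w = Ln w * bes_A \<kappa> w - 2 * bes_B \<kappa> w"

lemma DERIV_bes_A: "(bes_A \<kappa> has_field_derivative deriv (bes_A \<kappa>) w) (at w)"
  by (rule holomorphic_derivI[OF bes_A_holomorphic[of _ UNIV] open_UNIV]) simp

lemma DERIV_bes_A': "(deriv (bes_A \<kappa>) has_field_derivative deriv (deriv (bes_A \<kappa>)) w) (at w)"
  by (rule holomorphic_derivI[OF holomorphic_deriv[OF bes_A_holomorphic[of _ UNIV]] open_UNIV]) simp_all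

lemma DERIV_bes_B: "(bes_B \<kappa> has_field_derivative deriv (bes_B \<kappa>) w) (at w)"
  by (rule holomorphic_derivI[OF bes_B_holomorphic[of _ UNIV] open_UNIV]) simp

lemma DERIV_bes_B': "(deriv (bes_B \<kappa>) has_field_derivative deriv (deriv (bes_B \<kappa>)) w) (at w)"
  by (rule holomorphic_derivI[OF holomorphic_deriv[OF bes_B_holomorphic[of _ UNIV]] open_UNIV]) simp_all

lemma bes_Y_holomorphic: "bes_Y \<kappa> holomorphic_on slit"
  unfolding bes_Y_def by (intro holomorphic_intros bes_A_holomorphic bes_B_holomorphic) auto

lemma bes_Y_deriv:
  assumes "w \<in> slit"
  shows "deriv (bes_Y \<kappa>) w = bes_A \<kappa> w / w + Ln w * deriv (bes_A \<kappa>) w - 2 * deriv (bes_B \<kappa>) w"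
    and "deriv (deriv (bes_Y \<kappa>)) w = - bes_A \<kappa> w / w\<^sup>2 + 2 * deriv (bes_A \<kappa>) w / w
      + Ln w * deriv (deriv (bes_A \<kappa>)) w - 2 * deriv (deriv (bes_B \<kappa>)) w"
proof -
  have d1: "(bes_Y \<kappa> has_field_derivative (bes_A \<kappa> w / w + Ln w * deriv (bes_A \<kappa>) w - 2 * deriv (bes_B \<kappa>) w)) (at w)"
    if "w \<in> slit" for w
    using that unfolding bes_Y_def
    by (auto intro!: derivative_eq_intros DERIV_bes_A DERIV_bes_B simp: field_simps)
  have d2: "((\<lambda>w. bes_A \<kappa> w / w + Ln w * deriv (bes_A \<kappa>) w - 2 * deriv (bes_B \<kappa>) w) has_field_derivative
      (- bes_A \<kappa> w / w\<^sup>2 + 2 * deriv (bes_A \<kappa>) w / w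
      + Ln w * deriv (deriv (bes_A \<kappa>)) w - 2 * deriv (deriv (bes_B \<kappa>)) w)) (at w)" if "w \<in> slit" for w
  proof -
    have "w \<noteq> 0" using that by auto
    then show ?thesis using that
      by (auto intro!: derivative_eq_intros DERIV_bes_A DERIV_bes_A' DERIV_bes_B' simp: field_simps power2_eq_square)
  qed
  show "deriv (bes_Y \<kappa>) w = bes_A \<kappa> w / w + Ln w * deriv (bes_A \<kappa>) w - 2 * deriv (bes_B \<kappa>) w"
    "deriv (deriv (bes_Y \<kappa>)) w = - bes_A \<kappa> w / w\<^sup>2 + 2 * deriv (bes_A \<kappa>) w / w
      + Ln w * deriv (deriv (bes_A \<kappa>)) w - 2 * deriv (deriv (bes_B \<kappa>)) w"
    by (rule deriv_deriv_eqI[OF open_slit assms d1 d2]; assumption)+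
qed

lemma bes_Y_ode: "bessel_eq 1 \<kappa> slit (bes_Y \<kappa>)"
  unfolding bessel_eq_def
proof
  fix w assume w: "w \<in> slit"
  then have w0: "w \<noteq> 0" by auto
  define A A1 A2 B B1 B2 L where "A = bes_A \<kappa> w" and "A1 = deriv (bes_A \<kappa>) w" and "A2 = deriv (deriv (bes_A \<kappa>)) w"
    and "B = bes_B \<kappa> w" and "B1 = deriv (bes_B \<kappa>) w" and "B2 = deriv (deriv (bes_B \<kappa>)) w" and "L = Ln w"
  have a: "w * A2 + A1 + of_real \<kappa> * A = 0"
    using bes_A_ode[of \<kappa> UNIV] by (simp add: bessel_eq_def A_def A1_def A2_def)
  have b: "w * B2 + B1 + of_real \<kappa> * B = A1"
    using bes_B_ode[of w \<kappa>] by (simp add: B_def B1_def B2_def A1_def)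
  have "w * (- A / w\<^sup>2 + 2 * A1 / w + L * A2 - 2 * B2) + 1 * (A / w + L * A1 - 2 * B1) + of_real \<kappa> * (L * A - 2 * B)
     = L * (w * A2 + A1 + of_real \<kappa> * A) - 2 * (w * B2 + B1 + of_real \<kappa> * B) + 2 * A1"
    using w0 by (simp add: field_simps power2_eq_square)
  also have "\<dots> = 0" by (simp add: a b)
  finally show "w * deriv (deriv (bes_Y \<kappa>)) w + 1 * deriv (bes_Y \<kappa>) w + of_real \<kappa> * bes_Y \<kappa> w = 0"
    unfolding bes_Y_deriv[OF w] by (simp add: bes_Y_def A_def A1_def A2_def B_def B1_def B2_def L_def)
qed

text \<open>In w times the Wronskian of \<open>bes_A\<close> and \<open>bes_Y\<close> the logarithms
  cancel, and this expression remains. It is entire with derivative 0, so it can be evaluated at the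
  singular point w = 0, where only \<open>bes_A\<close> contributes.\<close>

lemma bes_wronskian_aux:
  "(bes_A \<kappa> w)\<^sup>2 + 2 * w * (deriv (bes_A \<kappa>) w * bes_B \<kappa> w - bes_A \<kappa> w * deriv (bes_B \<kappa>) w) = 1"
proof -
  define Q where "Q w = (bes_A \<kappa> w)\<^sup>2 + 2 * w * (deriv (bes_A \<kappa>) w * bes_B \<kappa> w - bes_A \<kappa> w * deriv (bes_B \<kappa>) w)" for w
  have "(Q has_field_derivative 0) (at w)" for w
  proof -
    define A A1 A2 B B1 B2 where "A = bes_A \<kappa> w" and "A1 = deriv (bes_A \<kappa>) w" and "A2 = deriv (deriv (bes_A \<kappa>)) w"
      and "B = bes_B \<kappa> w" and "B1 = deriv (bes_B \<kappa>) w" and "B2 = deriv (deriv (bes_B \<kappa>)) w"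
    have a: "w * A2 = - A1 - of_real \<kappa> * A"
      using bes_A_ode[of \<kappa> UNIV] by (simp add: bessel_eq_def A_def A1_def A2_def eq_neg_iff_add_eq_0 algebra_simps)
    have b: "w * B2 = A1 - B1 - of_real \<kappa> * B"
      using bes_B_ode[of w \<kappa>] by (simp add: B_def B1_def B2_def A1_def algebra_simps)
    have "(Q has_field_derivative (2 * A * A1 + (2 * (A1 * B - A * B1) + 2 * w * (A2 * B - A * B2)))) (at w)"
      unfolding Q_def A_def A1_def A2_def B_def B1_def B2_def
      by (auto intro!: derivative_eq_intros DERIV_bes_A DERIV_bes_A' DERIV_bes_B DERIV_bes_B' simp: algebra_simps)
    moreover have "2 * A * A1 + (2 * (A1 * B - A * B1) + 2 * w * (A2 * B - A * B2))
       = 2 * A * A1 + (2 * (A1 * B - A * B1) + 2 * ((w * A2) * B - A * (w * B2)))" by (simp add: algebra_simps)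
    moreover have "\<dots> = 0" unfolding a b by (simp add: algebra_simps)
    ultimately show ?thesis by simp
  qed
  then have "\<exists>c. \<forall>w\<in>UNIV. Q w = c"
    by (intro has_field_derivative_zero_constant) (auto intro: has_field_derivative_at_within)
  then have "Q w = Q 0" by (metis UNIV_I)
  then show ?thesis by (simp add: Q_def bes_A_0)
qed

definition bes_wronskian :: "real \<Rightarrow> nat \<Rightarrow> complex \<Rightarrow> complex" where
  "bes_wronskian \<kappa> n w = (deriv ^^ n) (bes_A \<kappa>) w * (deriv ^^ Suc n) (bes_Y \<kappa>) w
      - (deriv ^^ Suc n) (bes_A \<kappa>) w * (deriv ^^ n) (bes_Y \<kappa>) w"

text \<open>After the second derivatives are replaced by means of the Bessel equation, the terms
  with factor 1 + n cancel, and w times the Wronskian of order n + 1 is \<kappa> times that of order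
  n.\<close>

lemma bes_wronskian_eq:
  assumes w: "w \<in> slit"
  shows "w ^ Suc n * bes_wronskian \<kappa> n w = of_real \<kappa> ^ n"
proof (induction n)
  case 0
  have w0: "w \<noteq> 0" using w by auto
  have "w * bes_wronskian \<kappa> 0 w
     = (bes_A \<kappa> w)\<^sup>2 + 2 * w * (deriv (bes_A \<kappa>) w * bes_B \<kappa> w - bes_A \<kappa> w * deriv (bes_B \<kappa>) w)"
    using w0 by (simp add: bes_wronskian_def bes_Y_deriv[OF w] bes_Y_def field_simps power2_eq_square)
  then show ?case by (simp add: bes_wronskian_aux)
next
  case (Suc n)
  have eqn: "w * (deriv ^^ Suc (Suc n)) y w = - (1 + of_nat n) * (deriv ^^ Suc n) y w - of_real \<kappa> * (deriv ^^ n) y w"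
    if "bessel_eq (1 + of_nat n) \<kappa> slit ((deriv ^^ n) y)" for y
  proof -
    have "w * (deriv ^^ Suc (Suc n)) y w + (1 + of_nat n) * (deriv ^^ Suc n) y w + of_real \<kappa> * (deriv ^^ n) y w = 0"
      using that w unfolding bessel_eq_def by simp
    then show ?thesis by algebra
  qed
  have a: "w * (deriv ^^ Suc (Suc n)) (bes_A \<kappa>) w = - (1 + of_nat n) * (deriv ^^ Suc n) (bes_A \<kappa>) w - of_real \<kappa> * (deriv ^^ n) (bes_A \<kappa>) w"
    by (rule eqn[OF bessel_eq_higher_deriv[OF open_slit bes_A_holomorphic bes_A_ode]])
  have y: "w * (deriv ^^ Suc (Suc n)) (bes_Y \<kappa>) w = - (1 + of_nat n) * (deriv ^^ Suc n) (bes_Y \<kappa>) w - of_real \<kappa> * (deriv ^^ n) (bes_Y \<kappa>) w"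
    by (rule eqn[OF bessel_eq_higher_deriv[OF open_slit bes_Y_holomorphic bes_Y_ode]])
  have "w * bes_wronskian \<kappa> (Suc n) w = (deriv ^^ Suc n) (bes_A \<kappa>) w * (w * (deriv ^^ Suc (Suc n)) (bes_Y \<kappa>) w)
      - (w * (deriv ^^ Suc (Suc n)) (bes_A \<kappa>) w) * (deriv ^^ Suc n) (bes_Y \<kappa>) w"
    unfolding bes_wronskian_def by (simp only: right_diff_distrib mult_ac)
  also have "\<dots> = of_real \<kappa> * bes_wronskian \<kappa> n w"
    unfolding a y bes_wronskian_def by (simp only: algebra_simps)
  finally have *: "w * bes_wronskian \<kappa> (Suc n) w = of_real \<kappa> * bes_wronskian \<kappa> n w" .
  have "w ^ Suc (Suc n) * bes_wronskian \<kappa> (Suc n) w = w ^ Suc n * (w * bes_wronskian \<kappa> (Suc n) w)"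
    by (simp only: power_Suc mult_ac)
  also have "\<dots> = of_real \<kappa> * (w ^ Suc n * bes_wronskian \<kappa> n w)" unfolding * by (simp only: mult_ac)
  also have "\<dots> = of_real \<kappa> ^ Suc n" unfolding Suc by simp
  finally show ?case .
qed

lemma bes_wronskian_nonzero: "w \<in> slit \<Longrightarrow> \<kappa> > 0 \<Longrightarrow> bes_wronskian \<kappa> n w \<noteq> 0"
  using bes_wronskian_eq[of w n \<kappa>] by (metis mult_zero_right of_real_eq_0_iff order_less_irrefl power_not_zero)

subsection \<open>The fundamental solution\<close>

definition kap :: "real \<Rightarrow> real" where "kap k = k\<^sup>2 / 4"

text \<open>This and \<open>fund_coeff_Y\<close> are the coefficients of (i/4) (J_0 + i Y_0) in the
  basis \<open>bes_A\<close>, \<open>bes_Y\<close>; the real part collects the constant that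
  \<open>bes_Y\<close> omits from Y_0.\<close>

definition fund_coeff_J :: "real \<Rightarrow> complex" where
  "fund_coeff_J k = \<i> / 4 - of_real ((ln (k / 2) + euler_mascheroni) / (2 * pi))"

definition fund_coeff_Y :: complex where "fund_coeff_Y = of_real (- 1 / (4 * pi))"

text \<open>The logarithm \<open>l\<close> of \<open>w\<close> is a separate argument since different branches will be needed.\<close>

definition fund_log :: "real \<Rightarrow> complex \<Rightarrow> complex \<Rightarrow> complex" where
  "fund_log k l w = fund_coeff_J k * bes_A (kap k) w + fund_coeff_Y * (l * bes_A (kap k) w - 2 * bes_B (kap k) w)"

definition fund :: "real \<Rightarrow> complex \<Rightarrow> complex" where
  "fund k w = fund_log k (Ln w) w"

lemma fund_eq: "fund k w = fund_coeff_J k * bes_A (kap k) w + fund_coeff_Y * bes_Y (kap k) w"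
  by (simp add: fund_def fund_log_def bes_Y_def)

lemma fund_holomorphic: "fund k holomorphic_on slit"
  unfolding fund_eq[abs_def] by (intro holomorphic_intros bes_A_holomorphic bes_Y_holomorphic)

lemma fund_higher_deriv:
  assumes "w \<in> slit"
  shows "(deriv ^^ n) (fund k) w = fund_coeff_J k * (deriv ^^ n) (bes_A (kap k)) w + fund_coeff_Y * (deriv ^^ n) (bes_Y (kap k)) w"
proof -
  have "(deriv ^^ n) (fund k) w = (deriv ^^ n) (\<lambda>w. fund_coeff_J k * bes_A (kap k) w) w + (deriv ^^ n) (\<lambda>w. fund_coeff_Y * bes_Y (kap k) w) w"
    unfolding fund_eq[abs_def]
    by (rule higher_deriv_add[OF _ _ open_slit assms])
      (intro holomorphic_intros bes_A_holomorphic bes_Y_holomorphic)+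
  then show ?thesis
    by (simp only: higher_deriv_cmult[OF bes_A_holomorphic assms open_slit]
        higher_deriv_cmult[OF bes_Y_holomorphic assms open_slit])
qed

lemma fund_ode: "bessel_eq 1 (kap k) slit (fund k)"
  unfolding bessel_eq_def
proof
  fix w assume w: "w \<in> slit"
  have d: "deriv (deriv f) w = (deriv ^^ 2) f w" "deriv f w = (deriv ^^ 1) f w" "f w = (deriv ^^ 0) f w" for f :: "complex \<Rightarrow> complex"
    by (simp_all add: eval_nat_numeral)
  have a: "w * deriv (deriv (bes_A (kap k))) w + deriv (bes_A (kap k)) w + of_real (kap k) * bes_A (kap k) w = 0"
    using bes_A_ode[of "kap k" slit] w by (simp add: bessel_eq_def)
  have y: "w * deriv (deriv (bes_Y (kap k))) w + deriv (bes_Y (kap k)) w + of_real (kap k) * bes_Y (kap k) w = 0"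
    using bes_Y_ode[of "kap k"] w by (simp add: bessel_eq_def)
  have "w * deriv (deriv (fund k)) w + 1 * deriv (fund k) w + of_real (kap k) * fund k w
    = fund_coeff_J k * (w * deriv (deriv (bes_A (kap k))) w + deriv (bes_A (kap k)) w + of_real (kap k) * bes_A (kap k) w)
    + fund_coeff_Y * (w * deriv (deriv (bes_Y (kap k))) w + deriv (bes_Y (kap k)) w + of_real (kap k) * bes_Y (kap k) w)"
    using fund_higher_deriv[OF w, of 0 k] fund_higher_deriv[OF w, of 1 k] fund_higher_deriv[OF w, of 2 k]
    by (simp add: eval_nat_numeral algebra_simps)
  then show "w * deriv (deriv (fund k)) w + 1 * deriv (fund k) w + of_real (kap k) * fund k w = 0"
    unfolding a y by simp
qed

lemma of_real_slit: "r > 0 \<Longrightarrow> complex_of_real r \<in> slit"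
  by (auto simp: complex_nonpos_Reals_iff)

lemma bes_A_of_real: "bes_A \<kappa> (of_real r) = of_real (\<Sum>m. (-\<kappa>) ^ m / (fact m)\<^sup>2 * r ^ m)"
  and bes_B_of_real: "bes_B \<kappa> (of_real r) = of_real (\<Sum>m. (-\<kappa>) ^ m * harm m / (fact m)\<^sup>2 * r ^ m)"
proof -
  have s: "summable (\<lambda>m. complex_of_real ((-\<kappa>) ^ m / (fact m)\<^sup>2 * r ^ m))"
    using summable_coeff_A[of \<kappa> "of_real r"] by (simp add: coeff_A_def)
  then have "summable (\<lambda>m. (-\<kappa>) ^ m / (fact m)\<^sup>2 * r ^ m)" unfolding summable_complex_of_real .
  then show "bes_A \<kappa> (of_real r) = of_real (\<Sum>m. (-\<kappa>) ^ m / (fact m)\<^sup>2 * r ^ m)"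
    unfolding bes_A_def by (subst suminf_of_real) (simp_all add: coeff_A_def)
  have s: "summable (\<lambda>m. complex_of_real ((-\<kappa>) ^ m * harm m / (fact m)\<^sup>2 * r ^ m))"
    using summable_coeff_B[of \<kappa> "of_real r"] by (simp add: coeff_B_def)
  then have "summable (\<lambda>m. (-\<kappa>) ^ m * harm m / (fact m)\<^sup>2 * r ^ m)" unfolding summable_complex_of_real .
  then show "bes_B \<kappa> (of_real r) = of_real (\<Sum>m. (-\<kappa>) ^ m * harm m / (fact m)\<^sup>2 * r ^ m)"
    unfolding bes_B_def by (subst suminf_of_real) (simp_all add: coeff_B_def)
qed

lemma Phi_eq_fund:
  assumes k: "k > 0" and xy: "x \<noteq> y"
  shows "Phi k x y = fund k (of_real ((cmod (x - y))\<^sup>2))"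
proof -
  define r where "r = cmod (x - y)"
  have r: "r > 0" using xy by (simp add: r_def)
  have pow: "(k * r / 2) ^ (2 * m) = kap k ^ m * (r\<^sup>2) ^ m" for m
    by (simp add: power_mult kap_def power_mult_distrib power_divide flip: power_mult_distrib)
  have J: "complex_of_real (bessel_J0 (k * r)) = bes_A (kap k) (of_real (r\<^sup>2))"
  proof -
    have "(-1) ^ m / (fact m)\<^sup>2 * (k * r / 2) ^ (2 * m) = (-kap k) ^ m / (fact m)\<^sup>2 * (r\<^sup>2) ^ m" for m
      unfolding pow by (simp add: power_minus[of "kap k"])
    then show ?thesis by (simp only: bes_A_of_real bessel_J0_def)
  qed
  have B: "complex_of_real (\<Sum>m. (-1) ^ m * harm m / (fact m)\<^sup>2 * (k * r / 2) ^ (2 * m)) = bes_B (kap k) (of_real (r\<^sup>2))"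
  proof -
    have "(-1) ^ m * harm m / (fact m)\<^sup>2 * (k * r / 2) ^ (2 * m) = (-kap k) ^ m * harm m / (fact m)\<^sup>2 * (r\<^sup>2) ^ m" for m :: nat
      unfolding pow by (simp add: power_minus[of "kap k"])
    then show ?thesis by (simp only: bes_B_of_real)
  qed
  have ln: "ln (k * r / 2) = ln (k / 2) + ln (r\<^sup>2) / 2"
    using k r by (simp add: ln_mult ln_div ln_realpow)
  have Ln: "Ln (of_real (r\<^sup>2)) = of_real (ln (r\<^sup>2))" using r by (intro Ln_of_real) simp
  have "Phi k x y = \<i> / 4 * (of_real (bessel_J0 (k * r)) + \<i> * of_real (bessel_Y0 (k * r)))"
    by (simp add: Phi_def hankel_H10_def r_def)
  also have "complex_of_real (bessel_Y0 (k * r)) = 2 / pi * ((of_real (ln (k / 2) + euler_mascheroni) + of_real (ln (r\<^sup>2)) / 2)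
      * bes_A (kap k) (of_real (r\<^sup>2)) - bes_B (kap k) (of_real (r\<^sup>2)))"
    unfolding bessel_Y0_def ln J[symmetric] B[symmetric] by simp
  finally have "Phi k x y = \<i> / 4 * (bes_A (kap k) (of_real (r\<^sup>2)) + \<i> * (2 / pi *
      ((of_real (ln (k / 2) + euler_mascheroni) + of_real (ln (r\<^sup>2)) / 2)
      * bes_A (kap k) (of_real (r\<^sup>2)) - bes_B (kap k) (of_real (r\<^sup>2)))))" unfolding J .
  moreover have "\<i> / 4 * (J + \<i> * (2 / pi * ((of_real c + l / 2) * J - B)))
      = (\<i> / 4 - of_real (c / (2 * pi))) * J + of_real (- 1 / (4 * pi)) * (l * J - 2 * B)" for J B l :: complex and c
    by (simp add: field_simps)
  ultimately show ?thesis
    unfolding fund_def fund_log_def Ln fund_coeff_J_def fund_coeff_Y_def r_def[symmetric] by (simp only:)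
qed

subsection \<open>Nonvanishing and linear independence\<close>

lemma deriv_real:
  assumes "f holomorphic_on S" "open S" "\<And>x. x > 0 \<Longrightarrow> complex_of_real x \<in> S"
    and "\<And>x. x > 0 \<Longrightarrow> f (of_real x) \<in> \<real>" and x: "x > 0"
  shows "deriv f (of_real x) \<in> \<real>"
proof -
  have d: "(f has_field_derivative deriv f (of_real x)) (at (of_real x))"
    by (rule holomorphic_derivI[OF assms(1,2) assms(3)[OF x]])
  have lim: "(\<lambda>n. (f (of_real x + of_real (1 / real (Suc n))) - f (of_real x)) / of_real (1 / real (Suc n))) \<longlonglongrightarrow> deriv f (of_real x)"
  proof -
    have "filterlim (\<lambda>n. complex_of_real (1 / real (Suc n))) (at 0) sequentially"
      unfolding filterlim_at
      using tendsto_of_real[OF LIMSEQ_inverse_real_of_nat, where 'a=complex]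
      by (auto simp: inverse_eq_divide simp del: of_nat_Suc)
    then show ?thesis
      using d unfolding DERIV_def by (rule filterlim_compose[rotated])
  qed
  show ?thesis
  proof (rule Lim_in_closed_set[OF closed_complex_Reals _ _ lim])
    show "\<forall>\<^sub>F n in sequentially. (f (of_real x + of_real (1 / real (Suc n))) - f (of_real x)) / of_real (1 / real (Suc n)) \<in> \<real>"
    proof (rule always_eventually, rule allI)
      fix n
      have "f (of_real (x + 1 / real (Suc n))) \<in> \<real>" "f (of_real x) \<in> \<real>"
        by (rule assms(4), simp add: x add_pos_pos)+
      then show "(f (of_real x + of_real (1 / real (Suc n))) - f (of_real x)) / of_real (1 / real (Suc n)) \<in> \<real>"
        by (metis Reals_diff Reals_divide Reals_of_real of_real_add)
    qed
  qed simp
qed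

lemma higher_deriv_real:
  assumes "f holomorphic_on S" "open S" "\<And>x. x > 0 \<Longrightarrow> complex_of_real x \<in> S"
    and "\<And>x. x > 0 \<Longrightarrow> f (of_real x) \<in> \<real>" and "x > 0"
  shows "(deriv ^^ n) f (of_real x) \<in> \<real>"
  using assms(5)
proof (induction n arbitrary: x)
  case (Suc n)
  show ?case
    using deriv_real[OF holomorphic_higher_deriv[OF assms(1,2)] assms(2,3) Suc.IH Suc.prems] by simp
qed (use assms in simp)

lemma bes_A_higher_deriv_real: "x > 0 \<Longrightarrow> (deriv ^^ n) (bes_A \<kappa>) (of_real x) \<in> \<real>"
  by (rule higher_deriv_real[OF bes_A_holomorphic[of _ UNIV]]) (auto simp: bes_A_of_real)

lemma bes_Y_higher_deriv_real: "x > 0 \<Longrightarrow> (deriv ^^ n) (bes_Y \<kappa>) (of_real x) \<in> \<real>"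
proof (rule higher_deriv_real[OF bes_Y_holomorphic open_slit of_real_slit])
  fix x :: real assume "x > 0"
  then show "bes_Y \<kappa> (of_real x) \<in> \<real>"
    by (simp add: bes_Y_def bes_A_of_real bes_B_of_real Ln_of_real Reals_mult Reals_diff)
qed

text \<open>On the positive axis both basis functions have real derivatives, and only the
  coefficient of \<open>bes_A\<close> has an imaginary part, namely 1/4. A zero would therefore be a
  common zero of both derivatives, which the Wronskian excludes. This is the absence of positive
  zeros of H_n.\<close>

lemma fund_higher_deriv_nonzero:
  assumes k: "k > 0" and x: "x > 0"
  shows "(deriv ^^ n) (fund k) (of_real x) \<noteq> 0"
proof
  assume 0: "(deriv ^^ n) (fund k) (of_real x) = 0"
  have slit: "of_real x \<in> slit" using x by (rule of_real_slit)
  obtain a where a: "(deriv ^^ n) (bes_A (kap k)) (of_real x) = of_real a"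
    using bes_A_higher_deriv_real[OF x, of n "kap k"] unfolding Reals_def by auto
  obtain y where y: "(deriv ^^ n) (bes_Y (kap k)) (of_real x) = of_real y"
    using bes_Y_higher_deriv_real[OF x, of n "kap k"] unfolding Reals_def by auto
  have eq: "fund_coeff_J k * of_real a + fund_coeff_Y * of_real y = 0"
    using fund_higher_deriv[OF slit, of n k] 0 by (simp add: a y)
  obtain c where "fund_coeff_J k = \<i> / 4 - of_real c" by (simp only: fund_coeff_J_def)
  then have "Im (fund_coeff_J k * of_real a + fund_coeff_Y * of_real y) = a / 4"
    by (simp add: fund_coeff_Y_def)
  then have "a = 0" using eq by simp
  then have "y = 0" using eq by (simp add: fund_coeff_Y_def)
  have "bes_wronskian (kap k) n (of_real x) = 0"
    unfolding bes_wronskian_def a y \<open>a = 0\<close> \<open>y = 0\<close> by simp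
  moreover have "kap k > 0" using k by (simp add: kap_def)
  ultimately show False using bes_wronskian_nonzero[OF slit] by blast
qed

text \<open>Differentiating the relation at the midpoint of the interval gives a second linear
  equation for p and q; the determinant of the system is a nonzero multiple of the
  Wronskian.\<close>

lemma fund_bes_A_independent:
  assumes k: "k > 0" and ab: "0 \<le> a" "a < b"
    and eq: "\<And>x. a < x \<Longrightarrow> x < b \<Longrightarrow> p * (deriv ^^ n) (fund k) (of_real x) + q * (deriv ^^ n) (bes_A (kap k)) (of_real x) = 0"
  shows "p = 0 \<and> q = 0"
proof -
  define g where "g w = p * (deriv ^^ n) (fund k) w + q * (deriv ^^ n) (bes_A (kap k)) w" for w
  have hF: "(deriv ^^ n) (fund k) holomorphic_on slit" by (rule holomorphic_higher_deriv[OF fund_holomorphic open_slit])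
  have hA: "(deriv ^^ n) (bes_A (kap k)) holomorphic_on slit" by (rule holomorphic_higher_deriv[OF bes_A_holomorphic open_slit])
  define x where "x = (a + b) / 2"
  have x: "a < x" "x < b" "x > 0" using ab by (auto simp: x_def)
  have xs: "of_real x \<in> slit" using x by (intro of_real_slit)
  have dg: "(g has_field_derivative (p * (deriv ^^ Suc n) (fund k) (of_real x) + q * (deriv ^^ Suc n) (bes_A (kap k)) (of_real x))) (at (of_real x))"
    unfolding g_def using holomorphic_derivI[OF hF open_slit xs] holomorphic_derivI[OF hA open_slit xs]
    by (auto intro!: derivative_eq_intros)
  \<comment> \<open>The relation is known only on a real interval, so the complex derivative is
    computed along real increments that keep x + h n below b.\<close>
  define h where "h n = (b - x) / 2 * (1 / real (Suc n))" for n
  have h: "h n > 0" "h n < b - x" for n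
  proof -
    show "h n > 0" using x by (simp add: h_def)
    have "(b - x) / 2 * (1 / real (Suc n)) \<le> (b - x) / 2 * 1" using x by (intro mult_left_mono) (auto simp: field_simps)
    also have "\<dots> < b - x" using x by simp
    finally show "h n < b - x" unfolding h_def .
  qed
  have "h \<longlonglongrightarrow> (b - x) / 2 * 0"
    unfolding h_def using LIMSEQ_inverse_real_of_nat by (intro tendsto_mult tendsto_const) (simp add: inverse_eq_divide)
  then have "filterlim (\<lambda>n. complex_of_real (h n)) (at 0) sequentially"
    unfolding filterlim_at using h(1) tendsto_of_real[of h 0 sequentially, where 'a=complex] by (auto simp: less_imp_neq[THEN not_sym])
  then have "(\<lambda>n. (g (of_real x + of_real (h n)) - g (of_real x)) / of_real (h n)) \<longlonglongrightarrow>
      p * (deriv ^^ Suc n) (fund k) (of_real x) + q * (deriv ^^ Suc n) (bes_A (kap k)) (of_real x)"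
    using dg unfolding DERIV_def by (rule filterlim_compose[rotated])
  moreover have "(g (of_real x + of_real (h m)) - g (of_real x)) / of_real (h m) = 0" for m
  proof -
    have "g (of_real (x + h m)) = 0" "g (of_real x) = 0"
      unfolding g_def by (rule eq; use h[of m] x in linarith)+
    then show ?thesis by simp
  qed
  ultimately have "(\<lambda>n::nat. 0) \<longlonglongrightarrow> p * (deriv ^^ Suc n) (fund k) (of_real x) + q * (deriv ^^ Suc n) (bes_A (kap k)) (of_real x)"
    by (simp only:)
  then have eq1: "p * (deriv ^^ Suc n) (fund k) (of_real x) + q * (deriv ^^ Suc n) (bes_A (kap k)) (of_real x) = 0"
    by (metis LIMSEQ_unique tendsto_const)
  have eq0: "p * (deriv ^^ n) (fund k) (of_real x) + q * (deriv ^^ n) (bes_A (kap k)) (of_real x) = 0"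
    using eq x by simp
  define A0 A1 F0 F1 where "A0 = (deriv ^^ n) (bes_A (kap k)) (of_real x)" and "A1 = (deriv ^^ Suc n) (bes_A (kap k)) (of_real x)"
    and "F0 = (deriv ^^ n) (fund k) (of_real x)" and "F1 = (deriv ^^ Suc n) (fund k) (of_real x)"
  have det: "A0 * F1 - A1 * F0 = fund_coeff_Y * bes_wronskian (kap k) n (of_real x)"
    unfolding A0_def A1_def F0_def F1_def bes_wronskian_def fund_higher_deriv[OF xs] by (simp only: algebra_simps)
  have "kap k > 0" using k by (simp add: kap_def)
  then have nz: "A0 * F1 - A1 * F0 \<noteq> 0"
    unfolding det using bes_wronskian_nonzero[OF xs] by (simp add: fund_coeff_Y_def)
  have e0: "p * F0 + q * A0 = 0" and e1: "p * F1 + q * A1 = 0"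
    using eq0 eq1 by (simp_all only: A0_def A1_def F0_def F1_def)
  have "p * (A0 * F1 - A1 * F0) = A0 * (p * F1 + q * A1) - A1 * (p * F0 + q * A0)" by (simp add: algebra_simps)
  then have p: "p = 0" using nz by (simp add: e0 e1)
  have "q * (A0 * F1 - A1 * F0) = F1 * (p * F0 + q * A0) - F0 * (p * F1 + q * A1)" by (simp add: algebra_simps)
  then have "q = 0" using nz by (simp add: e0 e1)
  with p show ?thesis by blast
qed


section \<open>Fourier coefficients of the fundamental solution\<close>

text \<open>Arguments of modulus below pi/2 add up to less than pi. Without arguments: x y = s <= 0
  would give x |y|^2 = s cnj y, whose real parts have opposite signs.\<close>

lemma slit_mult:
  assumes "Re x > 0" "Re y > 0"
  shows "x * y \<in> slit"
proof
  assume "x * y \<in> \<real>\<^sub>\<le>\<^sub>0"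
  then obtain s where s: "x * y = of_real s" "s \<le> 0" by (auto elim: nonpos_Reals_cases)
  have "x * of_real ((cmod y)\<^sup>2) = x * y * cnj y" unfolding complex_norm_square by (simp add: mult_ac)
  from arg_cong[OF this, of Re] have "Re x * (cmod y)\<^sup>2 = s * Re y" unfolding s by simp
  moreover have "Re x * (cmod y)\<^sup>2 > 0" using assms by (intro mult_pos_pos) auto
  moreover have "s * Re y \<le> 0" using s assms by (simp add: mult_nonpos_nonneg)
  ultimately show False by simp
qed

lemma slit_factor:
  assumes R: "R > 0" and a: "cmod a < R" and q: "cmod q < cmod a * R"
  shows "(of_real R - a) * (of_real R - q / a) \<in> slit"
proof (rule slit_mult)
  show "Re (of_real R - a) > 0" using complex_Re_le_cmod[of a] a by simp
  have "cmod a > 0" using q R by (metis mult_zero_left norm_ge_zero not_less order_le_less)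
  then have "cmod (q / a) < R" using q by (simp add: norm_divide divide_less_eq mult.commute)
  then show "Re (of_real R - q / a) > 0" using complex_Re_le_cmod[of "q / a"] by simp
qed

text \<open>
  The \<open>n\<close>-th coefficient of \<open>F(|R - a|\<^sup>2)\<close> on the circle \<open>|a| = \<rho>\<close>, where \<open>|R - a|\<^sup>2 = (R - a) (R - q / a)\<close> with
  \<open>q = \<rho>\<^sup>2\<close>. For complex \<open>q\<close> it is holomorphic and solves a Bessel equation, since the equation holds
  for the integrand up to a derivative in \<open>a\<close>. Its value at \<open>q = 0\<close> is a Cauchy integral.
\<close>

context
  fixes k R \<rho> :: real and n :: nat
  assumes k: "k > 0" and \<rho>: "0 < \<rho>" "\<rho> < R"
begin

text \<open>This is the j-th derivative in q of the integrand: the inner derivative of (R - a) (R -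
  q / a) is -(R - a) / a. Dividing by a^(n+1) under the contour integral selects the n-th
  coefficient.\<close>

definition graf_integrand :: "nat \<Rightarrow> complex \<Rightarrow> complex \<Rightarrow> complex" where
  "graf_integrand j q a =
     (deriv ^^ j) (fund k) ((of_real R - a) * (of_real R - q / a)) * (- (of_real R - a) / a) ^ j / a ^ Suc n"

definition graf_int :: "nat \<Rightarrow> complex \<Rightarrow> complex" where
  "graf_int j q = contour_integral (circlepath 0 \<rho>) (graf_integrand j q)"

lemma graf_slit:
  assumes "q \<in> ball 0 (\<rho> * R)" "cmod a = \<rho>"
  shows "(of_real R - a) * (of_real R - q / a) \<in> slit"
  by (rule slit_factor) (use assms \<rho> in auto)

lemma fund_deriv_holomorphic: "(deriv ^^ j) (fund k) holomorphic_on slit"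
  by (rule holomorphic_higher_deriv[OF fund_holomorphic open_slit])

lemma fund_deriv_DERIV:
  "w \<in> slit \<Longrightarrow> ((deriv ^^ j) (fund k) has_field_derivative (deriv ^^ Suc j) (fund k) w) (at w)"
  using holomorphic_derivI[OF fund_deriv_holomorphic open_slit] by simp

lemma graf_integrand_continuous:
  "continuous_on (ball (0::complex) (\<rho> * R) \<times> sphere 0 \<rho>) (\<lambda>(q, a). graf_integrand j q a)"
proof -
  have "continuous_on (ball (0::complex) (\<rho> * R) \<times> sphere 0 \<rho>) (\<lambda>p. (deriv ^^ j) (fund k)
      ((of_real R - snd p) * (of_real R - fst p / snd p)))"
  proof (rule continuous_on_compose2[OF holomorphic_on_imp_continuous_on[OF fund_deriv_holomorphic]])
    show "continuous_on (ball (0::complex) (\<rho> * R) \<times> sphere 0 \<rho>) (\<lambda>p. (of_real R - snd p) * (of_real R - fst p / snd p))"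
      using \<rho> by (intro continuous_intros) auto
  qed (use graf_slit in auto)
  then show ?thesis
    unfolding graf_integrand_def case_prod_beta' using \<rho> by (intro continuous_intros) auto
qed

lemma graf_integrand_circle_continuous:
  assumes "q \<in> ball 0 (\<rho> * R)"
  shows "continuous_on (sphere 0 \<rho>) (graf_integrand j q)"
proof -
  have "continuous_on (sphere 0 \<rho>) (\<lambda>a. case (q, a) of (q, a) \<Rightarrow> graf_integrand j q a)"
    by (rule continuous_on_compose2[OF graf_integrand_continuous]) (use assms in \<open>auto intro!: continuous_intros\<close>)
  then show ?thesis by simp
qed

lemma graf_integrand_integrable:
  "q \<in> ball 0 (\<rho> * R) \<Longrightarrow> graf_integrand j q contour_integrable_on circlepath 0 \<rho>"
  by (rule contour_integrable_continuous_circlepath)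
    (use graf_integrand_circle_continuous[of q j] \<rho> in \<open>simp add: path_image_circlepath\<close>)

lemma graf_int_DERIV:
  assumes q0: "q0 \<in> ball 0 (\<rho> * R)"
  shows "(graf_int j has_field_derivative graf_int (Suc j) q0) (at q0)"
proof -
  define cp where "cp t = circlepath 0 \<rho> t" for t
  have cp: "cmod (cp t) = \<rho>" for t using \<rho> by (simp add: cp_def circlepath norm_mult)
  have cpc: "continuous_on S cp" for S unfolding cp_def circlepath by (intro continuous_intros)
  define d where "d t = 2 * pi * \<i> * \<rho> * exp (2 * of_real pi * \<i> * of_real t)" for t :: real
  have dc: "continuous_on S d" for S unfolding d_def by (intro continuous_intros)
  have eq: "graf_int j q = integral (cbox 0 1) (\<lambda>t. graf_integrand j q (cp t) * d t)" for j q
    unfolding graf_int_def contour_integral_integral cp_def d_def vector_derivative_circlepath by simp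
  have "((\<lambda>q. integral (cbox 0 1) (\<lambda>t. graf_integrand j q (cp t) * d t)) has_field_derivative
      integral (cbox 0 1) (\<lambda>t. graf_integrand (Suc j) q0 (cp t) * d t)) (at q0 within ball 0 (\<rho> * R))"
  proof (rule leibniz_rule_field_derivative[where fx="\<lambda>q t. graf_integrand (Suc j) q (cp t) * d t"])
    fix q :: complex and t :: real assume q: "q \<in> ball 0 (\<rho> * R)"
    define a where "a = cp t"
    have a: "cmod a = \<rho>" "a \<noteq> 0" using cp[of t] \<rho> by (auto simp: a_def)
    have "((\<lambda>q. (of_real R - a) * (of_real R - q / a)) has_field_derivative (- (of_real R - a) / a)) (at q)"
      using a by (auto intro!: derivative_eq_intros simp: field_simps)
    with fund_deriv_DERIV[OF graf_slit[OF q a(1)], of j]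
    have "((\<lambda>q. (deriv ^^ j) (fund k) ((of_real R - a) * (of_real R - q / a))) has_field_derivative
       (deriv ^^ Suc j) (fund k) ((of_real R - a) * (of_real R - q / a)) * (- (of_real R - a) / a)) (at q)"
      by (rule DERIV_chain2)
    then have "((\<lambda>q. (deriv ^^ j) (fund k) ((of_real R - a) * (of_real R - q / a)) *
         ((- (of_real R - a) / a) ^ j / a ^ Suc n * d t)) has_field_derivative
       (deriv ^^ Suc j) (fund k) ((of_real R - a) * (of_real R - q / a)) * (- (of_real R - a) / a) *
         ((- (of_real R - a) / a) ^ j / a ^ Suc n * d t)) (at q)"
      by (rule DERIV_cmult_right)
    moreover have "(\<lambda>q. (deriv ^^ j) (fund k) ((of_real R - a) * (of_real R - q / a)) *
         ((- (of_real R - a) / a) ^ j / a ^ Suc n * d t)) = (\<lambda>q. graf_integrand j q (cp t) * d t)"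
      "(deriv ^^ Suc j) (fund k) ((of_real R - a) * (of_real R - q / a)) * (- (of_real R - a) / a) *
         ((- (of_real R - a) / a) ^ j / a ^ Suc n * d t) = graf_integrand (Suc j) q (cp t) * d t"
      by (simp_all add: graf_integrand_def a_def fun_eq_iff)
    ultimately show "((\<lambda>q. graf_integrand j q (cp t) * d t) has_field_derivative graf_integrand (Suc j) q (cp t) * d t)
        (at q within ball 0 (\<rho> * R))"
      by (metis has_field_derivative_at_within)
  next
    fix q :: complex assume q: "q \<in> ball 0 (\<rho> * R)"
    have "continuous_on (cbox 0 1) (\<lambda>t. graf_integrand j q (cp t))"
      by (rule continuous_on_compose2[OF graf_integrand_circle_continuous[OF q] cpc]) (use cp in auto)
    then show "(\<lambda>t. graf_integrand j q (cp t) * d t) integrable_on cbox 0 1"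
      by (intro integrable_continuous continuous_intros dc)
  next
    have "continuous_on (ball (0::complex) (\<rho> * R) \<times> cbox 0 (1::real)) (\<lambda>p. case (fst p, cp (snd p)) of (q, a) \<Rightarrow> graf_integrand (Suc j) q a)"
    proof (rule continuous_on_compose2[OF graf_integrand_continuous])
      show "continuous_on (ball (0::complex) (\<rho> * R) \<times> cbox 0 (1::real)) (\<lambda>p. (fst p, cp (snd p)))"
        by (intro continuous_intros continuous_on_compose2[OF cpc[of UNIV]]) auto
    qed (use cp in auto)
    moreover have "continuous_on (ball (0::complex) (\<rho> * R) \<times> cbox 0 (1::real)) (\<lambda>p. d (snd p))"
      by (intro continuous_on_compose2[OF dc[of UNIV]] continuous_intros) auto
    ultimately show "continuous_on (ball (0::complex) (\<rho> * R) \<times> cbox 0 1) (\<lambda>(q, t). graf_integrand (Suc j) q (cp t) * d t)"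
      unfolding case_prod_beta' by (auto intro: continuous_on_mult)
  qed (use q0 in auto)
  then have "(graf_int j has_field_derivative graf_int (Suc j) q0) (at q0 within ball 0 (\<rho> * R))"
    unfolding eq[abs_def] .
  then show ?thesis using q0 by (simp add: at_within_open[OF _ open_ball])
qed

lemma graf_int_holomorphic: "graf_int j holomorphic_on ball 0 (\<rho> * R)"
  unfolding holomorphic_on_open[OF open_ball] using graf_int_DERIV by blast

lemma graf_int_ode: "bessel_eq (of_nat (Suc n)) (kap k) (ball 0 (\<rho> * R)) (graf_int 0)"
  unfolding bessel_eq_def
proof
  fix q :: complex assume q: "q \<in> ball 0 (\<rho> * R)"
  \<comment> \<open>\<open>H'\<close> is the Bessel expression in q applied to the integrand, and
    \<open>H\<close> is a primitive of it in a that is single-valued on the circle. The integral of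
    \<open>H'\<close> over the closed circle is therefore 0.\<close>
  define H where "H a = deriv (fund k) ((of_real R - a) * (of_real R - q / a)) * (of_real R - a) / a ^ Suc n" for a
  define H' where "H' a = q * graf_integrand 2 q a + of_nat (Suc n) * graf_integrand 1 q a + of_real (kap k) * graf_integrand 0 q a" for a
  have dH: "(H has_field_derivative H' a) (at a)" if "a \<in> sphere 0 \<rho>" for a
  proof -
    have a: "cmod a = \<rho>" "a \<noteq> 0" using that \<rho> by auto
    define w where "w = (of_real R - a) * (of_real R - q / a)"
    have w: "w \<in> slit" unfolding w_def by (rule graf_slit[OF q a(1)])
    define F0 F1 F2 where "F0 = fund k w" and "F1 = deriv (fund k) w" and "F2 = deriv (deriv (fund k)) w"
    have ode: "w * F2 + F1 + of_real (kap k) * F0 = 0"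
      using fund_ode[of k] w by (simp add: bessel_eq_def F0_def F1_def F2_def)
    define w' where "w' = - (of_real R - q / a) + (of_real R - a) * (q / a\<^sup>2)"
    have dw: "((\<lambda>a. (of_real R - a) * (of_real R - q / a)) has_field_derivative w') (at a)"
      using a unfolding w'_def by (auto intro!: derivative_eq_intros simp: field_simps power2_eq_square)
    have d1: "(deriv (fund k) has_field_derivative F2) (at w)"
      using fund_deriv_DERIV[OF w, of 1] by (simp add: F2_def)
    have "((\<lambda>a. deriv (fund k) ((of_real R - a) * (of_real R - q / a))) has_field_derivative F2 * w') (at a)"
      using d1 dw unfolding w_def by (rule DERIV_chain2)
    moreover have "((\<lambda>a. (of_real R - a) * (1 / a) ^ Suc n) has_field_derivative
        (0 - 1) * (1 / a) ^ Suc n + of_nat (Suc n) * ((1 / a) ^ n * (- 1 / a\<^sup>2)) * (of_real R - a)) (at a)"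
    proof (intro DERIV_mult DERIV_diff DERIV_const DERIV_ident)
      have "((\<lambda>a. 1 / a) has_field_derivative - 1 / a\<^sup>2) (at a)"
        using a by (auto intro!: derivative_eq_intros simp: power2_eq_square)
      from DERIV_power[OF this, of "Suc n"]
      show "((\<lambda>a. (1 / a) ^ Suc n) has_field_derivative of_nat (Suc n) * ((1 / a) ^ n * (- 1 / a\<^sup>2))) (at a)"
        by (simp only: diff_Suc_Suc diff_zero mult_ac)
    qed
    ultimately have "((\<lambda>a. deriv (fund k) ((of_real R - a) * (of_real R - q / a)) * ((of_real R - a) * (1 / a) ^ Suc n)) has_field_derivative
        F2 * w' * ((of_real R - a) * (1 / a) ^ Suc n) + ((0 - 1) * (1 / a) ^ Suc n
          + of_nat (Suc n) * ((1 / a) ^ n * (- 1 / a\<^sup>2)) * (of_real R - a)) * F1) (at a)"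
      unfolding F1_def w_def by (rule DERIV_mult)
    moreover have "(\<lambda>a. deriv (fund k) ((of_real R - a) * (of_real R - q / a)) * ((of_real R - a) * (1 / a) ^ Suc n)) = H"
      by (simp add: H_def fun_eq_iff power_one_over)
    moreover have "F2 * w' * ((of_real R - a) * (1 / a) ^ Suc n) + ((0 - 1) * (1 / a) ^ Suc n
          + of_nat (Suc n) * ((1 / a) ^ n * (- 1 / a\<^sup>2)) * (of_real R - a)) * F1
        = F2 * w' * (of_real R - a) / a ^ Suc n - F1 / a ^ Suc n
         - of_nat (Suc n) * F1 * (of_real R - a) / a ^ Suc (Suc n)"
      by (simp add: power_one_over power2_eq_square diff_divide_distrib ring_distribs mult_ac del: of_nat_Suc)
    moreover have "F2 * w' * (of_real R - a) / a ^ Suc n - F1 / a ^ Suc n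
         - of_nat (Suc n) * F1 * (of_real R - a) / a ^ Suc (Suc n) = H' a"
    proof -
      \<comment> \<open>This splits the derivative of w in a: the part -w feeds the equation of
        \<open>fund\<close>, and the other is the term with q in the Bessel equation for the
        integral.\<close>
      have ww: "w' * (of_real R - a) = - w + q * ((of_real R - a) / a)\<^sup>2"
        using a by (simp add: w'_def w_def field_simps power2_eq_square)
      have "H' a = (q * F2 * ((of_real R - a) / a)\<^sup>2 - of_nat (Suc n) * F1 * ((of_real R - a) / a) + of_real (kap k) * F0) / a ^ Suc n"
        unfolding H'_def graf_integrand_def w_def[symmetric]
        by (simp add: F0_def F1_def F2_def eval_nat_numeral add_divide_distrib diff_divide_distrib ring_distribs mult_ac del: of_nat_Suc)
      also have "of_real (kap k) * F0 = - w * F2 - F1" using ode by algebra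
      also have "(q * F2 * ((of_real R - a) / a)\<^sup>2 - of_nat (Suc n) * F1 * ((of_real R - a) / a) + (- w * F2 - F1)) / a ^ Suc n
          = (F2 * (- w + q * ((of_real R - a) / a)\<^sup>2) - F1 - of_nat (Suc n) * F1 * ((of_real R - a) / a)) / a ^ Suc n"
        by (simp add: algebra_simps del: of_nat_Suc)
      also have "\<dots> = F2 * w' * (of_real R - a) / a ^ Suc n - F1 / a ^ Suc n
         - of_nat (Suc n) * F1 * (of_real R - a) / a ^ Suc (Suc n)"
      proof -
        have "(F2 * (w' * v) - F1 - N * F1 * (v / a)) / a ^ Suc n = F2 * w' * v / a ^ Suc n - F1 / a ^ Suc n - N * F1 * v / a ^ Suc (Suc n)"
          for v N by (simp add: diff_divide_distrib mult.assoc)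
        then show ?thesis unfolding ww[symmetric] .
      qed
      finally show ?thesis by simp
    qed
    ultimately show ?thesis by simp
  qed
  have "(H' has_contour_integral 0) (circlepath 0 \<rho>)"
  proof (rule Cauchy_theorem_primitive)
    show "(H has_field_derivative H' a) (at a within sphere 0 \<rho>)" if "a \<in> sphere 0 \<rho>" for a
      by (rule has_field_derivative_at_within[OF dH[OF that]])
  qed (use \<rho> in auto)
  then have "contour_integral (circlepath 0 \<rho>) H' = 0" by (rule contour_integral_unique)
  also have "contour_integral (circlepath 0 \<rho>) H' = q * graf_int 2 q + of_nat (Suc n) * graf_int 1 q + of_real (kap k) * graf_int 0 q"
    unfolding H'_def graf_int_def using graf_integrand_integrable[OF q]
    by (simp add: contour_integral_add contour_integral_lmul contour_integrable_add contour_integrable_lmul del: of_nat_Suc)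
  finally have eq: "q * graf_int 2 q + of_nat (Suc n) * graf_int 1 q + of_real (kap k) * graf_int 0 q = 0" .
  have "deriv (graf_int 0) q = graf_int 1 q" "deriv (deriv (graf_int 0)) q = graf_int 2 q"
    using deriv_deriv_eqI[OF open_ball q, of "graf_int 0" "graf_int 1" "graf_int 2"]
      graf_int_DERIV[of _ 0] graf_int_DERIV[of _ 1] by (simp_all add: numeral_2_eq_2)
  then show "q * deriv (deriv (graf_int 0)) q + of_nat (Suc n) * deriv (graf_int 0) q + of_real (kap k) * graf_int 0 q = 0"
    using eq by simp
qed

text \<open>At q = 0 the argument of \<open>fund\<close> becomes R^2 - R a, holomorphic for |a| < R,
  and a^(n+1) in the denominator is the only pole. Cauchy's formula then gives the n-th derivative,
  with (-R)^n from the affine substitution.\<close>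

lemma graf_int_0: "graf_int 0 0 = 2 * pi * \<i> / fact n * ((- of_real R) ^ n * (deriv ^^ n) (fund k) (of_real (R\<^sup>2)))"
proof -
  define f where "f a = fund k (- of_real R * a + of_real (R\<^sup>2))" for a
  have slit: "- of_real R * a + of_real (R\<^sup>2) \<in> slit" if "a \<in> ball 0 R" for a
  proof -
    have "(of_real R - a) * of_real R \<in> slit"
      by (rule slit_mult) (use that complex_Re_le_cmod[of a] \<rho> in auto)
    then show ?thesis by (simp add: algebra_simps power2_eq_square)
  qed
  have hol: "f holomorphic_on ball 0 R"
    unfolding f_def using slit
    by (intro holomorphic_on_compose_gen[OF _ fund_holomorphic, unfolded o_def]) (auto intro!: holomorphic_intros)
  have "((\<lambda>u. f u / (u - 0) ^ Suc n) has_contour_integral ((2 * pi * \<i>) / fact n * (deriv ^^ n) f 0)) (circlepath 0 \<rho>)"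
  proof (rule Cauchy_has_contour_integral_higher_derivative_circlepath)
    show "continuous_on (cball 0 \<rho>) f"
      using \<rho> by (intro holomorphic_on_imp_continuous_on holomorphic_on_subset[OF hol]) auto
    show "f holomorphic_on ball 0 \<rho>" using \<rho> by (intro holomorphic_on_subset[OF hol]) auto
  qed (use \<rho> in auto)
  then have "contour_integral (circlepath 0 \<rho>) (\<lambda>u. f u / u ^ Suc n) = (2 * pi * \<i>) / fact n * (deriv ^^ n) f 0"
    using contour_integral_unique by simp
  moreover have "graf_int 0 0 = contour_integral (circlepath 0 \<rho>) (\<lambda>u. f u / u ^ Suc n)"
    unfolding graf_int_def graf_integrand_def f_def
    by (intro arg_cong2[where f=contour_integral] refl) (simp add: algebra_simps power2_eq_square fun_eq_iff)
  moreover have "(deriv ^^ n) f 0 = (- of_real R) ^ n * (deriv ^^ n) (fund k) (- of_real R * 0 + of_real (R\<^sup>2))"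
    unfolding f_def
    by (rule higher_deriv_compose_linear'[OF fund_holomorphic open_ball open_slit, of _ 0 R]) (use \<rho> slit in auto)
  ultimately show ?thesis by simp
qed

text \<open>A solution holomorphic at the singular point 0 is fixed by its value there, so it is a
  multiple of the n-th derivative of \<open>bes_A\<close>, which does not vanish at 0.\<close>

lemma graf_int_eq:
  assumes q: "q \<in> ball 0 (\<rho> * R)"
  shows "graf_int 0 q = graf_int 0 0 / (deriv ^^ n) (bes_A (kap k)) 0 * (deriv ^^ n) (bes_A (kap k)) q"
proof -
  define A where "A = (deriv ^^ n) (bes_A (kap k))"
  define c where "c = graf_int 0 0 / A 0"
  have A0: "A 0 \<noteq> 0" unfolding A_def by (rule bes_A_deriv_0_nonzero) (use k in \<open>simp add: kap_def\<close>)
  have A_hol: "A holomorphic_on UNIV" unfolding A_def by (rule holomorphic_higher_deriv[OF bes_A_holomorphic open_UNIV])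
  have A_ode: "bessel_eq (of_nat (Suc n)) (kap k) UNIV A"
    using bessel_eq_higher_deriv[OF open_UNIV bes_A_holomorphic[of "kap k"] bes_A_ode[of "kap k"], of n] by (simp add: A_def)
  have dA: "(A has_field_derivative deriv A w) (at w)" for w
    by (rule holomorphic_derivI[OF A_hol open_UNIV]) simp
  have dA': "(deriv A has_field_derivative deriv (deriv A) w) (at w)" for w
    by (rule holomorphic_derivI[OF holomorphic_deriv[OF A_hol open_UNIV] open_UNIV]) simp
  have dg: "(graf_int 0 has_field_derivative deriv (graf_int 0) w) (at w)" if "w \<in> ball 0 (\<rho> * R)" for w
    by (rule holomorphic_derivI[OF graf_int_holomorphic open_ball that])
  have dg': "(deriv (graf_int 0) has_field_derivative deriv (deriv (graf_int 0)) w) (at w)" if "w \<in> ball 0 (\<rho> * R)" for w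
    by (rule holomorphic_derivI[OF holomorphic_deriv[OF graf_int_holomorphic open_ball] open_ball that])
  define y where "y w = graf_int 0 w - c * A w" for w
  have dy: "deriv y w = deriv (graf_int 0) w - c * deriv A w" "deriv (deriv y) w = deriv (deriv (graf_int 0)) w - c * deriv (deriv A) w"
    if "w \<in> ball 0 (\<rho> * R)" for w
  proof -
    have d1: "(y has_field_derivative (deriv (graf_int 0) w - c * deriv A w)) (at w)" if "w \<in> ball 0 (\<rho> * R)" for w
      unfolding y_def by (intro DERIV_diff DERIV_cmult dA dg that)
    have d2: "((\<lambda>w. deriv (graf_int 0) w - c * deriv A w) has_field_derivative
        (deriv (deriv (graf_int 0)) w - c * deriv (deriv A) w)) (at w)" if "w \<in> ball 0 (\<rho> * R)" for w
      by (intro DERIV_diff DERIV_cmult dA' dg' that)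
    show "deriv y w = deriv (graf_int 0) w - c * deriv A w"
      by (rule deriv_deriv_eqI(1)[OF open_ball that d1 d2])
    show "deriv (deriv y) w = deriv (deriv (graf_int 0)) w - c * deriv (deriv A) w"
      by (rule deriv_deriv_eqI(2)[OF open_ball that d1 d2])
  qed
  have "y q = 0"
  proof (rule bessel_eq_unique[OF _ _ _ q])
    show "y holomorphic_on ball 0 (\<rho> * R)"
      unfolding y_def by (intro holomorphic_intros graf_int_holomorphic holomorphic_on_subset[OF A_hol]) auto
    show "bessel_eq (of_nat (Suc n)) (kap k) (ball 0 (\<rho> * R)) y"
      unfolding bessel_eq_def
    proof
      fix w :: complex assume w: "w \<in> ball 0 (\<rho> * R)"
      have a: "w * deriv (deriv A) w + of_nat (Suc n) * deriv A w + of_real (kap k) * A w = 0"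
        using A_ode by (simp add: bessel_eq_def del: of_nat_Suc)
      have g: "w * deriv (deriv (graf_int 0)) w + of_nat (Suc n) * deriv (graf_int 0) w + of_real (kap k) * graf_int 0 w = 0"
        using graf_int_ode w by (simp add: bessel_eq_def del: of_nat_Suc)
      have "w * deriv (deriv y) w + of_nat (Suc n) * deriv y w + of_real (kap k) * y w
        = (w * deriv (deriv (graf_int 0)) w + of_nat (Suc n) * deriv (graf_int 0) w + of_real (kap k) * graf_int 0 w)
          - c * (w * deriv (deriv A) w + of_nat (Suc n) * deriv A w + of_real (kap k) * A w)"
        unfolding dy[OF w] y_def by (simp add: algebra_simps del: of_nat_Suc)
      then show "w * deriv (deriv y) w + of_nat (Suc n) * deriv y w + of_real (kap k) * y w = 0"
        unfolding a g by simp
    qed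
    show "y 0 = 0" using A0 by (simp add: y_def c_def)
  qed
  then show ?thesis by (simp add: y_def c_def A_def)
qed

end

definition graf_const :: "real \<Rightarrow> nat \<Rightarrow> complex" where
  "graf_const k n = (-1) ^ n / (fact n * (deriv ^^ n) (bes_A (kap k)) 0)"

lemma graf_const_nonzero: "k > 0 \<Longrightarrow> graf_const k n \<noteq> 0"
  using bes_A_deriv_0_nonzero[of "kap k" n] by (simp add: graf_const_def kap_def)

text \<open>On |a| = r one has r^2 / a = cnj a, so q = r^2 recovers the actual distance inside the
  holomorphic family \<open>graf_int\<close>. Up to constants, r^n times the derivative of
  \<open>bes_A\<close> is J_n(k r) and R^n times that of \<open>fund\<close> is H_n(k R): this is
  Graf's addition theorem for a single mode.\<close>

theorem graf_coefficient:
  assumes k: "k > 0" and r: "0 < r" "r < R"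
  shows "integral {0..1} (\<lambda>t. fund k (of_real ((cmod (of_real R - of_real r * cis (2 * pi * t)))\<^sup>2)) * cis (- (2 * pi * real n * t)))
    = graf_const k n * of_real (R * r) ^ n * (deriv ^^ n) (bes_A (kap k)) (of_real (r\<^sup>2)) * (deriv ^^ n) (fund k) (of_real (R\<^sup>2))"
    (is "?I = _")
proof -
  define A where "A = (deriv ^^ n) (bes_A (kap k))"
  have q: "of_real (r\<^sup>2) \<in> ball (0::complex) (r * R)"
    using r by (simp add: power2_eq_square norm_mult)
  have cp: "circlepath 0 r t = of_real r * cis (2 * pi * t)" for t
    by (simp add: circlepath cis_conv_exp mult_ac)
  have integrand: "graf_integrand k R n 0 (of_real (r\<^sup>2)) (circlepath 0 r t) * vector_derivative (circlepath 0 r) (at t)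
     = 2 * pi * \<i> / of_real r ^ n * (fund k (of_real ((cmod (of_real R - of_real r * cis (2 * pi * t)))\<^sup>2)) * cis (- (2 * pi * real n * t)))" for t
  proof -
    define a where "a = of_real r * cis (2 * pi * t)"
    have a0: "a \<noteq> 0" using r by (simp add: a_def)
    have "cnj a * a = of_real (r\<^sup>2)" by (simp add: a_def mult.commute power2_eq_square cis_cnj cis_mult mult.left_commute)
    then have "of_real (r\<^sup>2) / a = cnj a" using a0 by (simp add: field_simps)
    then have w: "(of_real R - a) * (of_real R - of_real (r\<^sup>2) / a) = of_real ((cmod (of_real R - a))\<^sup>2)"
      unfolding complex_norm_square by simp
    have vd: "vector_derivative (circlepath 0 r) (at t) = 2 * pi * \<i> * a"
      by (simp add: vector_derivative_circlepath a_def cis_conv_exp mult_ac)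
    have an: "1 / a ^ n = cis (- (2 * pi * real n * t)) / of_real r ^ n"
    proof -
      have "cis (2 * pi * t) ^ n = cis (2 * pi * real n * t)" by (subst Complex.DeMoivre) (simp add: mult_ac)
      then have "a ^ n = of_real r ^ n * cis (2 * pi * real n * t)" by (simp only: a_def power_mult_distrib)
      then show ?thesis by (simp only: cis_inverse[symmetric] divide_inverse inverse_mult_distrib mult_1_left mult.commute)
    qed
    have "graf_integrand k R n 0 (of_real (r\<^sup>2)) a * (2 * pi * \<i> * a)
       = fund k ((of_real R - a) * (of_real R - of_real (r\<^sup>2) / a)) * (2 * pi * \<i>) * (1 / a ^ n)"
      using a0 by (simp add: graf_integrand_def[OF k r])
    also have "\<dots> = 2 * pi * \<i> / of_real r ^ n * (fund k (of_real ((cmod (of_real R - a))\<^sup>2)) * cis (- (2 * pi * real n * t)))"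
      unfolding w an by simp
    finally show ?thesis unfolding cp vd by (simp add: a_def)
  qed
  have "graf_int k R r n 0 (of_real (r\<^sup>2)) = 2 * pi * \<i> / of_real r ^ n * ?I"
    unfolding graf_int_def[OF k r] contour_integral_integral integrand by simp
  then have "2 * pi * \<i> / of_real r ^ n * ?I = graf_int k R r n 0 0 / A 0 * A (of_real (r\<^sup>2))"
    using graf_int_eq[OF k r q, of n] by (simp add: A_def)
  also have "\<dots> = 2 * pi * \<i> / of_real r ^ n * (graf_const k n * of_real (R * r) ^ n * A (of_real (r\<^sup>2)) * (deriv ^^ n) (fund k) (of_real (R\<^sup>2)))"
    unfolding graf_int_0[OF k r, of n] graf_const_def A_def[symmetric] using r
    by (simp add: power_mult_distrib power_minus[of "of_real R"] field_simps)
  finally have "2 * pi * \<i> / of_real r ^ n * ?I =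
     2 * pi * \<i> / of_real r ^ n * (graf_const k n * of_real (R * r) ^ n * A (of_real (r\<^sup>2)) * (deriv ^^ n) (fund k) (of_real (R\<^sup>2)))" .
  then show ?thesis using r by (simp add: A_def)
qed


section \<open>Wirtinger derivatives\<close>

text \<open>\<open>a\<close> and \<open>b\<close> are the derivatives with respect to x and cnj x.
  For functions of (x - y) cnj (x - y) they reduce the Helmholtz equation to one-variable
  calculus.\<close>

definition wirt_at :: "(complex \<Rightarrow> complex) \<Rightarrow> complex \<Rightarrow> complex \<Rightarrow> complex \<Rightarrow> bool" where
  "wirt_at u a b x \<longleftrightarrow> (u has_derivative (\<lambda>h. a * h + b * cnj h)) (at x)"

lemma wirt_at_mult:
  assumes "wirt_at u a b x" "wirt_at v c d x"
  shows "wirt_at (\<lambda>x. u x * v x) (a * v x + u x * c) (b * v x + u x * d) x"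
  using has_derivative_mult[OF assms[unfolded wirt_at_def]] unfolding wirt_at_def
  by (simp add: algebra_simps)

lemma wirt_at_add:
  assumes "wirt_at u a b x" "wirt_at v c d x"
  shows "wirt_at (\<lambda>x. u x + v x) (a + c) (b + d) x"
  using has_derivative_add[OF assms[unfolded wirt_at_def]] unfolding wirt_at_def
  by (simp add: algebra_simps)

lemma wirt_at_const: "wirt_at (\<lambda>x. c) 0 0 x"
  by (simp add: wirt_at_def)

lemma wirt_at_holomorphic:
  assumes "(f has_field_derivative f') (at x)"
  shows "wirt_at f f' 0 x"
  using assms by (simp add: wirt_at_def has_field_derivative_def)

lemma wirt_at_cnj: "wirt_at (\<lambda>x. cnj (x - c)) 0 1 x"
  unfolding wirt_at_def by (auto intro!: derivative_eq_intros)

lemma wirt_at_compose: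
  assumes "(f has_field_derivative f') (at (u x))" "wirt_at u a b x"
  shows "wirt_at (\<lambda>x. f (u x)) (f' * a) (f' * b) x"
  using has_derivative_compose[OF assms(2)[unfolded wirt_at_def] assms(1)[unfolded has_field_derivative_def]]
  unfolding wirt_at_def by (simp add: algebra_simps)

lemma wirt_at_transform:
  assumes "wirt_at u a b x" "open G" "x \<in> G" "\<And>y. y \<in> G \<Longrightarrow> u y = v y"
  shows "wirt_at v a b x"
  using has_derivative_transform_within_open[OF assms(1)[unfolded wirt_at_def] assms(2,3,4)]
  by (simp add: wirt_at_def)

lemma wirt_at_isCont: "wirt_at u a b x \<Longrightarrow> isCont u x"
  unfolding wirt_at_def by (rule has_derivative_continuous)

lemma wirt_at_directional:
  assumes "wirt_at u a b x"
  shows "((\<lambda>t::real. u (x + of_real t * e)) has_vector_derivative (a * e + b * cnj e)) (at 0)"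
proof -
  have "((\<lambda>t::real. x + of_real t * e) has_derivative (\<lambda>t. of_real t * e)) (at 0)"
    by (auto intro!: derivative_eq_intros)
  moreover have "(u has_derivative (\<lambda>h. a * h + b * cnj h)) (at (x + of_real 0 * e))"
    using assms by (simp add: wirt_at_def)
  ultimately have "((\<lambda>t::real. u (x + of_real t * e)) has_derivative (\<lambda>t. a * (of_real t * e) + b * cnj (of_real t * e))) (at 0)"
    by (rule has_derivative_compose)
  then show ?thesis unfolding has_vector_derivative_def
    by (simp add: scaleR_conv_of_real algebra_simps)
qed

lemma wirt_at_partial_deriv: "wirt_at u a b x \<Longrightarrow> partial_deriv e u x = a * e + b * cnj e"
  unfolding partial_deriv_def by (rule vector_derivative_at[OF wirt_at_directional])

lemma C1_on_wirt:
  assumes u: "\<And>x. x \<in> G \<Longrightarrow> wirt_at u (a x) (b x) x" and "continuous_on G a" "continuous_on G b"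
  shows "C1_on G u"
  unfolding C1_on_def
proof (intro ballI conjI)
  fix e :: complex
  show "(\<lambda>t::real. u (x + of_real t * e)) differentiable (at 0)" if "x \<in> G" for x
    using wirt_at_directional[OF u[OF that]] by (rule differentiableI_vector)
  have "continuous_on G (\<lambda>x. a x * e + b x * cnj e)" by (intro continuous_intros assms)
  then show "continuous_on G (partial_deriv e u)"
    by (rule continuous_on_cong[THEN iffD1, rotated -1]) (auto simp: wirt_at_partial_deriv[OF u])
qed

text \<open>The second derivative along 1 is aa + 2 ab + bb and the one along i is -aa + 2 ab - bb,
  so their sum is 4 ab. Using the same \<open>ab\<close> for both mixed derivatives encodes their
  symmetry.\<close>

lemma C2_on_wirt:
  assumes G: "open G"
    and u: "\<And>x. x \<in> G \<Longrightarrow> wirt_at u (a x) (b x) x"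
    and a: "\<And>x. x \<in> G \<Longrightarrow> wirt_at a (aa x) (ab x) x"
    and b: "\<And>x. x \<in> G \<Longrightarrow> wirt_at b (ab x) (bb x) x"
    and cont: "continuous_on G aa" "continuous_on G ab" "continuous_on G bb"
  shows "C2_on G u" "\<And>x. x \<in> G \<Longrightarrow> laplacian u x = 4 * ab x"
proof -
  have pd: "wirt_at (partial_deriv e u) (aa x * e + ab x * cnj e) (ab x * e + bb x * cnj e) x" if x: "x \<in> G" for x e
  proof (rule wirt_at_transform[OF _ G x])
    have "wirt_at (\<lambda>x. a x * e + b x * cnj e) ((aa x * e + a x * 0) + (ab x * cnj e + b x * 0))
        ((ab x * e + a x * 0) + (bb x * cnj e + b x * 0)) x"
      by (intro wirt_at_add wirt_at_mult a b x wirt_at_const)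
    then show "wirt_at (\<lambda>x. a x * e + b x * cnj e) (aa x * e + ab x * cnj e) (ab x * e + bb x * cnj e) x"
      by simp
  qed (simp add: wirt_at_partial_deriv[OF u])
  have ca: "continuous_on G a" "continuous_on G b"
    using wirt_at_isCont[OF a] wirt_at_isCont[OF b] by (auto intro!: continuous_at_imp_continuous_on)
  show "C2_on G u"
    unfolding C2_on_def
    by (intro conjI ballI C1_on_wirt[OF u] ca C1_on_wirt[OF pd] continuous_intros cont)
  show "laplacian u x = 4 * ab x" if "x \<in> G" for x
    using wirt_at_partial_deriv[OF pd[OF that, of 1], of 1] wirt_at_partial_deriv[OF pd[OF that, of \<i>], of \<i>]
    by (simp add: laplacian_def algebra_simps)
qed

section \<open>Integrals depending on a parameter\<close>

text \<open>The underlying sigma-algebra is that of C itself, as for \<open>arclength\<close>.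
  Continuity on C then gives measurability, and compactness gives the uniform bounds needed for
  dominated convergence.\<close>

locale compact_measure =
  fixes M :: "complex measure" and C :: "complex set"
  assumes compact_C: "compact C" and sets_M: "sets M = sets (restrict_space borel C)"
begin

lemma space_M: "space M = C"
  using sets_eq_imp_space_eq[OF sets_M] by (simp add: space_restrict_space)

lemma borel_measurable_M: "continuous_on C f \<Longrightarrow> f \<in> borel_measurable M"
  unfolding measurable_cong_sets[OF sets_M refl] by (rule borel_measurable_continuous_on_restrict)

lemma section_continuous:
  fixes K :: "complex \<Rightarrow> complex \<Rightarrow> complex"
  assumes "continuous_on (U \<times> C) (\<lambda>(x, y). K x y)" "x \<in> U"
  shows "continuous_on C (K x)"
proof -
  have "continuous_on C (\<lambda>y. case (x, y) of (x, y) \<Rightarrow> K x y)"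
    by (rule continuous_on_compose2[OF assms(1)]) (use assms(2) in \<open>auto intro!: continuous_intros\<close>)
  then show ?thesis by simp
qed

lemma compact_bound:
  fixes K :: "complex \<Rightarrow> complex \<Rightarrow> complex"
  assumes "continuous_on (U \<times> C) (\<lambda>(x, y). K x y)" "compact S" "S \<subseteq> U"
  obtains B where "B \<ge> 0" "\<And>x y. x \<in> S \<Longrightarrow> y \<in> C \<Longrightarrow> cmod (K x y) \<le> B"
proof -
  have "compact ((\<lambda>(x, y). K x y) ` (S \<times> C))"
    by (intro compact_continuous_image continuous_on_subset[OF assms(1)] compact_Times assms compact_C) (use assms in auto)
  then obtain B where B: "\<forall>z\<in>(\<lambda>(x, y). K x y) ` (S \<times> C). cmod z \<le> B"
    using compact_imp_bounded bounded_iff by blast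
  show ?thesis
    by (rule that[of "max 0 B"]) (use B in force)+
qed

lemma param_integrable:
  fixes K \<psi> :: "complex \<Rightarrow> complex"
  assumes \<psi>: "integrable M \<psi>" and K: "continuous_on C K"
  shows "integrable M (\<lambda>y. K y * \<psi> y)"
proof -
  have "compact (K ` C)" by (rule compact_continuous_image[OF K compact_C])
  then obtain B where B: "\<forall>z\<in>K ` C. cmod z \<le> B" using compact_imp_bounded bounded_iff by blast
  have [measurable]: "K \<in> borel_measurable M" "\<psi> \<in> borel_measurable M"
    using borel_measurable_M[OF K] \<psi> by auto
  show ?thesis
  proof (rule Bochner_Integration.integrable_bound)
    show "integrable M (\<lambda>y. B * cmod (\<psi> y))" using \<psi> by simp
    show "AE y in M. norm (K y * \<psi> y) \<le> norm (B * cmod (\<psi> y))"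
      by (rule AE_I2) (use B in \<open>auto simp: space_M norm_mult abs_mult intro!: mult_right_mono order_trans[OF _ abs_ge_self]\<close>)
  qed measurable
qed

lemma param_continuous:
  fixes K :: "complex \<Rightarrow> complex \<Rightarrow> complex" and \<psi> :: "complex \<Rightarrow> complex"
  assumes \<psi>: "integrable M \<psi>" and U: "open U" and K: "continuous_on (U \<times> C) (\<lambda>(x, y). K x y)"
  shows "continuous_on U (\<lambda>x. LINT y|M. K x y * \<psi> y)"
proof (rule continuous_on_sequentiallyI)
  fix s :: "nat \<Rightarrow> complex" and x assume s: "\<forall>n. s n \<in> U" "x \<in> U" "s \<longlonglongrightarrow> x"
  have cpt: "compact (insert x (range s))" by (rule compact_sequence_with_limit[OF s(3)])
  obtain B where B: "B \<ge> 0" "\<And>x' y. x' \<in> insert x (range s) \<Longrightarrow> y \<in> C \<Longrightarrow> cmod (K x' y) \<le> B"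
    using compact_bound[OF K cpt] s by auto
  have [measurable]: "\<psi> \<in> borel_measurable M" using \<psi> by auto
  have meas[measurable]: "K x' \<in> borel_measurable M" if "x' \<in> U" for x'
    by (rule borel_measurable_M[OF section_continuous[OF K that]])
  show "(\<lambda>n. LINT y|M. K (s n) y * \<psi> y) \<longlonglongrightarrow> (LINT y|M. K x y * \<psi> y)"
  proof (rule integral_dominated_convergence[where w="\<lambda>y. B * cmod (\<psi> y)"])
    show "integrable M (\<lambda>y. B * cmod (\<psi> y))" using \<psi> by simp
    show "AE y in M. (\<lambda>n. K (s n) y * \<psi> y) \<longlonglongrightarrow> K x y * \<psi> y"
    proof (rule AE_I2)
      fix y assume "y \<in> space M"
      then have y: "y \<in> C" by (simp add: space_M)
      have "(\<lambda>n. case (s n, y) of (x, y) \<Rightarrow> K x y) \<longlonglongrightarrow> (case (x, y) of (x, y) \<Rightarrow> K x y)"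
        by (rule continuous_on_tendsto_compose[OF K]) (use s y in \<open>auto intro!: tendsto_intros\<close>)
      then show "(\<lambda>n. K (s n) y * \<psi> y) \<longlonglongrightarrow> K x y * \<psi> y" by (auto intro: tendsto_mult)
    qed
    show "AE y in M. norm (K (s n) y * \<psi> y) \<le> B * cmod (\<psi> y)" for n
      by (rule AE_I2) (auto simp: norm_mult space_M intro!: mult_right_mono B(2))
  qed (use s meas in \<open>auto intro!: borel_measurable_times\<close>)
qed

text \<open>The remainder quotient of the kernel is at most 2 B near x: one B comes from the mean
  value inequality on a ball, the other from the linear part. Dominated convergence along sequences
  does the rest.\<close>

lemma param_wirt:
  fixes K :: "complex \<Rightarrow> complex \<Rightarrow> complex" and \<psi> :: "complex \<Rightarrow> complex"
  assumes \<psi>: "integrable M \<psi>" and U: "open U"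
    and K: "continuous_on (U \<times> C) (\<lambda>(x, y). K x y)"
    and a: "continuous_on (U \<times> C) (\<lambda>(x, y). a x y)" and b: "continuous_on (U \<times> C) (\<lambda>(x, y). b x y)"
    and d: "\<And>x y. x \<in> U \<Longrightarrow> y \<in> C \<Longrightarrow> wirt_at (\<lambda>x. K x y) (a x y) (b x y) x"
    and x: "x \<in> U"
  shows "wirt_at (\<lambda>x. LINT y|M. K x y * \<psi> y) (LINT y|M. a x y * \<psi> y) (LINT y|M. b x y * \<psi> y) x"
proof -
  obtain r where r: "r > 0" "cball x r \<subseteq> U" using U x by (meson open_contains_cball)
  obtain Ba where Ba: "Ba \<ge> 0" "\<And>x' y. x' \<in> cball x r \<Longrightarrow> y \<in> C \<Longrightarrow> cmod (a x' y) \<le> Ba"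
    using compact_bound[OF a compact_cball r(2)] by blast
  obtain Bb where Bb: "Bb \<ge> 0" "\<And>x' y. x' \<in> cball x r \<Longrightarrow> y \<in> C \<Longrightarrow> cmod (b x' y) \<le> Bb"
    using compact_bound[OF b compact_cball r(2)] by blast
  define B where "B = Ba + Bb"
  have B: "B \<ge> 0" using Ba(1) Bb(1) by (simp add: B_def)
  have lin_bound: "cmod (a x' y * h + b x' y * cnj h) \<le> B * cmod h" if "x' \<in> cball x r" "y \<in> C" for x' y h
  proof -
    have "cmod (a x' y * h + b x' y * cnj h) \<le> cmod (a x' y) * cmod h + cmod (b x' y) * cmod h"
      by (rule order_trans[OF norm_triangle_ineq]) (simp add: norm_mult)
    also have "\<dots> \<le> Ba * cmod h + Bb * cmod h" using Ba(2)[OF that] Bb(2)[OF that] by (intro add_mono mult_right_mono) auto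
    finally show ?thesis by (simp add: B_def distrib_right)
  qed
  have K_lip: "cmod (K x' y - K x y) \<le> B * cmod (x' - x)" if "x' \<in> cball x r" "y \<in> C" for x' y
  proof (rule differentiable_bound[OF convex_cball[of x r]])
    fix x' assume x': "x' \<in> cball x r"
    show "((\<lambda>x. K x y) has_derivative (\<lambda>h. a x' y * h + b x' y * cnj h)) (at x' within cball x r)"
      using d[of x' y] x' r that unfolding wirt_at_def by (blast intro: has_derivative_at_withinI)
    show "onorm (\<lambda>h. a x' y * h + b x' y * cnj h) \<le> B"
      by (rule onorm_le) (rule lin_bound[OF x' that(2)])
  qed (use that r in auto)
  define L where "L h = (LINT y|M. a x y * \<psi> y) * h + (LINT y|M. b x y * \<psi> y) * cnj h" for h
  have meas[measurable]: "\<psi> \<in> borel_measurable M" using \<psi> by auto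
  have mK[measurable]: "K x' \<in> borel_measurable M" and iK: "integrable M (\<lambda>y. K x' y * \<psi> y)" if "x' \<in> U" for x'
    using borel_measurable_M section_continuous[OF K that] param_integrable[OF \<psi>] by auto
  have ma[measurable]: "a x \<in> borel_measurable M" "b x \<in> borel_measurable M"
    and ia: "integrable M (\<lambda>y. a x y * \<psi> y)" "integrable M (\<lambda>y. b x y * \<psi> y)"
    using borel_measurable_M section_continuous[OF a x] section_continuous[OF b x] param_integrable[OF \<psi>] by auto
  have bl: "bounded_linear (\<lambda>h. p * h + q * cnj h)" for p q :: complex
    by (intro bounded_linear_add bounded_linear_mult_right bounded_linear_compose[OF bounded_linear_mult_right bounded_linear_cnj])
  have "((\<lambda>x'. norm (((LINT y|M. K x' y * \<psi> y) - (LINT y|M. K x y * \<psi> y)) - L (x' - x)) / norm (x' - x)) \<longlongrightarrow> 0) (at x)"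
    unfolding tendsto_at_iff_sequentially
  proof (intro allI impI)
    fix s :: "nat \<Rightarrow> complex" assume s: "\<forall>i. s i \<in> UNIV - {x}" "s \<longlonglongrightarrow> x"
    have ev: "\<forall>\<^sub>F n in sequentially. s n \<in> cball x r"
      using tendstoD[OF s(2) r(1)] by eventually_elim (simp add: dist_commute less_imp_le)
    then obtain N where N: "\<And>n. n \<ge> N \<Longrightarrow> s n \<in> cball x r" by (auto simp: eventually_sequentially)
    \<comment> \<open>The index shift puts every term into the ball, so the dominating bound holds
      for all n.\<close>
    define t where "t n = s (n + N)" for n
    have t: "t n \<in> cball x r" "t n \<in> U" "t n \<noteq> x" for n
      using N[of "n + N"] r s(1) by (auto simp: t_def)
    have t_lim: "t \<longlonglongrightarrow> x" unfolding t_def by (rule LIMSEQ_ignore_initial_segment[OF s(2)])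
    define Q where "Q n y = (K (t n) y - K x y - (a x y * (t n - x) + b x y * cnj (t n - x))) / of_real (cmod (t n - x))" for n y
    have "(\<lambda>n. LINT y|M. Q n y * \<psi> y) \<longlonglongrightarrow> (LINT y|M. 0)"
    proof (rule integral_dominated_convergence[where w="\<lambda>y. (2 * B) * cmod (\<psi> y)"])
      show "integrable M (\<lambda>y. (2 * B) * cmod (\<psi> y))" using \<psi> by simp
      show "(\<lambda>y. Q n y * \<psi> y) \<in> borel_measurable M" for n
        unfolding Q_def using t[of n] x by measurable
      show "AE y in M. (\<lambda>n. Q n y * \<psi> y) \<longlonglongrightarrow> 0"
      proof (rule AE_I2)
        fix y assume "y \<in> space M"
        then have y: "y \<in> C" by (simp add: space_M)
        have "((\<lambda>x'. norm ((K x' y - K x y) - (a x y * (x' - x) + b x y * cnj (x' - x))) / norm (x' - x)) \<longlongrightarrow> 0) (at x)"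
          using d[OF x y] unfolding wirt_at_def has_derivative_iff_norm by simp
        then have "((\<lambda>x'. norm ((K x' y - K x y) - (a x y * (x' - x) + b x y * cnj (x' - x))) / norm (x' - x)) \<circ> t) \<longlonglongrightarrow> 0"
          unfolding tendsto_at_iff_sequentially using t t_lim by auto
        then have "(\<lambda>n. norm (Q n y)) \<longlonglongrightarrow> 0" by (simp add: o_def Q_def norm_divide)
        then have "(\<lambda>n. Q n y) \<longlonglongrightarrow> 0" by (rule tendsto_norm_zero_cancel)
        then show "(\<lambda>n. Q n y * \<psi> y) \<longlonglongrightarrow> 0" by (rule tendsto_mult_left_zero)
      qed
      show "AE y in M. norm (Q n y * \<psi> y) \<le> (2 * B) * cmod (\<psi> y)" for n
      proof (rule AE_I2)
        fix y assume "y \<in> space M"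
        then have y: "y \<in> C" by (simp add: space_M)
        have "cmod (K (t n) y - K x y - (a x y * (t n - x) + b x y * cnj (t n - x))) \<le> B * cmod (t n - x) + B * cmod (t n - x)"
          by (rule order_trans[OF norm_triangle_ineq4 add_mono[OF K_lip[OF t(1) y] lin_bound[OF _ y]]]) (use r in simp)
        then have "cmod (Q n y) \<le> 2 * B"
          using t(3)[of n] by (simp add: Q_def norm_divide divide_le_eq)
        then show "norm (Q n y * \<psi> y) \<le> (2 * B) * cmod (\<psi> y)"
          unfolding norm_mult by (intro mult_right_mono) auto
      qed
    qed auto
    moreover have "(LINT y|M. Q n y * \<psi> y) = ((LINT y|M. K (t n) y * \<psi> y) - (LINT y|M. K x y * \<psi> y) - L (t n - x)) / of_real (cmod (t n - x))" for n
    proof -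
      define c where "c = complex_of_real (cmod (t n - x))"
      define h where "h = t n - x"
      have "(\<lambda>y. Q n y * \<psi> y) = (\<lambda>y. (K (t n) y * \<psi> y - K x y * \<psi> y - ((a x y * \<psi> y) * h + (b x y * \<psi> y) * cnj h)) / c)"
        by (simp add: Q_def c_def h_def fun_eq_iff algebra_simps)
      moreover have "(LINT y|M. (K (t n) y * \<psi> y - K x y * \<psi> y - ((a x y * \<psi> y) * h + (b x y * \<psi> y) * cnj h)) / c)
         = ((LINT y|M. K (t n) y * \<psi> y) - (LINT y|M. K x y * \<psi> y) - L h) / c"
        using iK[OF t(2)[of n]] iK[OF x] ia by (simp add: L_def)
      ultimately show ?thesis by (simp add: c_def h_def)
    qed
    ultimately have "(\<lambda>n. ((LINT y|M. K (t n) y * \<psi> y) - (LINT y|M. K x y * \<psi> y) - L (t n - x)) / of_real (cmod (t n - x))) \<longlonglongrightarrow> 0"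
      by simp
    then have "(\<lambda>n. norm (((LINT y|M. K (t n) y * \<psi> y) - (LINT y|M. K x y * \<psi> y) - L (t n - x)) / of_real (cmod (t n - x)))) \<longlonglongrightarrow> 0"
      by (rule tendsto_norm_zero)
    then have "(\<lambda>n. ((\<lambda>x'. norm (((LINT y|M. K x' y * \<psi> y) - (LINT y|M. K x y * \<psi> y)) - L (x' - x)) / norm (x' - x)) \<circ> s) (n + N)) \<longlonglongrightarrow> 0"
      by (simp add: o_def t_def norm_divide)
    then show "((\<lambda>x'. norm (((LINT y|M. K x' y * \<psi> y) - (LINT y|M. K x y * \<psi> y)) - L (x' - x)) / norm (x' - x)) \<circ> s) \<longlonglongrightarrow> 0"
      by (rule LIMSEQ_offset)
  qed
  then show ?thesis
    unfolding wirt_at_def has_derivative_iff_norm L_def using bl by blast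
qed

text \<open>Joint continuity is assumed for the kernel alone. Cauchy's inequality on balls of radius
  r inside one of radius 2 r bounds its derivative uniformly in y and thus supplies the dominating
  function.\<close>

lemma param_holomorphic:
  fixes K :: "complex \<Rightarrow> complex \<Rightarrow> complex" and \<psi> :: "complex \<Rightarrow> complex"
  assumes \<psi>: "integrable M \<psi>" and U: "open U"
    and K: "continuous_on (U \<times> C) (\<lambda>(x, y). K x y)"
    and hol: "\<And>y. y \<in> C \<Longrightarrow> (\<lambda>x. K x y) holomorphic_on U"
  shows "(\<lambda>x. LINT y|M. K x y * \<psi> y) holomorphic_on U"
  unfolding holomorphic_on_open[OF U]
proof
  fix x assume x: "x \<in> U"
  obtain r where r: "r > 0" "cball x (2 * r) \<subseteq> U"
    using U x by (metis open_contains_cball mult.commute nonzero_mult_div_cancel_left zero_less_divide_iff zero_less_numeral zero_neq_numeral times_divide_eq_right)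
  obtain B where B: "B \<ge> 0" "\<And>x' y. x' \<in> cball x (2 * r) \<Longrightarrow> y \<in> C \<Longrightarrow> cmod (K x' y) \<le> B"
    using compact_bound[OF K compact_cball r(2)] by blast
  define D where "D x y = deriv (\<lambda>x. K x y) x" for x y
  have der: "((\<lambda>x. K x y) has_field_derivative D x' y) (at x')" if "x' \<in> U" "y \<in> C" for x' y
    unfolding D_def by (rule holomorphic_derivI[OF hol[OF that(2)] U that(1)])
  have D_bound: "cmod (D x' y) \<le> B / r" if x': "x' \<in> cball x r" and y: "y \<in> C" for x' y
  proof -
    have sub: "cball x' r \<subseteq> cball x (2 * r)"
    proof
      fix z assume "z \<in> cball x' r"
      then show "z \<in> cball x (2 * r)" using x' dist_triangle[of x z x'] by simp
    qed
    have "cmod ((deriv ^^ 1) (\<lambda>x. K x y) x') \<le> fact 1 * B / r ^ 1"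
    proof (rule Cauchy_inequality[OF _ _ r(1)])
      show "(\<lambda>x. K x y) holomorphic_on ball x' r"
        by (rule holomorphic_on_subset[OF hol[OF y]]) (use sub r ball_subset_cball in blast)
      show "continuous_on (cball x' r) (\<lambda>x. K x y)"
        by (rule continuous_on_subset[OF holomorphic_on_imp_continuous_on[OF hol[OF y]]]) (use sub r in blast)
      show "cmod (K z y) \<le> B" if "cmod (x' - z) = r" for z
        by (rule B(2)[OF _ y]) (use that sub in \<open>auto simp: dist_norm\<close>)
    qed
    then show ?thesis by (simp add: D_def)
  qed
  have K_lip: "cmod (K x' y - K x y) \<le> B / r * cmod (x' - x)" if "x' \<in> cball x r" "y \<in> C" for x' y
  proof (rule field_differentiable_bound[OF convex_cball[of x r]])
    fix z assume z: "z \<in> cball x r"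
    then have "z \<in> U" using r by auto
    then show "((\<lambda>x. K x y) has_field_derivative D z y) (at z within cball x r)"
      using der[OF _ that(2)] has_field_derivative_at_within by blast
    show "cmod (D z y) \<le> B / r" by (rule D_bound[OF z that(2)])
  qed (use that r in auto)
  have [measurable]: "\<psi> \<in> borel_measurable M" using \<psi> by auto
  have mK[measurable]: "K x' \<in> borel_measurable M" and iK: "integrable M (\<lambda>y. K x' y * \<psi> y)" if "x' \<in> U" for x'
    using borel_measurable_M section_continuous[OF K that] param_integrable[OF \<psi>] by auto
  have quot: "(\<lambda>n. (K (t n) y - K x y) / (t n - x)) \<longlonglongrightarrow> D x y"
    if "y \<in> C" "t \<longlonglongrightarrow> x" "\<And>n. t n \<noteq> x" for y and t :: "nat \<Rightarrow> complex"
  proof -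
    have "((\<lambda>x'. (K x' y - K x y) / (x' - x)) \<longlongrightarrow> D x y) (at x)"
      using der[OF x that(1)] by (simp add: has_field_derivative_iff)
    then show ?thesis
      unfolding tendsto_at_iff_sequentially using that(2,3) by (auto simp: o_def)
  qed
  \<comment> \<open>Continuity of \<open>D x\<close> in y is not among the assumptions;
    measurability comes from a pointwise limit of difference quotients.\<close>
  have mD[measurable]: "D x \<in> borel_measurable M"
  proof -
    define t where "t n = x + of_real (r / real (Suc n))" for n
    have "(\<lambda>n. complex_of_real (r * inverse (real (Suc n)))) \<longlonglongrightarrow> of_real (r * 0)"
      by (intro tendsto_of_real tendsto_mult tendsto_const LIMSEQ_inverse_real_of_nat)
    then have lim: "t \<longlonglongrightarrow> x" using tendsto_add[OF tendsto_const[of x]] unfolding t_def by (fastforce simp: divide_inverse)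
    have tU: "t n \<in> U" "t n \<noteq> x" for n
    proof -
      have "r / real (Suc n) \<le> r / 1" using r by (intro divide_left_mono) auto
      then have "t n \<in> cball x (2 * r)" using r by (simp add: t_def dist_norm norm_divide del: of_nat_Suc)
      then show "t n \<in> U" using r by blast
      show "t n \<noteq> x" using r by (simp add: t_def del: of_nat_Suc)
    qed
    show ?thesis
    proof (rule borel_measurable_LIMSEQ_metric)
      show "(\<lambda>y. (K (t n) y - K x y) / (t n - x)) \<in> borel_measurable M" for n
        using tU[of n] x by measurable
      show "(\<lambda>n. (K (t n) y - K x y) / (t n - x)) \<longlonglongrightarrow> D x y" if "y \<in> space M" for y
        by (rule quot[OF _ lim tU(2)]) (use that in \<open>simp add: space_M\<close>)
    qed
  qed
  have "((\<lambda>x'. ((LINT y|M. K x' y * \<psi> y) - (LINT y|M. K x y * \<psi> y)) / (x' - x)) \<longlongrightarrow> (LINT y|M. D x y * \<psi> y)) (at x)"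
    unfolding tendsto_at_iff_sequentially
  proof (intro allI impI)
    fix s :: "nat \<Rightarrow> complex" assume s: "\<forall>i. s i \<in> UNIV - {x}" "s \<longlonglongrightarrow> x"
    have ev: "\<forall>\<^sub>F n in sequentially. s n \<in> cball x r"
      using tendstoD[OF s(2) r(1)] by eventually_elim (simp add: dist_commute less_imp_le)
    then obtain N where N: "\<And>n. n \<ge> N \<Longrightarrow> s n \<in> cball x r" by (auto simp: eventually_sequentially)
    define t where "t n = s (n + N)" for n
    have t: "t n \<in> cball x r" "t n \<noteq> x" for n
      using N[of "n + N"] s(1) by (auto simp: t_def)
    then have tU: "t n \<in> U" for n using r by (metis mem_cball order_trans subsetD less_imp_le mult_le_cancel_right1 one_le_numeral linorder_not_less)
    have t_lim: "t \<longlonglongrightarrow> x" unfolding t_def by (rule LIMSEQ_ignore_initial_segment[OF s(2)])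
    have "(\<lambda>n. LINT y|M. (K (t n) y - K x y) / (t n - x) * \<psi> y) \<longlonglongrightarrow> (LINT y|M. D x y * \<psi> y)"
    proof (rule integral_dominated_convergence[where w="\<lambda>y. (B / r) * cmod (\<psi> y)"])
      show "integrable M (\<lambda>y. (B / r) * cmod (\<psi> y))" using \<psi> by simp
      show "(\<lambda>y. (K (t n) y - K x y) / (t n - x) * \<psi> y) \<in> borel_measurable M" for n
        using tU[of n] x by measurable
      show "AE y in M. (\<lambda>n. (K (t n) y - K x y) / (t n - x) * \<psi> y) \<longlonglongrightarrow> D x y * \<psi> y"
        by (rule AE_I2, rule tendsto_mult[OF quot tendsto_const]) (simp_all add: space_M t_lim t)
      show "AE y in M. norm ((K (t n) y - K x y) / (t n - x) * \<psi> y) \<le> (B / r) * cmod (\<psi> y)" for n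
      proof (rule AE_I2)
        fix y assume "y \<in> space M"
        then have "cmod ((K (t n) y - K x y) / (t n - x)) \<le> B / r"
          using K_lip[OF t(1)[of n], of y] t(2)[of n] by (simp add: space_M norm_divide divide_le_eq)
        then show "norm ((K (t n) y - K x y) / (t n - x) * \<psi> y) \<le> (B / r) * cmod (\<psi> y)"
          unfolding norm_mult by (intro mult_right_mono) auto
      qed
    qed measurable
    moreover have "(LINT y|M. (K (t n) y - K x y) / (t n - x) * \<psi> y) = ((LINT y|M. K (t n) y * \<psi> y) - (LINT y|M. K x y * \<psi> y)) / (t n - x)" for n
    proof -
      define h where "h = t n - x"
      have "(\<lambda>y. (K (t n) y - K x y) / h * \<psi> y) = (\<lambda>y. (K (t n) y * \<psi> y - K x y * \<psi> y) / h)"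
        by (simp add: fun_eq_iff algebra_simps)
      then show ?thesis unfolding h_def[symmetric] using iK[OF tU[of n]] iK[OF x] by simp
    qed
    ultimately have "(\<lambda>n. ((\<lambda>x'. ((LINT y|M. K x' y * \<psi> y) - (LINT y|M. K x y * \<psi> y)) / (x' - x)) \<circ> s) (n + N)) \<longlonglongrightarrow> (LINT y|M. D x y * \<psi> y)"
      by (simp only: o_def t_def)
    then show "((\<lambda>x'. ((LINT y|M. K x' y * \<psi> y) - (LINT y|M. K x y * \<psi> y)) / (x' - x)) \<circ> s) \<longlonglongrightarrow> (LINT y|M. D x y * \<psi> y)"
      by (rule LIMSEQ_offset)
  qed
  then show "\<exists>f'. ((\<lambda>x. LINT y|M. K x y * \<psi> y) has_field_derivative f') (at x)"
    unfolding has_field_derivative_iff by blast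
qed

end


section \<open>Arc length\<close>

locale closed_curve =
  fixes g :: "real \<Rightarrow> complex"
  assumes cont: "continuous_on UNIV g" and dcont: "continuous_on UNIV (curve_deriv g)"
    and periodic: "g (t + 1) = g t" and regular: "curve_deriv g t \<noteq> 0"
begin

lemma periodic_int: "g (t + of_int n) = g t"
proof (induction n)
  case (nonneg n)
  show ?case
  proof (induction n)
    case (Suc n)
    then show ?case using periodic[of "t + real n"] by (simp add: add_ac)
  qed simp
next
  case (neg n)
  show ?case
  proof (induction n)
    case 0
    show ?case using periodic[of "t - 1"] by simp
  next
    case (Suc n)
    have "t + of_int (- int (Suc (Suc n))) + 1 = t + of_int (- int (Suc n))" by simp
    then show ?case using periodic[of "t + of_int (- int (Suc (Suc n)))"] Suc by (simp only:)
  qed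
qed

lemma eq_frac: "g t = g (frac t)"
  using periodic_int[of "frac t" "\<lfloor>t\<rfloor>"] by (simp add: frac_def)

lemma range_eq: "range g = g ` {0..<1}"
proof -
  have "g t \<in> g ` {0..<1}" for t by (subst eq_frac) (simp add: frac_lt_1)
  then show ?thesis by blast
qed

lemma compact_range: "compact (range g)"
proof -
  have "range g = g ` {0..1}" using range_eq by auto
  then show ?thesis by (metis compact_continuous_image compact_Icc cont continuous_on_subset subset_UNIV)
qed

lemma sets_arclength: "sets (arclength g) = sets (restrict_space borel (range g))"
  by (simp add: arclength_def)

sublocale compact_measure "arclength g" "range g"
  by standard (simp_all add: compact_range sets_arclength)

lemma space_arclength: "space (arclength g) = range g"
  by (rule space_M)

lemma borel_measurable_arclength: "f \<in> borel_measurable borel \<Longrightarrow> f \<in> borel_measurable (arclength g)"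
  unfolding measurable_cong_sets[OF sets_arclength refl] by (rule measurable_restrict_space1)

abbreviation speed :: "real \<Rightarrow> real" where
  "speed t \<equiv> indicator {0..<1} t * cmod (curve_deriv g t)"

lemma speed_borel[measurable]: "speed \<in> borel_measurable lborel"
proof -
  have [measurable]: "curve_deriv g \<in> borel_measurable borel"
    by (rule borel_measurable_continuous_onI[OF dcont])
  show ?thesis by measurable
qed

lemma g_measurable_restrict: "g \<in> measurable borel (restrict_space borel (range g))"
  by (intro measurable_restrict_space2 borel_measurable_continuous_onI cont) auto

lemma g_measurable: "g \<in> measurable lborel (arclength g)"
  unfolding measurable_cong_sets[OF sets_lborel sets_arclength] by (rule g_measurable_restrict)

lemma g_measurable': "g \<in> measurable (density lborel (\<lambda>t. ennreal (speed t))) (restrict_space borel (range g))"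
proof -
  have "sets (density lborel (\<lambda>t. ennreal (speed t))) = sets borel" by simp
  from measurable_cong_sets[OF this refl] show ?thesis using g_measurable_restrict by simp
qed

lemma nn_integral_arclength:
  assumes "f \<in> borel_measurable (arclength g)"
  shows "(\<integral>\<^sup>+y. f y \<partial>arclength g) = (\<integral>\<^sup>+t. ennreal (speed t) * f (g t) \<partial>lborel)"
proof -
  have [measurable]: "(\<lambda>t. f (g t)) \<in> borel_measurable lborel"
    using measurable_compose[OF g_measurable assms] .
  have "(\<integral>\<^sup>+y. f y \<partial>arclength g) = (\<integral>\<^sup>+t. f (g t) \<partial>density lborel (\<lambda>t. ennreal (speed t)))"
    unfolding arclength_def by (rule nn_integral_distr[OF g_measurable']) (use assms in \<open>simp add: arclength_def\<close>)
  also have "\<dots> = (\<integral>\<^sup>+t. ennreal (speed t) * f (g t) \<partial>lborel)"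
    by (rule nn_integral_density) measurable
  finally show ?thesis .
qed

lemma integral_arclength:
  fixes f :: "complex \<Rightarrow> complex"
  assumes "f \<in> borel_measurable (arclength g)"
  shows "(LINT y|arclength g. f y) = (LINT t|lborel. speed t *\<^sub>R f (g t))"
proof -
  have [measurable]: "(\<lambda>t. f (g t)) \<in> borel_measurable lborel"
    using measurable_compose[OF g_measurable assms] .
  have "(LINT y|arclength g. f y) = (LINT t|density lborel (\<lambda>t. ennreal (speed t)). f (g t))"
    unfolding arclength_def by (rule integral_distr[OF g_measurable'])
      (use assms in \<open>simp add: arclength_def measurable_cong_sets[OF sets_distr refl]\<close>)
  also have "\<dots> = (LINT t|lborel. speed t *\<^sub>R f (g t))"
    by (rule integral_density) auto
  finally show ?thesis .
qed

lemma speed_bound: obtains B where "\<And>t. t \<in> {0..1} \<Longrightarrow> cmod (curve_deriv g t) \<le> B"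
proof -
  have "compact (curve_deriv g ` {0..1})"
    by (intro compact_continuous_image continuous_on_subset[OF dcont]) auto
  then obtain B where "\<forall>z\<in>curve_deriv g ` {0..1}. cmod z \<le> B"
    using compact_imp_bounded bounded_iff by blast
  then show ?thesis using that by blast
qed

lemma finite_arclength: "finite_measure (arclength g)"
proof
  obtain B where B: "\<And>t. t \<in> {0..1} \<Longrightarrow> cmod (curve_deriv g t) \<le> B" using speed_bound by blast
  have "emeasure (arclength g) (space (arclength g)) = (\<integral>\<^sup>+y. 1 \<partial>arclength g)" by simp
  also have "\<dots> = (\<integral>\<^sup>+t. ennreal (speed t) * 1 \<partial>lborel)" by (rule nn_integral_arclength) simp
  also have "\<dots> \<le> (\<integral>\<^sup>+t. ennreal B * indicator {0..<1::real} t \<partial>lborel)"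
    by (intro nn_integral_mono) (auto simp: indicator_def intro!: ennreal_leI B)
  also have "\<dots> = ennreal B" by (simp add: nn_integral_cmult_indicator)
  finally show "emeasure (arclength g) (space (arclength g)) \<noteq> \<infinity>" by (auto simp: top_unique)
qed

text \<open>The speed is positive on the parameter interval, so the density that defines
  \<open>arclength\<close> has the same null sets there as Lebesgue measure.\<close>

lemma AE_arclength:
  assumes "AE y in arclength g. P y"
  shows "AE t in lborel. t \<in> {0..<1} \<longrightarrow> P (g t)"
proof -
  have "AE t in density lborel (\<lambda>t. ennreal (speed t)). P (g t)"
    by (rule AE_distrD[OF g_measurable' assms[unfolded arclength_def]])
  then have "AE t in lborel. 0 < ennreal (speed t) \<longrightarrow> P (g t)"
    by (subst (asm) AE_density) auto
  then show ?thesis by eventually_elim (auto simp: regular)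
qed

lemma continuous_AE_zero:
  fixes v :: "complex \<Rightarrow> complex"
  assumes v: "continuous_on (range g) v" and ae: "AE y in arclength g. v y = 0" and y: "y \<in> range g"
  shows "v y = 0"
proof (rule ccontr)
  assume nz: "v y \<noteq> 0"
  obtain t where t: "y = g t" using y by blast
  have vg: "continuous_on UNIV (\<lambda>t. v (g t))"
    by (rule continuous_on_compose2[OF v cont]) auto
  define S where "S = {t. v (g t) \<noteq> 0}"
  have "open S" unfolding S_def by (rule open_Collect_neq[OF vg continuous_on_const])
  have shift: "v (g (s + of_int n)) = v (g s)" for s n by (simp add: periodic_int)
  have "frac t \<in> S" using nz unfolding S_def t eq_frac[of t] by simp
  then obtain e where e: "e > 0" "ball (frac t) e \<subseteq> S" using \<open>open S\<close> open_contains_ball by blast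
  \<comment> \<open>Only the part to the right of \<open>frac t\<close> is used, cut off at 1:
    \<open>arclength\<close> sees the parameters in [0,1), and a two-sided interval could leave it
    at the seam.\<close>
  define d where "d = min e (1 - frac t)"
  have d: "d > 0" "d \<le> e" "frac t + d \<le> 1" using e frac_lt_1[of t] by (auto simp: d_def)
  have "AE s in lborel. s \<notin> {frac t<..<frac t + d}"
    using AE_arclength[OF ae]
  proof eventually_elim
    case (elim s)
    show ?case
    proof
      assume s: "s \<in> {frac t<..<frac t + d}"
      then have "s \<in> ball (frac t) e" using d by (auto simp: dist_real_def)
      then have "s \<in> S" using e by blast
      moreover have "s \<in> {0..<1}"
      proof -
        have "frac t < s" "s < 1" using s d by auto
        then have "0 \<le> s" using frac_ge_0[of t] by linarith
        with \<open>s < 1\<close> show ?thesis by simp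
      qed
      ultimately show False using elim by (auto simp: S_def)
    qed
  qed
  then have "emeasure lborel {frac t<..<frac t + d} = 0"
    by (subst (asm) AE_iff_null_sets[symmetric]) auto
  then show False using d by simp
qed

end

lemma closed_curveI:
  assumes "Ck_curve 1 g" "regular_jordan_curve g"
  shows "closed_curve g"
proof
  show "continuous_on UNIV g"
    using assms(1) unfolding Ck_curve_def
    by (auto intro!: continuous_at_imp_continuous_on differentiable_imp_continuous_within)
  show "continuous_on UNIV (curve_deriv g)" using assms(1) by (simp add: Ck_curve_def)
  show "g (t + 1) = g t" "curve_deriv g t \<noteq> 0" for t
    using assms(2) by (auto simp: regular_jordan_curve_def)
qed

section \<open>Circles\<close>

lemma curve_deriv_circle: "curve_deriv (circle_curve R) t = 2 * pi * R * \<i> * cis (2 * pi * t)"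
proof -
  have "((\<lambda>z. of_real R * exp (\<i> * (2 * pi * z))) has_field_derivative (2 * pi * R * \<i> * exp (\<i> * (2 * pi * z)))) (at z)" for z
    by (auto intro!: derivative_eq_intros)
  from has_vector_derivative_real_field[OF this[of "of_real t"]]
  have "(circle_curve R has_vector_derivative (2 * pi * R * \<i> * cis (2 * pi * t))) (at t)"
    by (simp add: circle_curve_def[abs_def] cis_conv_exp)
  then show ?thesis unfolding curve_deriv_def by (rule vector_derivative_at)
qed

lemma closed_curve_circle: "R > 0 \<Longrightarrow> closed_curve (circle_curve R)"
proof
  assume "R > 0"
  show "continuous_on UNIV (circle_curve R)"
    unfolding circle_curve_def cis_conv_exp by (intro continuous_intros)
  have "curve_deriv (circle_curve R) = (\<lambda>t. 2 * pi * R * \<i> * cis (2 * pi * t))"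
    by (simp add: curve_deriv_circle fun_eq_iff)
  then show "continuous_on UNIV (curve_deriv (circle_curve R))"
    unfolding cis_conv_exp by (auto intro!: continuous_intros)
  show "circle_curve R (t + 1) = circle_curve R t" for t
  proof -
    have "cis (2 * pi * (t + 1)) = cis (2 * pi * t) * cis (2 * pi)" by (simp add: cis_mult algebra_simps)
    then show ?thesis by (simp add: circle_curve_def)
  qed
  show "curve_deriv (circle_curve R) t \<noteq> 0" for t
    using \<open>R > 0\<close> by (simp add: curve_deriv_circle)
qed

section \<open>Chord lengths and integrability of weak singularities on circles\<close>

lemma sin_lower: "0 \<le> x \<Longrightarrow> x \<le> pi / 2 \<Longrightarrow> x / 3 \<le> sin x"
proof -
  assume x: "0 \<le> x" "x \<le> pi / 2"
  have "\<bar>sin x - (\<Sum>m<3. sin_coeff m * x ^ m)\<bar> \<le> inverse (fact 3) * \<bar>x\<bar> ^ 3"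
    by (rule Maclaurin_sin_bound)
  then have "\<bar>sin x - x\<bar> \<le> x ^ 3 / 6"
    using x by (simp add: eval_nat_numeral sin_coeff_def field_simps)
  then have "x - x ^ 3 / 6 \<le> sin x" by linarith
  \<comment> \<open>From x <= pi/2 < 2 the lower bound x - x^3 / 6 is at least x - 4 x / 6, which is
    the constant 1/3.\<close>
  moreover have "x ^ 3 \<le> 4 * x"
  proof -
    have "x * x \<le> 2 * 2" using x pi_less_4 by (intro mult_mono) auto
    then have "x * (x * x) \<le> x * 4" using x by (intro mult_left_mono) auto
    then show ?thesis by (simp add: eval_nat_numeral)
  qed
  ultimately show ?thesis by linarith
qed

text \<open>The chord is 2 |sin (pi u)| with u = |t - s|, invariant under u -> 1 - u, and the
  minimum is the distance of the parameters modulo 1. The constant 1/3 of \<open>sin_lower\<close>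
  suffices because pi > 3.\<close>

lemma dist_circle_lower:
  assumes "0 \<le> s" "s < 1" "0 \<le> t" "t < 1"
  shows "min \<bar>t - s\<bar> (1 - \<bar>t - s\<bar>) \<le> cmod (cis (2 * pi * t) - cis (2 * pi * s))"
proof -
  define u where "u = \<bar>t - s\<bar>"
  have u: "0 \<le> u" "u < 1" using assms by (auto simp: u_def)
  have "cis (2 * pi * t) - cis (2 * pi * s) = cis (2 * pi * s) * (exp (\<i> * of_real (2 * pi * (t - s))) - 1)"
    by (simp add: cis_conv_exp exp_add[symmetric] algebra_simps)
  then have "cmod (cis (2 * pi * t) - cis (2 * pi * s)) = 2 * \<bar>sin (2 * pi * (t - s) / 2)\<bar>"
    by (simp only: norm_mult norm_cis dist_exp_i_1 mult_1)
  also have "\<bar>sin (2 * pi * (t - s) / 2)\<bar> = \<bar>sin (pi * u)\<bar>"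
  proof -
    have "u = t - s \<or> u = - (t - s)" by (auto simp: u_def)
    moreover have "2 * pi * (t - s) / 2 = pi * (t - s)" by simp
    ultimately show ?thesis by (elim disjE) (simp_all only: mult_minus_right sin_minus abs_minus_cancel)
  qed
  finally have eq: "cmod (cis (2 * pi * t) - cis (2 * pi * s)) = 2 * \<bar>sin (pi * u)\<bar>" .
  have "min u (1 - u) \<le> 2 * sin (pi * u)"
  proof (cases "u \<le> 1 / 2")
    case True
    have "pi * u \<le> pi * (1 / 2)" using True by (intro mult_left_mono) auto
    then have "pi * u / 3 \<le> sin (pi * u)" using u by (intro sin_lower) auto
    moreover have "3 * u \<le> pi * u" using u pi_gt3 by (intro mult_right_mono) auto
    ultimately show ?thesis using u by linarith
  next
    case False
    have "pi * (1 - u) \<le> pi * (1 / 2)" using False by (intro mult_left_mono) auto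
    then have "pi * (1 - u) / 3 \<le> sin (pi * (1 - u))" using u by (intro sin_lower) auto
    moreover have "sin (pi * (1 - u)) = sin (pi * u)" by (simp add: right_diff_distrib)
    moreover have "3 * (1 - u) \<le> pi * (1 - u)" using u pi_gt3 by (intro mult_right_mono) auto
    ultimately have "(1 - u) \<le> sin (pi * u)" by simp
    then show ?thesis using u by linarith
  qed
  then show ?thesis unfolding eq u_def[symmetric] by linarith
qed

lemma circle_curve_eq_AE: "R > 0 \<Longrightarrow> AE t in lborel. t \<in> {0..<1} \<longrightarrow> circle_curve R t \<noteq> x"
proof -
  assume R: "R > 0"
  define N where "N = {t \<in> {0..<1}. circle_curve R t = x}"
  have "t = s" if "t \<in> N" "s \<in> N" for s t
  proof -
    have "cis (2 * pi * t) = cis (2 * pi * s)" using that R by (auto simp: N_def circle_curve_def)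
    then have "min \<bar>t - s\<bar> (1 - \<bar>t - s\<bar>) \<le> 0"
      using dist_circle_lower[of s t] that by (simp add: N_def)
    moreover have "1 - \<bar>t - s\<bar> > 0" using that by (auto simp: N_def)
    ultimately show ?thesis by (auto simp: min_def split: if_splits)
  qed
  then have "\<exists>s. N \<subseteq> {s}" by blast
  then obtain s where "N \<subseteq> {s}" by blast
  show ?thesis
    by (rule AE_I'[of "{s}"]) (use \<open>N \<subseteq> {s}\<close> in \<open>auto simp: N_def\<close>)
qed

text \<open>The range of c covers a parameter s in [0,1) and its translates s - 1 and s + 1, where
  the singularity reappears by periodicity. Distances to points of [0,1] are then at most 2, so two
  reflected copies of one integral over [0,2] bound all cases uniformly.\<close>

lemma nn_integral_abs_powr_finite:
  "\<exists>J\<ge>0. \<forall>c\<in>{-1..2}. (\<integral>\<^sup>+t. ennreal (indicator {0..1} t * \<bar>t - c\<bar> powr (-1/2)) \<partial>lborel) \<le> ennreal J"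
proof -
  define f where "f u = (if u \<in> {0..2} then u powr (-1/2) else 0)" for u :: real
  have f0: "f u \<ge> 0" for u by (simp add: f_def)
  have [measurable]: "f \<in> borel_measurable borel" unfolding f_def by measurable
  have "((\<lambda>u. u powr (-1/2)) has_integral (2 powr (-1/2 + 1) / (-1/2 + 1))) {0..2::real}"
    by (rule has_integral_powr_from_0) auto
  then have "(f has_integral (2 powr (-1/2 + 1) / (-1/2 + 1))) UNIV"
    unfolding f_def by (subst has_integral_restrict_UNIV)
  then have I: "(\<integral>\<^sup>+u. ennreal (f u) \<partial>lborel) = ennreal (2 powr (1/2) * 2)"
    using nn_integral_has_integral_lborel[of f] f0 by simp
  have "(\<integral>\<^sup>+t. ennreal (indicator {0..1} t * \<bar>t - c\<bar> powr (-1/2)) \<partial>lborel) \<le> ennreal (2 * (2 powr (1/2) * 2))"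
    if c: "c \<in> {-1..2}" for c
  proof -
    have "(\<integral>\<^sup>+t. ennreal (indicator {0..1} t * \<bar>t - c\<bar> powr (-1/2)) \<partial>lborel)
        \<le> (\<integral>\<^sup>+t. ennreal (f (- c + 1 * t)) + ennreal (f (c + (-1) * t)) \<partial>lborel)"
    proof (rule nn_integral_mono)
      fix t :: real
      have "indicator {0..1} t * \<bar>t - c\<bar> powr (-1/2) \<le> f (- c + 1 * t) + f (c + (-1) * t)"
      proof (cases "t \<in> {0..1}")
        case True
        then show ?thesis
          using c f0[of "c - t"] f0[of "t - c"] by (cases "t \<ge> c") (auto simp: f_def)
      qed (simp add: f0)
      then show "ennreal (indicator {0..1} t * \<bar>t - c\<bar> powr (-1/2)) \<le> ennreal (f (- c + 1 * t)) + ennreal (f (c + (-1) * t))"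
        using f0 by (simp add: ennreal_plus[symmetric] ennreal_leI del: ennreal_plus)
    qed
    also have "\<dots> = (\<integral>\<^sup>+t. ennreal (f (- c + 1 * t)) \<partial>lborel) + (\<integral>\<^sup>+t. ennreal (f (c + (-1) * t)) \<partial>lborel)"
      by (rule nn_integral_add) auto
    also have "(\<integral>\<^sup>+t. ennreal (f (- c + 1 * t)) \<partial>lborel) = (\<integral>\<^sup>+u. ennreal (f u) \<partial>lborel)"
      using nn_integral_real_affine[of "\<lambda>u. ennreal (f u)" 1 "- c"] by simp
    also have "(\<integral>\<^sup>+t. ennreal (f (c + (-1) * t)) \<partial>lborel) = (\<integral>\<^sup>+u. ennreal (f u) \<partial>lborel)"
      using nn_integral_real_affine[of "\<lambda>u. ennreal (f u)" "-1" c] by simp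
    finally show ?thesis unfolding I by (simp add: ennreal_plus[symmetric] del: ennreal_plus)
  qed
  then show ?thesis by (intro exI[of _ "2 * (2 powr (1/2) * 2)"]) auto
qed

text \<open>The distance modulo 1 is attained by s or one of its two neighbouring translates; the
  sum avoids a case distinction under the integral.\<close>

lemma powr_circle_bound:
  assumes "0 \<le> s" "s < 1" "0 \<le> t" "t < 1"
  shows "cmod (cis (2 * pi * t) - cis (2 * pi * s)) powr (-1/2)
      \<le> \<bar>t - s\<bar> powr (-1/2) + \<bar>t - (s - 1)\<bar> powr (-1/2) + \<bar>t - (s + 1)\<bar> powr (-1/2)"
proof (cases "t = s")
  case False
  define m where "m = min \<bar>t - s\<bar> (1 - \<bar>t - s\<bar>)"
  have m: "m > 0" using False assms by (auto simp: m_def)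
  have "cmod (cis (2 * pi * t) - cis (2 * pi * s)) powr (-1/2) \<le> m powr (-1/2)"
    using dist_circle_lower[OF assms] m by (intro powr_mono2') (auto simp: m_def)
  also have "m = \<bar>t - s\<bar> \<or> m = \<bar>t - (s - 1)\<bar> \<or> m = \<bar>t - (s + 1)\<bar>"
    using assms by (auto simp: m_def min_def abs_if)
  then have "m powr (-1/2) \<le> \<bar>t - s\<bar> powr (-1/2) + \<bar>t - (s - 1)\<bar> powr (-1/2) + \<bar>t - (s + 1)\<bar> powr (-1/2)"
    using powr_ge_zero[of "\<bar>t - s\<bar>" "-1/2"] powr_ge_zero[of "\<bar>t - (s - 1)\<bar>" "-1/2"] powr_ge_zero[of "\<bar>t - (s + 1)\<bar>" "-1/2"]
    by (elim disjE) (simp_all del: powr_ge_zero)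
  finally show ?thesis .
\<comment> \<open>For t = s the left-hand side is \<open>0 powr (-1/2)\<close>, which is 0 by
  convention.\<close>
qed simp

text \<open>The point \<open>y\<^sub>0\<close> of the circle nearest to \<open>x\<close> satisfies \<open>|y - y\<^sub>0| \<le> 2 |x - y|\<close>.\<close>

lemma nearest_circle_point:
  assumes R: "R > 0"
  obtains s where "0 \<le> s" "s < 1" "\<And>t. cmod (circle_curve R t - circle_curve R s) \<le> 2 * cmod (x - circle_curve R t)"
proof -
  interpret closed_curve "circle_curve R" by (rule closed_curve_circle[OF R])
  have "range (circle_curve R) \<noteq> {}" by simp
  then obtain y0 where y0: "y0 \<in> range (circle_curve R)" "\<And>y. y \<in> range (circle_curve R) \<Longrightarrow> dist x y0 \<le> dist x y"
    using distance_attains_inf[OF compact_imp_closed[OF compact_range], of x] by blast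
  obtain s where s: "s \<in> {0..<1}" "y0 = circle_curve R s" using y0(1) unfolding range_eq by blast
  show ?thesis
  proof (rule that[of s])
    fix t
    have "cmod (circle_curve R t - y0) \<le> dist (circle_curve R t) x + dist x y0"
      using dist_triangle[of "circle_curve R t" y0 x] by (simp add: dist_norm)
    also have "\<dots> \<le> 2 * cmod (x - circle_curve R t)"
      using y0(2)[of "circle_curve R t"] by (simp add: dist_norm norm_minus_commute)
    finally show "cmod (circle_curve R t - circle_curve R s) \<le> 2 * cmod (x - circle_curve R t)" by (simp add: s)
  qed (use s in auto)
qed

text \<open>The bound must not degenerate as x approaches the circle. Replacing x by its nearest
  circle point costs a factor 2 in the distance and reduces everything to chords.\<close>

lemma nn_integral_circle_powr:
  assumes R: "R > 0"
  obtains J where "0 \<le> J" "\<And>x. (\<integral>\<^sup>+y. ennreal (cmod (x - y) powr (-1/2)) \<partial>arclength (circle_curve R)) \<le> ennreal J"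
proof -
  interpret closed_curve "circle_curve R" by (rule closed_curve_circle[OF R])
  obtain J where J: "0 \<le> J" "\<And>c. c \<in> {-1..2} \<Longrightarrow> (\<integral>\<^sup>+t. ennreal (indicator {0..1} t * \<bar>t - c\<bar> powr (-1/2)) \<partial>lborel) \<le> ennreal J"
    using nn_integral_abs_powr_finite by (elim exE conjE) (rule that, auto)
  \<comment> \<open>The speed is 2 pi R; in R / 2, R scales the unit chord and 1/2 comes from the
    nearest point.\<close>
  define c where "c = 2 * pi * R * (R / 2) powr (-1/2)"
  have c: "c \<ge> 0" using R by (simp add: c_def)
  have "(\<integral>\<^sup>+y. ennreal (cmod (x - y) powr (-1/2)) \<partial>arclength (circle_curve R)) \<le> ennreal (c * (3 * J))" for x
  proof -
    obtain s where s: "0 \<le> s" "s < 1" "\<And>t. cmod (circle_curve R t - circle_curve R s) \<le> 2 * cmod (x - circle_curve R t)"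
      using nearest_circle_point[OF R, of x] by blast
    define f where "f b t = indicator {0..1} t * \<bar>t - b\<bar> powr (-1/2)" for b t :: real
    have f0: "f b t \<ge> 0" for b t by (simp add: f_def)
    have [measurable]: "f b \<in> borel_measurable borel" for b unfolding f_def by measurable
    have meas: "(\<lambda>y. ennreal (cmod (x - y) powr (-1/2))) \<in> borel_measurable (arclength (circle_curve R))"
      by (rule borel_measurable_arclength) measurable
    have "(\<integral>\<^sup>+y. ennreal (cmod (x - y) powr (-1/2)) \<partial>arclength (circle_curve R))
       = (\<integral>\<^sup>+t. ennreal (speed t) * ennreal (cmod (x - circle_curve R t) powr (-1/2)) \<partial>lborel)"
      by (rule nn_integral_arclength[OF meas])
    also have "\<dots> \<le> (\<integral>\<^sup>+t. ennreal c * (ennreal (f s t) + ennreal (f (s - 1) t) + ennreal (f (s + 1) t)) \<partial>lborel)"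
    proof (rule nn_integral_mono_AE, use circle_curve_eq_AE[OF R, of x] circle_curve_eq_AE[OF R, of "circle_curve R s"] in eventually_elim)
      case (elim t)
      show ?case
      proof (cases "t \<in> {0..<1}")
        case True
        then have t: "0 \<le> t" "t < 1" by auto
        have speed: "speed t = 2 * pi * R" using True R by (simp add: curve_deriv_circle norm_mult)
        have pos: "cmod (cis (2 * pi * t) - cis (2 * pi * s)) > 0"
          using elim(2) True by (auto simp: circle_curve_def)
        have "R / 2 * cmod (cis (2 * pi * t) - cis (2 * pi * s)) = cmod (circle_curve R t - circle_curve R s) / 2"
          using R by (simp add: circle_curve_def norm_mult flip: right_diff_distrib)
        also have "\<dots> \<le> cmod (x - circle_curve R t)" using s(3)[of t] by simp
        finally have "cmod (x - circle_curve R t) powr (-1/2) \<le> (R / 2 * cmod (cis (2 * pi * t) - cis (2 * pi * s))) powr (-1/2)"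
          using R pos by (intro powr_mono2') auto
        also have "\<dots> = (R / 2) powr (-1/2) * cmod (cis (2 * pi * t) - cis (2 * pi * s)) powr (-1/2)"
          by (rule powr_mult)
        also have "\<dots> \<le> (R / 2) powr (-1/2) * (f s t + f (s - 1) t + f (s + 1) t)"
          using powr_circle_bound[OF s(1,2) t] t by (intro mult_left_mono) (auto simp: f_def)
        finally have "speed t * cmod (x - circle_curve R t) powr (-1/2) \<le> c * (f s t + f (s - 1) t + f (s + 1) t)"
          unfolding speed c_def using R by (simp add: mult.assoc)
        then have "ennreal (speed t * cmod (x - circle_curve R t) powr (-1/2)) \<le> ennreal (c * (f s t + f (s - 1) t + f (s + 1) t))"
          by (rule ennreal_leI)
        moreover have "ennreal (speed t * cmod (x - circle_curve R t) powr (-1/2)) = ennreal (speed t) * ennreal (cmod (x - circle_curve R t) powr (-1/2))"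
          by (rule ennreal_mult) auto
        moreover have "ennreal (c * (f s t + f (s - 1) t + f (s + 1) t)) = ennreal c * (ennreal (f s t) + ennreal (f (s - 1) t) + ennreal (f (s + 1) t))"
          by (simp add: ennreal_mult c f0)
        ultimately show ?thesis by (simp only:)
      qed simp
    qed
    also have "\<dots> = ennreal c * ((\<integral>\<^sup>+t. ennreal (f s t) \<partial>lborel) + (\<integral>\<^sup>+t. ennreal (f (s - 1) t) \<partial>lborel) + (\<integral>\<^sup>+t. ennreal (f (s + 1) t) \<partial>lborel))"
      by (simp add: nn_integral_cmult nn_integral_add)
    also have "\<dots> \<le> ennreal c * (ennreal J + ennreal J + ennreal J)"
    proof -
      have "(\<integral>\<^sup>+t. ennreal (f b t) \<partial>lborel) \<le> ennreal J" if "b \<in> {-1..2}" for b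
        unfolding f_def by (rule J(2)[OF that])
      then show ?thesis using s by (intro mult_left_mono add_mono) auto
    qed
    also have "\<dots> = ennreal (c * (3 * J))" using c J(1) by (simp add: ennreal_mult[symmetric] ennreal_plus[symmetric] del: ennreal_plus)
    finally show ?thesis .
  qed
  then show ?thesis by (intro that[of "c * (3 * J)"]) (use c J(1) in auto)
qed


section \<open>Single-layer potentials on circles\<close>

subsection \<open>The logarithmic singularity\<close>

text \<open>Both sides follow from ln u <= u - 1, at u = w powr (-1/16) and at u = w powr (1/16).
  The exponent is chosen with reserve: with w = |x - y|^2 it gives |x - y|^(-1/8), the continuity
  proof weakens this to -1/4, and the square has exponent -1/2, for which the uniform integral bound
  is available.\<close>

lemma abs_ln_le_powr:
  assumes w: "0 < w" "w \<le> (W::real)"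
  shows "\<bar>ln w\<bar> \<le> 16 * (1 + W powr (1/8)) * w powr (-1/16)"
proof -
  have "ln (w powr (-1/16)) \<le> w powr (-1/16) - 1" using w by (intro ln_le_minus_one) auto
  then have 1: "- ln w \<le> 16 * w powr (-1/16)" using w by (simp add: ln_powr)
  have "ln (w powr (1/16)) \<le> w powr (1/16) - 1" using w by (intro ln_le_minus_one) auto
  then have "ln w \<le> 16 * w powr (1/16)" using w by (simp add: ln_powr)
  also have "w powr (1/16) = w powr (1/8) * w powr (-1/16)" by (simp flip: powr_add)
  also have "\<dots> \<le> W powr (1/8) * w powr (-1/16)"
    using w by (intro mult_right_mono powr_mono2) auto
  finally have 2: "ln w \<le> 16 * (W powr (1/8) * w powr (-1/16))" by simp
  have "0 \<le> w powr (-1/16)" "0 \<le> W powr (1/8) * w powr (-1/16)" by auto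
  moreover have "16 * (1 + W powr (1/8)) * w powr (-1/16) = 16 * w powr (-1/16) + 16 * (W powr (1/8) * w powr (-1/16))"
    by (simp add: algebra_simps)
  ultimately show ?thesis using 1 2 by linarith
qed

lemma fund_bound:
  assumes W: "W > 0"
  obtains C where "0 \<le> C" "\<And>w. 0 < w \<Longrightarrow> w \<le> W \<Longrightarrow> cmod (fund k (of_real w)) \<le> C * w powr (-1/16)"
proof -
  have bnd: "\<exists>a\<ge>0. \<forall>w. 0 < w \<and> w \<le> W \<longrightarrow> cmod (f (of_real w)) \<le> a" if "continuous_on (cball 0 W) f" for f :: "complex \<Rightarrow> complex"
  proof -
    have "compact (f ` cball 0 W)" by (rule compact_continuous_image[OF that compact_cball])
    then obtain a where "\<forall>z\<in>f ` cball 0 W. cmod z \<le> a" using compact_imp_bounded bounded_iff by blast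
    then show ?thesis by (intro exI[of _ "max 0 a"]) (auto simp: le_max_iff_disj)
  qed
  obtain a where a: "a \<ge> 0" "\<And>w. 0 < w \<Longrightarrow> w \<le> W \<Longrightarrow> cmod (bes_A (kap k) (of_real w)) \<le> a"
    using bnd[OF holomorphic_on_imp_continuous_on[OF bes_A_holomorphic]] by blast
  obtain b where b: "b \<ge> 0" "\<And>w. 0 < w \<Longrightarrow> w \<le> W \<Longrightarrow> cmod (bes_B (kap k) (of_real w)) \<le> b"
    using bnd[OF holomorphic_on_imp_continuous_on[OF bes_B_holomorphic]] by blast
  define c1 c2 L where "c1 = cmod (fund_coeff_J k)" and "c2 = cmod fund_coeff_Y" and "L = 16 * (1 + W powr (1/8))"
  have pos: "0 \<le> c1" "0 \<le> c2" "0 \<le> L" by (auto simp: c1_def c2_def L_def)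
  define C where "C = (c1 * a + c2 * (2 * b)) * W powr (1/16) + c2 * (L * a)"
  show ?thesis
  proof (rule that[of C])
    show "0 \<le> C" using pos a b by (simp add: C_def)
    fix w assume w: "0 < w" "w \<le> W"
    define p where "p = w powr (-1/16)"
    have p: "p \<ge> 0" by (simp add: p_def)
    \<comment> \<open>This absorbs the bounded terms of \<open>fund\<close> into the power of
      w.\<close>
    have one: "1 \<le> W powr (1/16) * p"
    proof -
      have "1 = w powr (1/16) * p" using w by (simp add: p_def flip: powr_add)
      also have "\<dots> \<le> W powr (1/16) * p" using w p by (intro mult_right_mono powr_mono2) auto
      finally show ?thesis .
    qed
    have ln: "\<bar>ln w\<bar> \<le> L * p" using abs_ln_le_powr[OF w] by (simp add: L_def p_def)
    have "fund k (of_real w) = fund_coeff_J k * bes_A (kap k) (of_real w)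
        + fund_coeff_Y * (of_real (ln w) * bes_A (kap k) (of_real w) - 2 * bes_B (kap k) (of_real w))"
      using w by (simp add: fund_def fund_log_def Ln_of_real)
    also have "cmod \<dots> \<le> c1 * cmod (bes_A (kap k) (of_real w))
        + c2 * (\<bar>ln w\<bar> * cmod (bes_A (kap k) (of_real w)) + 2 * cmod (bes_B (kap k) (of_real w)))"
      unfolding c1_def c2_def
      by (rule order_trans[OF norm_triangle_ineq], unfold norm_mult)
        (intro add_left_mono mult_left_mono order_trans[OF norm_triangle_ineq4], auto simp: norm_mult)
    also have "\<dots> \<le> c1 * a + c2 * ((L * p) * a + 2 * b)"
      using a(2)[OF w] b(2)[OF w] ln pos a(1) p by (intro add_mono mult_left_mono mult_mono) auto
    also have "\<dots> = (c1 * a + c2 * (2 * b)) * 1 + c2 * (L * a) * p" by (simp add: algebra_simps)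
    also have "\<dots> \<le> (c1 * a + c2 * (2 * b)) * (W powr (1/16) * p) + c2 * (L * a) * p"
      using one pos a b by (intro add_right_mono mult_left_mono) auto
    also have "\<dots> = C * p" by (simp add: C_def algebra_simps)
    finally show "cmod (fund k (of_real w)) \<le> C * w powr (-1/16)" by (simp add: p_def)
  qed
qed

lemma fund_of_real_continuous: "continuous_on {0<..} (\<lambda>w. fund k (of_real w))"
  by (rule continuous_on_compose2[OF holomorphic_on_imp_continuous_on[OF fund_holomorphic]])
    (auto intro!: continuous_intros simp: complex_nonpos_Reals_iff)

lemma circle_AE_neq:
  assumes R: "R > 0"
  shows "AE y in arclength (circle_curve R). y \<noteq> x"
proof -
  interpret closed_curve "circle_curve R" by (rule closed_curve_circle[OF R])
  have meas: "(\<lambda>y. indicator {x} y :: ennreal) \<in> borel_measurable (arclength (circle_curve R))"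
    by (rule borel_measurable_arclength) simp
  have "(\<integral>\<^sup>+y. indicator {x} y \<partial>arclength (circle_curve R)) = (\<integral>\<^sup>+t. ennreal (speed t) * indicator {x} (circle_curve R t) \<partial>lborel)"
    by (rule nn_integral_arclength[OF meas])
  also have "\<dots> = (\<integral>\<^sup>+(t::real). 0 \<partial>lborel)"
    by (rule nn_integral_cong_AE, use circle_curve_eq_AE[OF R, of x] in eventually_elim) (auto simp: indicator_def)
  finally have "(\<integral>\<^sup>+y. indicator {x} y \<partial>arclength (circle_curve R)) = 0" by simp
  then have "AE y in arclength (circle_curve R). indicator {x} y = (0::ennreal)"
    using nn_integral_0_iff_AE[OF meas] by simp
  then show ?thesis by eventually_elim (auto simp: indicator_def)
qed

lemma circle_powr_integrable:
  assumes R: "R > 0"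
  obtains J where "0 \<le> J" "\<And>x. integrable (arclength (circle_curve R)) (\<lambda>y. cmod (x - y) powr (-1/2))"
    "\<And>x. (LINT y|arclength (circle_curve R). cmod (x - y) powr (-1/2)) \<le> J"
proof -
  interpret closed_curve "circle_curve R" by (rule closed_curve_circle[OF R])
  obtain J where J: "0 \<le> J" "\<And>x. (\<integral>\<^sup>+y. ennreal (cmod (x - y) powr (-1/2)) \<partial>arclength (circle_curve R)) \<le> ennreal J"
    using nn_integral_circle_powr[OF R] by blast
  have int: "integrable (arclength (circle_curve R)) (\<lambda>y. cmod (x - y) powr (-1/2))" for x
  proof (rule integrableI_nonneg)
    show "(\<lambda>y. cmod (x - y) powr (-1/2)) \<in> borel_measurable (arclength (circle_curve R))"
      by (rule borel_measurable_arclength) measurable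
    show "(\<integral>\<^sup>+y. ennreal (cmod (x - y) powr (-1/2)) \<partial>arclength (circle_curve R)) < \<infinity>"
      using J(2)[of x] by (auto intro: le_less_trans)
  qed auto
  have "(LINT y|arclength (circle_curve R). cmod (x - y) powr (-1/2)) \<le> J" for x
    using J(2)[of x] J(1) nn_integral_eq_integral[OF int[of x]] by (simp add: ennreal_le_iff)
  then show ?thesis using that J(1) int by blast
qed

lemma bessel_J0_borel[measurable]: "bessel_J0 \<in> borel_measurable borel"
  unfolding bessel_J0_def[abs_def] by measurable

lemma bessel_Y0_borel[measurable]: "bessel_Y0 \<in> borel_measurable borel"
  unfolding bessel_Y0_def[abs_def] by measurable

lemma Phi_borel:
  assumes [measurable]: "f \<in> borel_measurable M" "g \<in> borel_measurable M"
  shows "(\<lambda>p. Phi k (f p) (g p)) \<in> borel_measurable M"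
  unfolding Phi_def hankel_H10_def by measurable

lemma Phi_borel_circle:
  assumes "R > 0"
  shows "(\<lambda>y. Phi k x y) \<in> borel_measurable (arclength (circle_curve R))"
proof -
  interpret closed_curve "circle_curve R" by (rule closed_curve_circle[OF assms])
  show ?thesis by (rule borel_measurable_arclength, rule Phi_borel) auto
qed

lemma powr_sq: "(r::real) \<ge> 0 \<Longrightarrow> (r\<^sup>2) powr a = r powr (2 * a)"
  by (metis powr_numeral powr_powr powr_zero_eq_one less_eq_real_def power2_eq_square mult_zero_left powr_0)

lemma Phi_le_powr:
  assumes k: "k > 0" and \<rho>: "\<rho> \<ge> 0" and R: "R > 0"
  obtains C where "0 \<le> C" "\<And>x y. cmod x \<le> \<rho> \<Longrightarrow> cmod y = R \<Longrightarrow> x \<noteq> y \<Longrightarrow> cmod (Phi k x y) \<le> C * cmod (x - y) powr (-1/8)"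
proof -
  have "(\<rho> + R)\<^sup>2 > 0" using \<rho> R by auto
  then obtain C where C: "0 \<le> C" "\<And>w. 0 < w \<Longrightarrow> w \<le> (\<rho> + R)\<^sup>2 \<Longrightarrow> cmod (fund k (of_real w)) \<le> C * w powr (-1/16)"
    using fund_bound[of _ k] by blast
  show ?thesis
  proof (rule that[OF C(1)])
    fix x y assume xy: "cmod x \<le> \<rho>" "cmod y = R" "x \<noteq> y"
    have "cmod (x - y) \<le> \<rho> + R" using norm_triangle_ineq4[of x y] xy by simp
    then have "(cmod (x - y))\<^sup>2 \<le> (\<rho> + R)\<^sup>2" by (intro power_mono) auto
    then have "cmod (Phi k x y) \<le> C * ((cmod (x - y))\<^sup>2) powr (-1/16)"
      unfolding Phi_eq_fund[OF k xy(3)] using xy by (intro C(2)) auto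
    then show "cmod (Phi k x y) \<le> C * cmod (x - y) powr (-1/8)" by (simp add: powr_sq)
  qed
qed

lemma norm_circle: "R > 0 \<Longrightarrow> y \<in> range (circle_curve R) \<Longrightarrow> cmod y = R"
  by (auto simp: circle_curve_def norm_mult)

lemma powr_half_bound:
  assumes "(r::real) > 0"
  shows "(r powr (-1/8))\<^sup>2 \<le> 1 + r powr (-1/2)"
proof -
  define p where "p = r powr (-1/4)"
  have "(r powr (-1/8))\<^sup>2 = p" by (simp add: p_def power2_eq_square flip: powr_add)
  moreover have "r powr (-1/2) = p\<^sup>2" by (simp add: p_def power2_eq_square flip: powr_add)
  moreover have "p \<le> 1 + p\<^sup>2"
    using sum_squares_bound[of 1 p] zero_le_power2[of p] by (simp add: p_def) (smt (verit) powr_ge_zero)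
  ultimately show ?thesis by simp
qed

text \<open>The square of the logarithmic singularity is at most a multiple of |x - y|^(-1/4), hence
  of 1 + |x - y|^(-1/2), whose integral is bounded uniformly in x, including x on the
  circle.\<close>

lemma Phi_square_bound:
  assumes k: "k > 0" and \<rho>: "\<rho> \<ge> 0" and R: "R > 0"
  obtains C where "\<And>x. cmod x \<le> \<rho> \<Longrightarrow> integrable (arclength (circle_curve R)) (\<lambda>y. (cmod (Phi k x y))\<^sup>2)"
    "\<And>x. cmod x \<le> \<rho> \<Longrightarrow> (LINT y|arclength (circle_curve R). (cmod (Phi k x y))\<^sup>2) \<le> C"
proof -
  interpret closed_curve "circle_curve R" by (rule closed_curve_circle[OF R])
  interpret finite_measure "arclength (circle_curve R)" by (rule finite_arclength)
  obtain C where C: "0 \<le> C" "\<And>x y. cmod x \<le> \<rho> \<Longrightarrow> cmod y = R \<Longrightarrow> x \<noteq> y \<Longrightarrow> cmod (Phi k x y) \<le> C * cmod (x - y) powr (-1/8)"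
    using Phi_le_powr[OF k \<rho> R] by blast
  obtain J where J: "0 \<le> J" "\<And>x. integrable (arclength (circle_curve R)) (\<lambda>y. cmod (x - y) powr (-1/2))"
    "\<And>x. (LINT y|arclength (circle_curve R). cmod (x - y) powr (-1/2)) \<le> J"
    using circle_powr_integrable[OF R] by blast
  define B where "B x y = C\<^sup>2 * (1 + cmod (x - y) powr (-1/2))" for x y
  have intB: "integrable (arclength (circle_curve R)) (B x)" for x
    unfolding B_def using J(2) by simp
  have le: "AE y in arclength (circle_curve R). (cmod (Phi k x y))\<^sup>2 \<le> B x y" if x: "cmod x \<le> \<rho>" for x
    using circle_AE_neq[OF R, of x] AE_space
  proof eventually_elim
    case (elim y)
    then have y: "cmod y = R" "x \<noteq> y" using norm_circle[OF R] by (auto simp: space_arclength)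
    have "(cmod (Phi k x y))\<^sup>2 \<le> (C * cmod (x - y) powr (-1/8))\<^sup>2"
      by (intro power_mono C(2)[OF x y]) simp
    also have "\<dots> = C\<^sup>2 * (cmod (x - y) powr (-1/8))\<^sup>2" by (simp add: power_mult_distrib)
    also have "\<dots> \<le> B x y" unfolding B_def using y by (intro mult_left_mono powr_half_bound) auto
    finally show ?case .
  qed
  have int: "integrable (arclength (circle_curve R)) (\<lambda>y. (cmod (Phi k x y))\<^sup>2)" if x: "cmod x \<le> \<rho>" for x
  proof (rule Bochner_Integration.integrable_bound[OF intB])
    show "(\<lambda>y. (cmod (Phi k x y))\<^sup>2) \<in> borel_measurable (arclength (circle_curve R))"
      by (rule borel_measurable_power[OF measurable_compose[OF Phi_borel_circle[OF R] borel_measurable_norm]])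
    show "AE y in arclength (circle_curve R). norm ((cmod (Phi k x y))\<^sup>2) \<le> norm (B x y)"
      using le[OF x] by eventually_elim simp
  qed
  show ?thesis
  proof (rule that[OF int])
    fix x assume x: "cmod x \<le> \<rho>"
    have "(LINT y|arclength (circle_curve R). (cmod (Phi k x y))\<^sup>2) \<le> (LINT y|arclength (circle_curve R). B x y)"
      by (rule integral_mono_AE[OF int[OF x] intB le[OF x]])
    also have "\<dots> = C\<^sup>2 * (measure (arclength (circle_curve R)) (space (arclength (circle_curve R)))
        + (LINT y|arclength (circle_curve R). cmod (x - y) powr (-1/2)))"
      unfolding B_def using J(2) by simp
    also have "\<dots> \<le> C\<^sup>2 * (measure (arclength (circle_curve R)) (space (arclength (circle_curve R))) + J)"
      using J(3)[of x] by (intro mult_left_mono add_left_mono) auto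
    finally show "(LINT y|arclength (circle_curve R). (cmod (Phi k x y))\<^sup>2)
      \<le> C\<^sup>2 * (measure (arclength (circle_curve R)) (space (arclength (circle_curve R))) + J)" .
  qed
qed

lemma Phi_L2_circle: "k > 0 \<Longrightarrow> R > 0 \<Longrightarrow> Phi k x \<in> L2 (arclength (circle_curve R))"
proof -
  assume kR: "k > 0" "R > 0"
  interpret closed_curve "circle_curve R" by (rule closed_curve_circle[OF kR(2)])
  have "integrable (arclength (circle_curve R)) (\<lambda>y. (cmod (Phi k x y))\<^sup>2)"
    using Phi_square_bound[OF kR(1) norm_ge_zero[of x] kR(2)] by blast
  moreover have "Phi k x \<in> borel_measurable (arclength (circle_curve R))" by (rule Phi_borel_circle[OF kR(2)])
  ultimately show ?thesis by (simp add: L2_def)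
qed

lemma single_layer_integrable:
  "k > 0 \<Longrightarrow> R > 0 \<Longrightarrow> \<psi> \<in> L2 (arclength (circle_curve R)) \<Longrightarrow> integrable (arclength (circle_curve R)) (\<lambda>y. Phi k x y * \<psi> y)"
  by (intro L2_mult_integrable Phi_L2_circle)

subsection \<open>Continuity\<close>

text \<open>The potential is the locally uniform limit of the potentials with the continuous kernels
  \<open>F(max (|x - y|\<^sup>2) (1/m))\<close>.\<close>

lemma single_layer_continuous:
  assumes k: "k > 0" and R: "R > 0" and \<psi>: "\<psi> \<in> L2 (arclength (circle_curve R))"
  shows "continuous_on S (single_layer k (circle_curve R) \<psi>)"
proof -
  let ?M = "arclength (circle_curve R)"
  interpret closed_curve "circle_curve R" by (rule closed_curve_circle[OF R])
  have [measurable]: "\<psi> \<in> borel_measurable ?M" using \<psi> by (simp add: L2_def)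
  have \<psi>i: "integrable ?M \<psi>" by (rule L2_integrable[OF finite_arclength \<psi>])
  have \<psi>2: "integrable ?M (\<lambda>y. (cmod (\<psi> y))\<^sup>2)" by (rule L2_integrable_square[OF \<psi>])
  obtain J where J: "0 \<le> J" "\<And>x. integrable ?M (\<lambda>y. cmod (x - y) powr (-1/2))"
    "\<And>x. (LINT y|?M. cmod (x - y) powr (-1/2)) \<le> J"
    using circle_powr_integrable[OF R] by blast
  define T where "T m x y = fund k (of_real (max ((cmod (x - y))\<^sup>2) (1 / real (Suc m))))" for m x y
  define v where "v m x = (LINT y|?M. T m x y * \<psi> y)" for m x
  have T_cont: "continuous_on (UNIV \<times> range (circle_curve R)) (\<lambda>(x, y). T m x y)" for m
    unfolding T_def case_prod_beta'
    by (rule continuous_on_compose2[OF fund_of_real_continuous])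
      (auto intro!: continuous_intros simp: less_max_iff_disj simp del: of_nat_Suc)
  have v_cont: "continuous_on UNIV (v m)" for m
    unfolding v_def by (rule param_continuous[OF \<psi>i open_UNIV T_cont])
  have ball: "continuous_on (ball 0 \<rho>) (single_layer k (circle_curve R) \<psi>)" if \<rho>: "\<rho> > 0" for \<rho>
  proof (rule uniform_limit_theorem)
    show "\<forall>\<^sub>F m in sequentially. continuous_on (ball 0 \<rho>) (v m)"
      by (rule always_eventually, rule allI, rule continuous_on_subset[OF v_cont]) simp
    define W where "W = max 1 ((\<rho> + R)\<^sup>2)"
    have "W > 0" by (simp add: W_def)
    then obtain C where C: "0 \<le> C" "\<And>w. 0 < w \<Longrightarrow> w \<le> W \<Longrightarrow> cmod (fund k (of_real w)) \<le> C * w powr (-1/16)"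
      using fund_bound[of W k] by blast
    \<comment> \<open>The kernel differs from its truncation only for w = |x - y|^2 below s = 1 / (m
      + 1). There w^(-1/16) = w^(1/16) w^(-1/8) is at most s^(1/16) w^(-1/8): a stronger singularity
      is traded for a factor tending to 0. The 2 comes from the triangle inequality.\<close>
    define e where "e m = 2 * C * (1 / real (Suc m)) powr (1/16)" for m
    have e0: "e m \<ge> 0" for m using C by (simp add: e_def)
    define P where "P = J + (L2_norm ?M \<psi>)\<^sup>2"
    have P0: "P \<ge> 0" using J by (simp add: P_def)
    have diff: "cmod (Phi k x y - T m x y) \<le> e m * cmod (x - y) powr (-1/4)"
      if x: "x \<in> ball 0 \<rho>" and y: "cmod y = R" "y \<noteq> x" for x y m
    proof -
      define w where "w = (cmod (x - y))\<^sup>2"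
      have w0: "w > 0" using y by (simp add: w_def)
      have "cmod (x - y) \<le> \<rho> + R" using norm_triangle_ineq4[of x y] x y by simp
      then have wW: "w \<le> W" unfolding w_def W_def by (auto intro!: max.coboundedI2 power_mono)
      define s where "s = 1 / real (Suc m)"
      have s: "s > 0" "s \<le> W" by (auto simp: s_def W_def field_simps le_max_iff_disj)
      have "cmod (fund k (of_real w) - fund k (of_real (max w s))) \<le> 2 * C * s powr (1/16) * w powr (-1/8)"
      proof (cases "w \<ge> s")
        case True
        then show ?thesis using C by simp
      next
        case False
        then have ws: "w < s" by simp
        have "cmod (fund k (of_real w) - fund k (of_real s)) \<le> C * w powr (-1/16) + C * s powr (-1/16)"
          by (rule order_trans[OF norm_triangle_ineq4 add_mono[OF C(2)[OF w0 wW] C(2)[OF s]]])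
        also have "C * s powr (-1/16) \<le> C * w powr (-1/16)"
          using ws w0 C by (intro mult_left_mono powr_mono2') auto
        also have "w powr (-1/16) = w powr (1/16) * w powr (-1/8)" by (simp flip: powr_add)
        also have "w powr (1/16) * w powr (-1/8) \<le> s powr (1/16) * w powr (-1/8)"
          using ws w0 by (intro mult_right_mono powr_mono2) auto
        finally have "cmod (fund k (of_real w) - fund k (of_real s)) \<le> C * (s powr (1/16) * w powr (-1/8)) + C * (s powr (1/16) * w powr (-1/8))"
          using C by (smt (verit) mult_left_mono)
        then show ?thesis using ws by (simp add: max_def mult.assoc)
      qed
      moreover have "w powr (-1/8) = cmod (x - y) powr (-1/4)" by (simp add: w_def powr_sq)
      moreover have "Phi k x y = fund k (of_real w)" using Phi_eq_fund[OF k] y(2) unfolding w_def by metis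
      ultimately show ?thesis by (simp add: e_def T_def s_def w_def)
    qed
    have bound: "cmod (v m x - single_layer k (circle_curve R) \<psi> x) \<le> e m * P" if x: "x \<in> ball 0 \<rho>" for x m
    proof -
      have i1: "integrable ?M (\<lambda>y. T m x y * \<psi> y)"
        by (rule param_integrable[OF \<psi>i section_continuous[OF T_cont]]) simp
      have i2: "integrable ?M (\<lambda>y. Phi k x y * \<psi> y)" by (rule single_layer_integrable[OF k R \<psi>])
      have "cmod (v m x - single_layer k (circle_curve R) \<psi> x) = cmod (LINT y|?M. T m x y * \<psi> y - Phi k x y * \<psi> y)"
        unfolding v_def single_layer_def using i1 i2 by simp
      also have "\<dots> \<le> (LINT y|?M. cmod (T m x y * \<psi> y - Phi k x y * \<psi> y))" by (rule integral_norm_bound)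
      also have "\<dots> \<le> (LINT y|?M. e m * (cmod (x - y) powr (-1/2) + (cmod (\<psi> y))\<^sup>2))"
      proof (rule integral_mono_AE)
        show "integrable ?M (\<lambda>y. cmod (T m x y * \<psi> y - Phi k x y * \<psi> y))" using i1 i2 by simp
        show "integrable ?M (\<lambda>y. e m * (cmod (x - y) powr (-1/2) + (cmod (\<psi> y))\<^sup>2))" using J(2) \<psi>2 by simp
        show "AE y in ?M. cmod (T m x y * \<psi> y - Phi k x y * \<psi> y) \<le> e m * (cmod (x - y) powr (-1/2) + (cmod (\<psi> y))\<^sup>2)"
          using circle_AE_neq[OF R, of x] AE_space
        proof eventually_elim
          case (elim y)
          then have y: "cmod y = R" "y \<noteq> x" using norm_circle[OF R] by (auto simp: space_arclength)
          \<comment> \<open>The square of this power has the exponent -1/2 of the uniform bound, so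
            p |\<psi>| <= p^2 + |\<psi>|^2 gives an estimate independent of x.\<close>
          define p where "p = cmod (x - y) powr (-1/4)"
          have p2: "cmod (x - y) powr (-1/2) = p\<^sup>2" by (simp add: p_def power2_eq_square flip: powr_add)
          have "cmod (T m x y * \<psi> y - Phi k x y * \<psi> y) = cmod (Phi k x y - T m x y) * cmod (\<psi> y)"
          proof -
            have "T m x y * \<psi> y - Phi k x y * \<psi> y = - ((Phi k x y - T m x y) * \<psi> y)" by (simp add: algebra_simps)
            then show ?thesis by (simp only: norm_minus_cancel norm_mult)
          qed
          also have "\<dots> \<le> (e m * p) * cmod (\<psi> y)"
            unfolding p_def using diff[OF x y] by (intro mult_right_mono) auto
          also have "\<dots> \<le> e m * (p\<^sup>2 + (cmod (\<psi> y))\<^sup>2)"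
          proof -
            have "0 \<le> p * cmod (\<psi> y)" by (simp add: p_def)
            then have "p * cmod (\<psi> y) \<le> p\<^sup>2 + (cmod (\<psi> y))\<^sup>2"
              using sum_squares_bound[of p "cmod (\<psi> y)"] by linarith
            then show ?thesis using e0[of m] by (simp add: mult_left_mono mult.assoc)
          qed
          finally show ?case unfolding p2 .
        qed
      qed
      also have "\<dots> = e m * ((LINT y|?M. cmod (x - y) powr (-1/2)) + (L2_norm ?M \<psi>)\<^sup>2)"
        using J(2) \<psi>2 by (simp add: L2_norm_sq)
      also have "\<dots> \<le> e m * P" unfolding P_def using J(3)[of x] e0 by (intro mult_left_mono add_right_mono) auto
      finally show ?thesis .
    qed
    have "(\<lambda>m. (inverse (real (Suc m))) powr (1/16)) \<longlonglongrightarrow> 0 powr (1/16)"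
      by (rule tendsto_powr2[OF LIMSEQ_inverse_real_of_nat tendsto_const]) auto
    then have "(\<lambda>m. 2 * C * (inverse (real (Suc m))) powr (1/16) * P) \<longlonglongrightarrow> 2 * C * 0 * P"
      by (intro tendsto_mult tendsto_const) simp
    then have eP: "(\<lambda>m. e m * P) \<longlonglongrightarrow> 0" by (simp add: e_def inverse_eq_divide)
    show "uniform_limit (ball 0 \<rho>) v (single_layer k (circle_curve R) \<psi>) sequentially"
    proof (rule uniform_limitI)
      fix r :: real assume "r > 0"
      then have "\<forall>\<^sub>F m in sequentially. e m * P < r" using order_tendstoD(2)[OF eP] by blast
      then show "\<forall>\<^sub>F m in sequentially. \<forall>x\<in>ball 0 \<rho>. dist (v m x) (single_layer k (circle_curve R) \<psi> x) < r"
      proof eventually_elim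
        case (elim m)
        then show ?case unfolding dist_norm by (blast intro: le_less_trans bound)
      qed
    qed
  qed simp
  have "isCont (single_layer k (circle_curve R) \<psi>) x" for x
  proof -
    have "continuous_on (ball 0 (cmod x + 1)) (single_layer k (circle_curve R) \<psi>)"
      by (rule ball) (simp add: add_nonneg_pos)
    then show ?thesis by (simp add: continuous_on_eq_continuous_at)
  qed
  then show ?thesis by (auto intro: continuous_at_imp_continuous_on)
qed

subsection \<open>The Helmholtz equation\<close>

text \<open>The witnesses are kept inside the predicate, so sums and restrictions are handled
  without returning to partial derivatives. Boundary behaviour is added only in
  \<open>wirt_helmholtz_solution\<close>.\<close>

definition wirt_helmholtz :: "real \<Rightarrow> complex set \<Rightarrow> (complex \<Rightarrow> complex) \<Rightarrow> bool" where
  "wirt_helmholtz lam G u \<longleftrightarrow> (\<exists>a b aa ab bb. (\<forall>x\<in>G. wirt_at u (a x) (b x) x \<and> wirt_at a (aa x) (ab x) x \<and>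
      wirt_at b (ab x) (bb x) x \<and> 4 * ab x = - of_real lam * u x) \<and>
      continuous_on G aa \<and> continuous_on G ab \<and> continuous_on G bb)"

lemma wirt_helmholtzI:
  assumes "\<And>x. x \<in> G \<Longrightarrow> wirt_at u (a x) (b x) x" "\<And>x. x \<in> G \<Longrightarrow> wirt_at a (aa x) (ab x) x"
      "\<And>x. x \<in> G \<Longrightarrow> wirt_at b (ab x) (bb x) x" "\<And>x. x \<in> G \<Longrightarrow> 4 * ab x = - of_real lam * u x"
      "continuous_on G aa" "continuous_on G ab" "continuous_on G bb"
  shows "wirt_helmholtz lam G u"
  unfolding wirt_helmholtz_def
  by (rule exI[of _ a], rule exI[of _ b], rule exI[of _ aa], rule exI[of _ ab], rule exI[of _ bb]) (simp add: assms)

lemma wirt_helmholtzE: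
  assumes "wirt_helmholtz lam G u"
  obtains a b aa ab bb where "\<And>x. x \<in> G \<Longrightarrow> wirt_at u (a x) (b x) x" "\<And>x. x \<in> G \<Longrightarrow> wirt_at a (aa x) (ab x) x"
      "\<And>x. x \<in> G \<Longrightarrow> wirt_at b (ab x) (bb x) x" "\<And>x. x \<in> G \<Longrightarrow> 4 * ab x = - of_real lam * u x"
      "continuous_on G aa" "continuous_on G ab" "continuous_on G bb"
proof -
  obtain a b aa ab bb where "\<forall>x\<in>G. wirt_at u (a x) (b x) x \<and> wirt_at a (aa x) (ab x) x \<and>
      wirt_at b (ab x) (bb x) x \<and> 4 * ab x = - of_real lam * u x"
      "continuous_on G aa" "continuous_on G ab" "continuous_on G bb"
    using assms unfolding wirt_helmholtz_def by (elim exE conjE)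
  then show ?thesis by (intro that[of a b aa ab bb]) simp_all
qed

lemma wirt_helmholtz_mono:
  assumes "wirt_helmholtz lam G u" "H \<subseteq> G"
  shows "wirt_helmholtz lam H u"
proof -
  obtain a b aa ab bb where "\<And>x. x \<in> G \<Longrightarrow> wirt_at u (a x) (b x) x" "\<And>x. x \<in> G \<Longrightarrow> wirt_at a (aa x) (ab x) x"
      "\<And>x. x \<in> G \<Longrightarrow> wirt_at b (ab x) (bb x) x" "\<And>x. x \<in> G \<Longrightarrow> 4 * ab x = - of_real lam * u x"
      "continuous_on G aa" "continuous_on G ab" "continuous_on G bb"
    using assms(1) by (rule wirt_helmholtzE) (rule that)
  then show ?thesis
    using assms(2) by (intro wirt_helmholtzI[of H u a b aa ab bb]) (auto intro: continuous_on_subset)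
qed

lemma wirt_helmholtz_add:
  assumes "wirt_helmholtz lam G u" "wirt_helmholtz lam G v"
  shows "wirt_helmholtz lam G (\<lambda>x. u x + v x)"
proof -
  obtain a b aa ab bb where 1: "\<And>x. x \<in> G \<Longrightarrow> wirt_at u (a x) (b x) x" "\<And>x. x \<in> G \<Longrightarrow> wirt_at a (aa x) (ab x) x"
      "\<And>x. x \<in> G \<Longrightarrow> wirt_at b (ab x) (bb x) x" "\<And>x. x \<in> G \<Longrightarrow> 4 * ab x = - of_real lam * u x"
      "continuous_on G aa" "continuous_on G ab" "continuous_on G bb"
    using assms(1) by (rule wirt_helmholtzE) (rule that)
  obtain a' b' aa' ab' bb' where 2: "\<And>x. x \<in> G \<Longrightarrow> wirt_at v (a' x) (b' x) x" "\<And>x. x \<in> G \<Longrightarrow> wirt_at a' (aa' x) (ab' x) x"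
      "\<And>x. x \<in> G \<Longrightarrow> wirt_at b' (ab' x) (bb' x) x" "\<And>x. x \<in> G \<Longrightarrow> 4 * ab' x = - of_real lam * v x"
      "continuous_on G aa'" "continuous_on G ab'" "continuous_on G bb'"
    using assms(2) by (rule wirt_helmholtzE) (rule that)
  show ?thesis
    by (rule wirt_helmholtzI[OF wirt_at_add[OF 1(1) 2(1)] wirt_at_add[OF 1(2) 2(2)] wirt_at_add[OF 1(3) 2(3)]])
      (auto intro: continuous_on_add 1 2 simp: 1(4) 2(4) distrib_left)
qed

lemma wirt_helmholtz_solution:
  assumes "wirt_helmholtz lam G u" "open G" "continuous_on (closure G) u"
  shows "helmholtz_solution lam G u"
proof -
  obtain a b aa ab bb where 1: "\<And>x. x \<in> G \<Longrightarrow> wirt_at u (a x) (b x) x" "\<And>x. x \<in> G \<Longrightarrow> wirt_at a (aa x) (ab x) x"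
      "\<And>x. x \<in> G \<Longrightarrow> wirt_at b (ab x) (bb x) x" "\<And>x. x \<in> G \<Longrightarrow> 4 * ab x = - of_real lam * u x"
      "continuous_on G aa" "continuous_on G ab" "continuous_on G bb"
    using assms(1) by (rule wirt_helmholtzE) (rule that)
  note C2 = C2_on_wirt[OF assms(2) 1(1,2,3,5,6,7)]
  show ?thesis
    unfolding helmholtz_solution_def using C2(1) assms(3) by (auto simp: C2(2) 1(4))
qed

text \<open>For F(w) with w = (x - y) cnj (x - y) the mixed derivative is w F'' + F', which the
  Bessel equation of \<open>fund\<close> turns into -(k^2 / 4) F. Four times this is the Helmholtz
  equation.\<close>

lemma Phi_wirt:
  assumes k: "k > 0" and xy: "x \<noteq> y"
  defines "w \<equiv> \<lambda>x. (x - y) * cnj (x - y)"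
  shows "w x \<in> slit"
    "wirt_at (\<lambda>x. Phi k x y) (deriv (fund k) (w x) * cnj (x - y)) (deriv (fund k) (w x) * (x - y)) x"
    "wirt_at (\<lambda>x. deriv (fund k) (w x) * cnj (x - y)) (deriv (deriv (fund k)) (w x) * cnj (x - y) * cnj (x - y))
      (- of_real (kap k) * fund k (w x)) x"
    "wirt_at (\<lambda>x. deriv (fund k) (w x) * (x - y)) (- of_real (kap k) * fund k (w x))
      (deriv (deriv (fund k)) (w x) * (x - y) * (x - y)) x"
proof -
  have w_eq: "w x = of_real ((cmod (x - y))\<^sup>2)" for x unfolding w_def complex_norm_square by simp
  show slit: "w x \<in> slit" unfolding w_eq using xy by (intro of_real_slit) simp
  have sub: "wirt_at (\<lambda>x. x - y) 1 0 x" by (rule wirt_at_holomorphic) (auto intro!: derivative_eq_intros)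
  have ww: "wirt_at w (cnj (x - y)) (x - y) x"
    using wirt_at_mult[OF sub wirt_at_cnj[of y x]] unfolding w_def by simp
  have d0: "(fund k has_field_derivative deriv (fund k) (w x)) (at (w x))"
    by (rule holomorphic_derivI[OF fund_holomorphic open_slit slit])
  have d1: "(deriv (fund k) has_field_derivative deriv (deriv (fund k)) (w x)) (at (w x))"
    by (rule holomorphic_derivI[OF holomorphic_deriv[OF fund_holomorphic open_slit] open_slit slit])
  have ode: "deriv (deriv (fund k)) (w x) * w x + deriv (fund k) (w x) = - of_real (kap k) * fund k (w x)"
    using bspec[OF fund_ode[of k, unfolded bessel_eq_def] slit] by algebra
  show "wirt_at (\<lambda>x. Phi k x y) (deriv (fund k) (w x) * cnj (x - y)) (deriv (fund k) (w x) * (x - y)) x"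
  proof (rule wirt_at_transform[OF wirt_at_compose[of _ _ w, OF d0 ww], of "- {y}"])
    show "fund k (w z) = Phi k z y" if "z \<in> - {y}" for z
      using Phi_eq_fund[OF k, of z y] that by (simp add: w_eq)
  qed (use xy in auto)
  have d1w: "wirt_at (\<lambda>x. deriv (fund k) (w x)) (deriv (deriv (fund k)) (w x) * cnj (x - y)) (deriv (deriv (fund k)) (w x) * (x - y)) x"
    by (rule wirt_at_compose[of _ _ w, OF d1 ww])
  have e1: "deriv (deriv (fund k)) (w x) * (x - y) * cnj (x - y) + deriv (fund k) (w x) * 1 = - of_real (kap k) * fund k (w x)"
    using ode by (simp add: w_def mult.assoc)
  have e2: "deriv (deriv (fund k)) (w x) * cnj (x - y) * (x - y) + deriv (fund k) (w x) * 1 = - of_real (kap k) * fund k (w x)"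
    using ode by (simp add: w_def mult_ac)
  show "wirt_at (\<lambda>x. deriv (fund k) (w x) * cnj (x - y)) (deriv (deriv (fund k)) (w x) * cnj (x - y) * cnj (x - y))
      (- of_real (kap k) * fund k (w x)) x"
    using wirt_at_mult[OF d1w wirt_at_cnj[of y x]] unfolding e1 by simp
  show "wirt_at (\<lambda>x. deriv (fund k) (w x) * (x - y)) (- of_real (kap k) * fund k (w x))
      (deriv (deriv (fund k)) (w x) * (x - y) * (x - y)) x"
    using wirt_at_mult[OF d1w sub] unfolding e2 by simp
qed

lemma single_layer_helmholtz:
  assumes k: "k > 0" and R: "R > 0" and \<psi>: "integrable (arclength (circle_curve R)) \<psi>"
  shows "wirt_helmholtz (k\<^sup>2) {x. cmod x \<noteq> R} (single_layer k (circle_curve R) \<psi>)"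
proof -
  let ?M = "arclength (circle_curve R)" and ?C = "range (circle_curve R)"
  interpret closed_curve "circle_curve R" by (rule closed_curve_circle[OF R])
  define U where "U = {x. cmod x \<noteq> R}"
  have U: "open U"
    unfolding U_def by (intro open_Collect_neq continuous_intros)
  have neq: "x \<noteq> y" if "x \<in> U" "y \<in> ?C" for x y using that norm_circle[OF R] by (auto simp: U_def)
  define w where "w x y = (x - y) * cnj (x - y)" for x y
  have w_slit: "w x y \<in> slit" if "x \<in> U" "y \<in> ?C" for x y
    unfolding w_def using Phi_wirt(1)[OF k neq[OF that]] .
  have cont_w: "continuous_on (U \<times> ?C) (\<lambda>p. f (w (fst p) (snd p)))" if "f holomorphic_on slit" for f
    by (rule continuous_on_compose2[OF holomorphic_on_imp_continuous_on[OF that]])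
      (auto simp: w_slit intro!: continuous_intros simp: w_def[abs_def] simp del: complex_cnj_diff, use w_slit in \<open>auto simp: w_def\<close>)
  define F0 F1 F2 where "F0 = fund k" and "F1 = deriv (fund k)" and "F2 = deriv (deriv (fund k))"
  have hol: "F0 holomorphic_on slit" "F1 holomorphic_on slit" "F2 holomorphic_on slit"
    unfolding F0_def F1_def F2_def by (intro holomorphic_deriv fund_holomorphic open_slit)+
  define a where "a x y = F1 (w x y) * cnj (x - y)" for x y
  define b where "b x y = F1 (w x y) * (x - y)" for x y
  define aa where "aa x y = F2 (w x y) * cnj (x - y) * cnj (x - y)" for x y
  define ab where "ab x y = - of_real (kap k) * F0 (w x y)" for x y
  define bb where "bb x y = F2 (w x y) * (x - y) * (x - y)" for x y
  have Phi_w: "Phi k x y = F0 (w x y)" if "x \<in> U" "y \<in> ?C" for x y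
    unfolding Phi_eq_fund[OF k neq[OF that]] F0_def w_def complex_norm_square by simp
  have c: "continuous_on (U \<times> ?C) (\<lambda>(x, y). a x y)" "continuous_on (U \<times> ?C) (\<lambda>(x, y). b x y)"
    "continuous_on (U \<times> ?C) (\<lambda>(x, y). aa x y)" "continuous_on (U \<times> ?C) (\<lambda>(x, y). ab x y)"
    "continuous_on (U \<times> ?C) (\<lambda>(x, y). bb x y)"
    unfolding a_def b_def aa_def ab_def bb_def case_prod_beta'
    by (intro continuous_intros cont_w hol)+
  have cPhi: "continuous_on (U \<times> ?C) (\<lambda>(x, y). Phi k x y)"
    by (rule continuous_on_cong[THEN iffD1, OF refl _ cont_w[OF hol(1)]]) (auto simp: Phi_w)
  have d: "wirt_at (\<lambda>x. Phi k x y) (a x y) (b x y) x" "wirt_at (\<lambda>x. a x y) (aa x y) (ab x y) x"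
    "wirt_at (\<lambda>x. b x y) (ab x y) (bb x y) x" if "x \<in> U" "y \<in> ?C" for x y
    using Phi_wirt(2-4)[OF k neq[OF that]]
    unfolding a_def b_def aa_def ab_def bb_def w_def F0_def F1_def F2_def by auto
  have ab_eq: "(LINT y|?M. ab x y * \<psi> y) = - of_real (kap k) * single_layer k (circle_curve R) \<psi> x" if "x \<in> U" for x
  proof -
    have "(LINT y|?M. ab x y * \<psi> y) = (LINT y|?M. - of_real (kap k) * (Phi k x y * \<psi> y))"
      by (rule Bochner_Integration.integral_cong) (auto simp: ab_def Phi_w that space_arclength)
    then show ?thesis by (simp add: single_layer_def)
  qed
  show ?thesis
    unfolding U_def[symmetric]
  proof (rule wirt_helmholtzI)
    fix x assume x: "x \<in> U"
    show "wirt_at (single_layer k (circle_curve R) \<psi>) (LINT y|?M. a x y * \<psi> y) (LINT y|?M. b x y * \<psi> y) x"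
      unfolding single_layer_def by (rule param_wirt[OF \<psi> U cPhi c(1,2) d(1) x])
    show "wirt_at (\<lambda>x. LINT y|?M. a x y * \<psi> y) (LINT y|?M. aa x y * \<psi> y) (LINT y|?M. ab x y * \<psi> y) x"
      by (rule param_wirt[OF \<psi> U c(1,3,4) d(2) x])
    show "wirt_at (\<lambda>x. LINT y|?M. b x y * \<psi> y) (LINT y|?M. ab x y * \<psi> y) (LINT y|?M. bb x y * \<psi> y) x"
      by (rule param_wirt[OF \<psi> U c(2,4,5) d(3) x])
    show "4 * (LINT y|?M. ab x y * \<psi> y) = - of_real (k\<^sup>2) * single_layer k (circle_curve R) \<psi> x"
      unfolding ab_eq[OF x] by (simp add: kap_def)
  qed (intro param_continuous[OF \<psi> U] c)+
qed

subsection \<open>Regular solutions in a disc\<close>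

text \<open>The function x^n A(|x|^2), with A the n-th derivative of \<open>bes_A\<close>, is up to
  a constant J_n(k r) exp(i n t) in polar coordinates. It solves the Helmholtz equation in the
  plane, and a zero of A at R^2 would make it a Dirichlet eigenfunction of the disc.\<close>

lemma not_eigenvalue_bes_A:
  assumes k: "k > 0" and R: "R > 0" and ev: "\<not> dirichlet_eigenvalue (k\<^sup>2) (ball 0 R)"
  shows "(deriv ^^ n) (bes_A (kap k)) (of_real (R\<^sup>2)) \<noteq> 0"
proof
  assume zero: "(deriv ^^ n) (bes_A (kap k)) (of_real (R\<^sup>2)) = 0"
  define A where "A j = (deriv ^^ j) ((deriv ^^ n) (bes_A (kap k)))" for j
  have hol: "A j holomorphic_on UNIV" for j
    unfolding A_def by (intro holomorphic_higher_deriv bes_A_holomorphic open_UNIV)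
  have dA: "(A j has_field_derivative A (Suc j) w) (at w)" for j w
    using holomorphic_derivI[OF hol[of j] open_UNIV] by (simp add: A_def)
  have cA: "continuous_on S (A j)" for S j using holomorphic_on_imp_continuous_on[OF hol] continuous_on_subset by blast
  have ode: "w * A 2 w + (1 + of_nat n) * A 1 w = - of_real (kap k) * A 0 w" for w
    using bessel_eq_higher_deriv[OF open_UNIV bes_A_holomorphic[of "kap k"] bes_A_ode[of "kap k"], of n]
    by (simp add: bessel_eq_def A_def eq_neg_iff_add_eq_0 numeral_2_eq_2)
  define u where "u x = x ^ n * A 0 (x * cnj x)" for x
  define b where "b x = x ^ Suc n * A 1 (x * cnj x)" for x
  define bb where "bb x = x ^ Suc (Suc n) * A 2 (x * cnj x)" for x
  define a where "a x = of_nat n * x ^ (n - 1) * A 0 (x * cnj x) + x ^ n * cnj x * A 1 (x * cnj x)" for x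
  \<comment> \<open>Truncated subtraction in the exponents is harmless: whenever it occurs, the
    factor \<open>of_nat n\<close> or \<open>of_nat (n - 1)\<close> in front vanishes.\<close>
  define aa where "aa x = of_nat n * (of_nat (n - 1) * x ^ (n - 1 - 1)) * A 0 (x * cnj x)
     + 2 * of_nat n * x ^ (n - 1) * cnj x * A 1 (x * cnj x) + x ^ n * cnj x * cnj x * A 2 (x * cnj x)" for x
  have w: "wirt_at (\<lambda>x. x * cnj x) (cnj x) x x" for x
    using wirt_at_mult[OF wirt_at_holomorphic[OF DERIV_ident] wirt_at_cnj[of 0 x]] by simp
  have Aw: "wirt_at (\<lambda>x. A j (x * cnj x)) (A (Suc j) (x * cnj x) * cnj x) (A (Suc j) (x * cnj x) * x) x" for j x
    by (rule wirt_at_compose[of _ _ "\<lambda>x. x * cnj x", OF dA w])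
  have pow: "wirt_at (\<lambda>x. x ^ m) (of_nat m * x ^ (m - 1)) 0 x" for m x
    by (rule wirt_at_holomorphic) (auto intro!: derivative_eq_intros)
  have cn: "wirt_at cnj 0 1 x" for x using wirt_at_cnj[of 0 x] by simp
  have xn: "of_nat n * x ^ (n - 1) * x = of_nat n * x ^ n" for x :: complex by (cases n) auto
  have "wirt_helmholtz (k\<^sup>2) UNIV u"
  proof (rule wirt_helmholtzI[of _ _ a b aa "\<lambda>x. - of_real (kap k) * u x" bb])
    fix x :: complex
    show "wirt_at u (a x) (b x) x"
      using wirt_at_mult[OF pow[of n x] Aw[of 0 x]] unfolding u_def a_def b_def by (simp add: mult_ac)
    have ab: "x ^ n * ((x * cnj x) * A 2 (x * cnj x) + (1 + of_nat n) * A 1 (x * cnj x)) = - of_real (kap k) * u x"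
      unfolding ode u_def by simp
    have "wirt_at b (of_nat (Suc n) * x ^ n * A 1 (x * cnj x) + x ^ Suc n * (A 2 (x * cnj x) * cnj x))
        (0 * A 1 (x * cnj x) + x ^ Suc n * (A 2 (x * cnj x) * x)) x"
      using wirt_at_mult[OF pow[of "Suc n" x] Aw[of 1 x]] unfolding b_def by (simp add: numeral_2_eq_2)
    moreover have "of_nat (Suc n) * x ^ n * A 1 (x * cnj x) + x ^ Suc n * (A 2 (x * cnj x) * cnj x)
       = x ^ n * ((x * cnj x) * A 2 (x * cnj x) + (1 + of_nat n) * A 1 (x * cnj x))" by (simp add: algebra_simps)
    ultimately show "wirt_at b (- of_real (kap k) * u x) (bb x) x"
      unfolding ab by (simp add: bb_def mult_ac)
    have "wirt_at (\<lambda>x. of_nat n * (x ^ (n - 1) * A 0 (x * cnj x)) + (x ^ n * cnj x) * A 1 (x * cnj x))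
       ((0 * (x ^ (n - 1) * A 0 (x * cnj x)) + of_nat n * (of_nat (n - 1) * x ^ (n - 1 - 1) * A 0 (x * cnj x) + x ^ (n - 1) * (A (Suc 0) (x * cnj x) * cnj x)))
         + ((of_nat n * x ^ (n - 1) * cnj x + x ^ n * 0) * A 1 (x * cnj x) + (x ^ n * cnj x) * (A (Suc 1) (x * cnj x) * cnj x)))
       ((0 * (x ^ (n - 1) * A 0 (x * cnj x)) + of_nat n * (0 * A 0 (x * cnj x) + x ^ (n - 1) * (A (Suc 0) (x * cnj x) * x)))
         + ((0 * cnj x + x ^ n * 1) * A 1 (x * cnj x) + (x ^ n * cnj x) * (A (Suc 1) (x * cnj x) * x))) x"
      by (intro wirt_at_add wirt_at_mult pow Aw cn wirt_at_const)
    moreover have "(0 * (x ^ (n - 1) * A 0 (x * cnj x)) + of_nat n * (0 * A 0 (x * cnj x) + x ^ (n - 1) * (A (Suc 0) (x * cnj x) * x)))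
         + ((0 * cnj x + x ^ n * 1) * A 1 (x * cnj x) + (x ^ n * cnj x) * (A (Suc 1) (x * cnj x) * x))
       = (of_nat n * x ^ (n - 1) * x) * A 1 (x * cnj x) + x ^ n * A 1 (x * cnj x) + x ^ n * ((x * cnj x) * A 2 (x * cnj x))"
      by (simp add: numeral_2_eq_2 mult_ac)
    moreover have "\<dots> = - of_real (kap k) * u x" unfolding xn ab[symmetric] by (simp add: algebra_simps)
    moreover have "(0 * (x ^ (n - 1) * A 0 (x * cnj x)) + of_nat n * (of_nat (n - 1) * x ^ (n - 1 - 1) * A 0 (x * cnj x) + x ^ (n - 1) * (A (Suc 0) (x * cnj x) * cnj x)))
         + ((of_nat n * x ^ (n - 1) * cnj x + x ^ n * 0) * A 1 (x * cnj x) + (x ^ n * cnj x) * (A (Suc 1) (x * cnj x) * cnj x)) = aa x"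
      by (simp add: aa_def numeral_2_eq_2 algebra_simps)
    moreover have "(\<lambda>x. of_nat n * (x ^ (n - 1) * A 0 (x * cnj x)) + (x ^ n * cnj x) * A 1 (x * cnj x)) = a"
      by (simp add: a_def fun_eq_iff mult.assoc)
    ultimately show "wirt_at a (aa x) (- of_real (kap k) * u x) x" by (simp only:)
    show "4 * (- of_real (kap k) * u x) = - of_real (k\<^sup>2) * u x" by (simp add: kap_def)
  next
    have cAw: "continuous_on UNIV (\<lambda>x. A j (x * cnj x))" for j
      by (rule continuous_on_compose2[OF cA[of UNIV j]]) (auto intro!: continuous_intros)
    show "continuous_on UNIV aa" "continuous_on UNIV (\<lambda>x. - of_real (kap k) * u x)" "continuous_on UNIV bb"
      unfolding aa_def u_def bb_def by (intro continuous_intros cAw)+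
  qed
  then have sol: "wirt_helmholtz (k\<^sup>2) (ball 0 R) u" by (rule wirt_helmholtz_mono) simp
  have ucont: "continuous_on S u" for S
    unfolding u_def by (intro continuous_intros continuous_on_compose2[OF cA[of UNIV 0]]) auto
  have hs: "helmholtz_solution (k\<^sup>2) (ball 0 R) u"
    by (rule wirt_helmholtz_solution[OF sol open_ball ucont])
  have bd: "u x = 0" if "x \<in> frontier (ball 0 R)" for x
  proof -
    have "cmod x = R" using that R by simp
    then have "x * cnj x = of_real (R\<^sup>2)" using complex_norm_square[of x] by simp
    then show ?thesis using zero by (simp add: u_def A_def)
  qed
  have "\<exists>x\<in>ball 0 R. u x \<noteq> 0"
  proof (rule ccontr)
    assume "\<not> ?thesis"
    then have u0: "u x = 0" if "x \<in> ball 0 R" for x using that by blast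
    \<comment> \<open>Nonzero points tending to 0: there x^n can be cancelled, and continuity would
      force A(0) = 0.\<close>
    define s where "s j = complex_of_real (R / 2 * (1 / real (Suc j)))" for j
    have s: "s j \<in> ball 0 R" "s j \<noteq> 0" for j
    proof -
      have "R / 2 * (1 / real (Suc j)) \<le> R / 2 * 1" using R by (intro mult_left_mono) (auto simp: field_simps)
      then have "R / 2 * (1 / real (Suc j)) < R" using R by linarith
      moreover have "0 < R / 2 * (1 / real (Suc j))" using R by simp
      ultimately show "s j \<in> ball 0 R" "s j \<noteq> 0"
        unfolding s_def mem_ball_0 norm_of_real of_real_eq_0_iff by linarith+
    qed
    have "A 0 (s j * cnj (s j)) = 0" for j using u0[OF s(1)[of j]] s(2)[of j] by (simp add: u_def)
    moreover have "(\<lambda>j. A 0 (s j * cnj (s j))) \<longlonglongrightarrow> A 0 (0 * cnj 0)"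
    proof -
      have "(\<lambda>j. complex_of_real (R / 2 * inverse (real (Suc j)))) \<longlonglongrightarrow> of_real (R / 2 * 0)"
        by (intro tendsto_of_real tendsto_mult tendsto_const LIMSEQ_inverse_real_of_nat)
      then have s0: "s \<longlonglongrightarrow> 0" unfolding s_def[abs_def] inverse_eq_divide by (simp only: mult_zero_right of_real_0)
      have "isCont (A 0) (0 * cnj 0)" using cA[of UNIV 0] by (simp add: continuous_on_eq_continuous_at)
      then show ?thesis by (rule isCont_tendsto_compose) (intro tendsto_intros s0)
    qed
    ultimately have "(\<lambda>j::nat. 0) \<longlonglongrightarrow> A 0 0" by simp
    then have "A 0 0 = 0" using LIMSEQ_unique tendsto_const by blast
    then show False using bes_A_deriv_0_nonzero[of "kap k" n] k by (simp add: A_def kap_def)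
  qed
  then have "dirichlet_eigenvalue (k\<^sup>2) (ball 0 R)"
    unfolding dirichlet_eigenvalue_def using hs bd by blast
  then show False using ev by blast
qed


subsection \<open>Unique continuation in an annulus\<close>

lemma fund_log_continuous:
  "continuous_on S l \<Longrightarrow> continuous_on S w \<Longrightarrow> continuous_on S (\<lambda>x. fund_log k (l x) (w x))"
  unfolding fund_log_def
  by (intro continuous_intros continuous_on_compose2[OF holomorphic_on_imp_continuous_on[OF bes_A_holomorphic[of _ UNIV]]]
      continuous_on_compose2[OF holomorphic_on_imp_continuous_on[OF bes_B_holomorphic[of _ UNIV]]]) auto

lemma fund_log_holomorphic:
  "l holomorphic_on S \<Longrightarrow> w holomorphic_on S \<Longrightarrow> (\<lambda>x. fund_log k (l x) (w x)) holomorphic_on S"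
  unfolding fund_log_def
  by (intro holomorphic_intros holomorphic_on_compose_gen[OF _ bes_A_holomorphic[of _ UNIV], unfolded o_def]
      holomorphic_on_compose_gen[OF _ bes_B_holomorphic[of _ UNIV], unfolded o_def]) auto

lemma slit_one_minus: "cmod z < 1 \<Longrightarrow> 1 - z \<in> slit"
  using complex_Re_le_cmod[of z] by (auto simp: complex_nonpos_Reals_iff)

lemma Ln_add_cnj:
  assumes "cmod z < 1"
  shows "Ln (1 - z) + Ln (1 - cnj z) = of_real (2 * ln (cmod (1 - z)))"
proof -
  have s: "1 - z \<notin> \<real>\<^sub>\<le>\<^sub>0" using slit_one_minus[OF assms] by simp
  then have nz: "1 - z \<noteq> 0" by auto
  have "Ln (1 - cnj z) = cnj (Ln (1 - z))" using cnj_Ln[OF s] by simp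
  then show ?thesis using nz by (simp add: complex_add_cnj)
qed

text \<open>
  In logarithmic coordinates \<open>x = exp a\<close>, \<open>cnj x = exp b\<close> the annulus is a strip, and the potential extends
  holomorphically to independent complex \<open>a\<close>, \<open>b\<close>. Along the complexified segment from \<open>x\<^sub>0\<close> to \<open>x\<^sub>1\<close> this
  is a holomorphic function of one variable on a convex set.
\<close>

lemma annulus_continuation:
  assumes k: "k > 0" and R: "0 < R\<^sub>1" "R\<^sub>1 < R\<^sub>2"
    and \<psi>1: "integrable (arclength (circle_curve R\<^sub>1)) \<psi>1" and \<psi>2: "integrable (arclength (circle_curve R\<^sub>2)) \<psi>2"
    and G: "open G" "x0 \<in> G" and x0: "R\<^sub>1 < cmod x0" "cmod x0 < R\<^sub>2"
    and zero: "\<And>x. x \<in> G \<Longrightarrow> single_layer k (circle_curve R\<^sub>1) \<psi>1 x + single_layer k (circle_curve R\<^sub>2) \<psi>2 x = 0"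
    and x1: "R\<^sub>1 < cmod x1" "cmod x1 < R\<^sub>2"
  shows "single_layer k (circle_curve R\<^sub>1) \<psi>1 x1 + single_layer k (circle_curve R\<^sub>2) \<psi>2 x1 = 0"
proof -
  have R2: "R\<^sub>2 > 0" using R by simp
  let ?M1 = "arclength (circle_curve R\<^sub>1)" and ?M2 = "arclength (circle_curve R\<^sub>2)"
  let ?C1 = "range (circle_curve R\<^sub>1)" and ?C2 = "range (circle_curve R\<^sub>2)"
  interpret c1: closed_curve "circle_curve R\<^sub>1" by (rule closed_curve_circle[OF R(1)])
  interpret c2: closed_curve "circle_curve R\<^sub>2" by (rule closed_curve_circle[OF R2])
  have nz: "x0 \<noteq> 0" "x1 \<noteq> 0" using x0 x1 R by auto
  \<comment> \<open>The parameter \<tau> runs along the segment of logarithms, from 0 at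
    \<open>x0\<close> to 1 at \<open>x1\<close>. For real \<tau>, \<open>b \<tau>\<close> is the
    conjugate of \<open>a \<tau>\<close>, and only there does the extension represent the
    field.\<close>
  define \<beta> where "\<beta> = Ln x1 - Ln x0"
  define a where "a \<tau> = Ln x0 + \<tau> * \<beta>" for \<tau>
  define b where "b \<tau> = cnj (Ln x0) + \<tau> * cnj \<beta>" for \<tau>
  have hol_a: "a holomorphic_on S" "b holomorphic_on S" for S
    unfolding a_def b_def by (intro holomorphic_intros)+
  have cont_a: "continuous_on S a" "continuous_on S b" for S
    using hol_a holomorphic_on_imp_continuous_on by blast+
  define I where "I = {ln R\<^sub>1<..<ln R\<^sub>2}"
  define U where "U = {\<tau>. Re (a \<tau>) \<in> I \<and> Re (b \<tau>) \<in> I}"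
  have "U = (\<lambda>\<tau>. Re (a \<tau>)) -` I \<inter> (\<lambda>\<tau>. Re (b \<tau>)) -` I" by (auto simp: U_def)
  moreover have "open ((\<lambda>\<tau>. Re (a \<tau>)) -` I)" "open ((\<lambda>\<tau>. Re (b \<tau>)) -` I)"
    unfolding I_def a_def b_def by (intro open_vimage open_greaterThanLessThan continuous_intros)+
  ultimately have U: "open U" by auto
  have "convex U"
  proof (rule convexI)
    fix s t and u v :: real assume *: "s \<in> U" "t \<in> U" "0 \<le> u" "0 \<le> v" "u + v = 1"
    have uv: "of_real u = (1 :: complex) - of_real v" using *(5) by (metis add_diff_cancel_right' of_real_1 of_real_diff)
    have "a (u *\<^sub>R s + v *\<^sub>R t) = u *\<^sub>R a s + v *\<^sub>R a t" "b (u *\<^sub>R s + v *\<^sub>R t) = u *\<^sub>R b s + v *\<^sub>R b t"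
      unfolding a_def b_def scaleR_conv_of_real uv by (simp_all add: algebra_simps)
    moreover have "u *\<^sub>R p + v *\<^sub>R q \<in> I" if "p \<in> I" "q \<in> I" for p q
      using that * convexD[of I p q u v] by (auto simp: I_def)
    ultimately show "u *\<^sub>R s + v *\<^sub>R t \<in> U" using *(1,2) by (simp add: U_def)
  qed
  then have conn: "connected U" by (rule convex_connected)
  have exp_bound: "R\<^sub>1 < cmod (exp z)" "cmod (exp z) < R\<^sub>2" if "Re z \<in> I" for z
  proof -
    have "exp (ln R\<^sub>1) < exp (Re z)" "exp (Re z) < exp (ln R\<^sub>2)" using that by (auto simp: I_def)
    then show "R\<^sub>1 < cmod (exp z)" "cmod (exp z) < R\<^sub>2" using R R2 by simp_all
  qed
  have U_bound: "R\<^sub>1 < cmod (exp (a \<tau>))" "cmod (exp (a \<tau>)) < R\<^sub>2" "R\<^sub>1 < cmod (exp (b \<tau>))" "cmod (exp (b \<tau>)) < R\<^sub>2"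
    if "\<tau> \<in> U" for \<tau> using that exp_bound by (auto simp: U_def)
  have C1: "cmod y = R\<^sub>1" if "y \<in> ?C1" for y using norm_circle[OF R(1) that] .
  have C2: "cmod y = R\<^sub>2" "y \<noteq> 0" if "y \<in> ?C2" for y using norm_circle[OF R2 that] R2 by auto
  have s1: "1 - y / exp (a \<tau>) \<in> slit" "1 - cnj y / exp (b \<tau>) \<in> slit" "cmod (y / exp (a \<tau>)) < 1" if "\<tau> \<in> U" "y \<in> ?C1" for \<tau> y
    using U_bound[OF that(1)] C1[OF that(2)] by (auto intro!: slit_one_minus[simplified] simp: norm_divide divide_less_eq simp del: norm_exp_eq_Re)
  have s2: "1 - exp (a \<tau>) / y \<in> slit" "1 - exp (b \<tau>) / cnj y \<in> slit" "cmod (exp (a \<tau>) / y) < 1" if "\<tau> \<in> U" "y \<in> ?C2" for \<tau> y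
    using U_bound[OF that(1)] C2[OF that(2)] R2 by (auto intro!: slit_one_minus[simplified] simp: norm_divide divide_less_eq simp del: norm_exp_eq_Re)
  \<comment> \<open>The branch of log ((x - y) (cnj x - cnj y)) is fixed by factoring out the larger
    of x and y: exp a exp b for the inner circle, |y|^2 = \<open>R\<^sub>2 ^ 2\<close> for the outer
    one. What remains are principal logarithms of 1 - z with |z| < 1.\<close>
  define K1 where "K1 \<tau> y = fund_log k (a \<tau> + b \<tau> + Ln (1 - y / exp (a \<tau>)) + Ln (1 - cnj y / exp (b \<tau>)))
      ((exp (a \<tau>) - y) * (exp (b \<tau>) - cnj y))" for \<tau> y
  define K2 where "K2 \<tau> y = fund_log k (of_real (2 * ln R\<^sub>2) + Ln (1 - exp (a \<tau>) / y) + Ln (1 - exp (b \<tau>) / cnj y))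
      ((exp (a \<tau>) - y) * (exp (b \<tau>) - cnj y))" for \<tau> y
  have ac: "continuous_on S (\<lambda>p. a (fst p))" "continuous_on S (\<lambda>p. b (fst p))" for S :: "(complex \<times> complex) set"
    unfolding a_def b_def by (intro continuous_intros)+
  have cK1: "continuous_on (U \<times> ?C1) (\<lambda>(\<tau>, y). K1 \<tau> y)"
    unfolding K1_def case_prod_beta'
    by (intro fund_log_continuous continuous_intros ac) (use s1 in auto)
  have cK2: "continuous_on (U \<times> ?C2) (\<lambda>(\<tau>, y). K2 \<tau> y)"
    unfolding K2_def case_prod_beta'
    by (intro fund_log_continuous continuous_intros ac) (use s2 C2(2) in auto)
  have hK1: "(\<lambda>\<tau>. K1 \<tau> y) holomorphic_on U" if "y \<in> ?C1" for y
    unfolding K1_def by (intro fund_log_holomorphic holomorphic_intros hol_a) (use s1 that in auto)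
  have hK2: "(\<lambda>\<tau>. K2 \<tau> y) holomorphic_on U" if "y \<in> ?C2" for y
    unfolding K2_def by (intro fund_log_holomorphic holomorphic_intros hol_a) (use s2 C2(2) that in auto)
  define h where "h \<tau> = (LINT y|?M1. K1 \<tau> y * \<psi>1 y) + (LINT y|?M2. K2 \<tau> y * \<psi>2 y)" for \<tau>
  have hol_h: "h holomorphic_on U"
    unfolding h_def
    by (intro holomorphic_on_add c1.param_holomorphic c2.param_holomorphic \<psi>1 \<psi>2 U cK1 cK2 hK1 hK2)
  have real: "h (of_real t) = single_layer k (circle_curve R\<^sub>1) \<psi>1 (exp (a (of_real t))) + single_layer k (circle_curve R\<^sub>2) \<psi>2 (exp (a (of_real t)))"
    if tU: "of_real t \<in> U" for t
  proof -
    define x where "x = exp (a (of_real t))"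
    have b: "b (of_real t) = cnj (a (of_real t))" by (simp add: a_def b_def)
    have eb: "exp (b (of_real t)) = cnj x" unfolding b x_def by (simp add: exp_cnj)
    have x: "R\<^sub>1 < cmod x" "cmod x < R\<^sub>2" "x \<noteq> 0" using U_bound[OF tU] by (auto simp: x_def)
    have ab: "a (of_real t) + b (of_real t) = of_real (2 * ln (cmod x))"
      unfolding b complex_add_cnj by (simp add: x_def)
    have Phi: "Phi k x y = fund_log k (of_real (2 * ln (cmod (x - y)))) ((x - y) * (cnj x - cnj y))" if "x \<noteq> y" for y
    proof -
      have "Ln (of_real ((cmod (x - y))\<^sup>2)) = of_real (ln ((cmod (x - y))\<^sup>2))" using that by (intro Ln_of_real) simp
      also have "ln ((cmod (x - y))\<^sup>2) = 2 * ln (cmod (x - y))" using that by (simp add: ln_realpow)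
      finally have L: "Ln (of_real ((cmod (x - y))\<^sup>2)) = of_real (2 * ln (cmod (x - y)))" .
      have w: "complex_of_real ((cmod (x - y))\<^sup>2) = (x - y) * (cnj x - cnj y)"
        unfolding complex_norm_square by simp
      show ?thesis unfolding Phi_eq_fund[OF k that] fund_def L unfolding w ..
    qed
    have 1: "K1 (of_real t) y = Phi k x y" if y: "y \<in> ?C1" for y
    proof -
      have xy: "x \<noteq> y" using x C1[OF y] by auto
      have "Ln (1 - y / x) + Ln (1 - cnj y / cnj x) = of_real (2 * ln (cmod (1 - y / x)))"
        using Ln_add_cnj[OF s1(3)[OF tU y]] by (simp add: x_def)
      moreover have "ln (cmod x) + ln (cmod (1 - y / x)) = ln (cmod (x - y))"
      proof -
        have "x * (1 - y / x) = x - y" using x by (simp add: right_diff_distrib)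
        then have "cmod x * cmod (1 - y / x) = cmod (x - y)" by (metis norm_mult)
        moreover have "cmod x > 0" "cmod (1 - y / x) > 0" using x xy by auto
        ultimately show ?thesis by (metis ln_mult_pos)
      qed
      ultimately have "a (of_real t) + b (of_real t) + Ln (1 - y / x) + Ln (1 - cnj y / cnj x) = of_real (2 * ln (cmod (x - y)))"
        unfolding ab by (simp add: add.assoc flip: of_real_add distrib_left)
      then show ?thesis unfolding K1_def eb x_def[symmetric] Phi[OF xy] by simp
    qed
    have 2: "K2 (of_real t) y = Phi k x y" if y: "y \<in> ?C2" for y
    proof -
      have xy: "x \<noteq> y" using x C2[OF y] by auto
      have "Ln (1 - x / y) + Ln (1 - cnj x / cnj y) = of_real (2 * ln (cmod (1 - x / y)))"
        using Ln_add_cnj[OF s2(3)[OF tU y]] by (simp add: x_def)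
      moreover have "ln R\<^sub>2 + ln (cmod (1 - x / y)) = ln (cmod (x - y))"
      proof -
        have "y * (1 - x / y) = y - x" using C2[OF y] by (simp add: right_diff_distrib)
        then have "R\<^sub>2 * cmod (1 - x / y) = cmod (x - y)" by (metis norm_mult C2(1)[OF y] norm_minus_commute)
        moreover have "cmod (1 - x / y) > 0" using C2[OF y] xy by auto
        ultimately show ?thesis using R2 by (metis ln_mult_pos)
      qed
      ultimately have "of_real (2 * ln R\<^sub>2) + Ln (1 - x / y) + Ln (1 - cnj x / cnj y) = of_real (2 * ln (cmod (x - y)))"
        by (simp add: add.assoc flip: of_real_add distrib_left)
      then show ?thesis unfolding K2_def eb x_def[symmetric] Phi[OF xy] by simp
    qed
    show ?thesis
      unfolding h_def single_layer_def x_def[symmetric]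
      by (intro arg_cong2[where f="(+)"] Bochner_Integration.integral_cong refl)
        (simp_all add: 1 2 c1.space_arclength c2.space_arclength)
  qed
  have a01: "exp (a 0) = x0" "exp (a 1) = x1" using nz by (simp_all add: a_def \<beta>_def)
  have "ln R\<^sub>1 < ln (cmod x0)" "ln (cmod x0) < ln R\<^sub>2" "ln R\<^sub>1 < ln (cmod x1)" "ln (cmod x1) < ln R\<^sub>2"
    using x0 x1 R nz R2 by simp_all
  then have U01: "0 \<in> U" "1 \<in> U" using nz by (simp_all add: U_def I_def a_def b_def \<beta>_def)
  define V where "V = {\<tau>. \<tau> \<in> U \<and> exp (a \<tau>) \<in> G}"
  have "open V"
  proof -
    have "continuous_on UNIV (\<lambda>\<tau>. exp (a \<tau>))" by (intro continuous_intros cont_a)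
    then have "open ((\<lambda>\<tau>. exp (a \<tau>)) -` G)" using G(1) by (simp add: open_vimage)
    moreover have "V = U \<inter> (\<lambda>\<tau>. exp (a \<tau>)) -` G" by (auto simp: V_def)
    ultimately show ?thesis using U by auto
  qed
  moreover have "0 \<in> V" using U01 a01 G by (simp add: V_def)
  ultimately obtain d where d: "d > 0" "ball 0 d \<subseteq> V" using open_contains_ball by blast
  \<comment> \<open>Vanishing of the field says something about \<open>h\<close> only at real
    parameters; a real interval accumulating at 0 is enough for the identity theorem.\<close>
  define Z where "Z = complex_of_real ` {0<..<d}"
  have Z: "Z \<subseteq> V" using d by (auto simp: Z_def)
  have lim: "0 islimpt Z"
  proof (rule islimptI)
    fix T assume "0 \<in> T" "open (T :: complex set)"
    then obtain e where e: "e > 0" "ball 0 e \<subseteq> T" using open_contains_ball by blast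
    define t where "t = min d e / 2"
    have t: "0 < t" "t < d" "t < e" using d e by (auto simp: t_def)
    then have "of_real t \<in> Z" "of_real t \<in> T" "complex_of_real t \<noteq> 0" using e by (auto simp: Z_def)
    then show "\<exists>y\<in>Z. y \<in> T \<and> y \<noteq> 0" by blast
  qed
  have "h 1 = 0"
  proof (rule analytic_continuation[OF hol_h U conn _ U01(1) lim _ U01(2)])
    show "Z \<subseteq> U" using Z by (auto simp: V_def)
    fix z assume z: "z \<in> Z"
    then obtain t where t: "z = of_real t" by (auto simp: Z_def)
    have "z \<in> V" using z Z by blast
    then show "h z = 0" unfolding t using real[of t] zero[of "exp (a (of_real t))"] by (simp add: V_def)
  qed
  then show ?thesis using real[of 1] U01(2) a01(2) by simp
qed


section \<open>Fourier coefficients on circles\<close>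

text \<open>By Stone-Weierstrass, \<psi> integrates to 0 against all real continuous functions on C,
  hence over closed sets by approximating their indicators, and hence over all measurable sets
  because closed sets form an intersection-stable generator.\<close>

lemma (in compact_measure) AE_zero_if_moments_zero:
  assumes fin: "finite_measure M" and \<psi>: "integrable M \<psi>"
    and mom: "\<And>i j. (LINT y|M. \<psi> y * (y ^ i * cnj y ^ j)) = 0"
  shows "AE y in M. \<psi> y = 0"
proof -
  interpret finite_measure M by fact
  have [measurable]: "\<psi> \<in> borel_measurable M" using \<psi> by auto
  define null where "null f \<longleftrightarrow> (\<forall>i j. (LINT y|M. (f y * (y ^ i * cnj y ^ j)) * \<psi> y) = 0)" for f :: "complex \<Rightarrow> complex"
  \<comment> \<open>\<open>P\<close> is phrased through multiplication preserving
    \<open>null\<close>, so closure under products is mere composition. The monomial factor built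
    into \<open>null\<close> makes it stable under y and cnj y, from which Re and Im are combined to
    separate points.\<close>
  define P where "P g \<longleftrightarrow> continuous_on C g \<and> (\<forall>f. continuous_on C f \<longrightarrow> null f \<longrightarrow> null (\<lambda>y. of_real (g y) * f y))" for g
  have int: "integrable M (\<lambda>y. (f y * (y ^ i * cnj y ^ j)) * \<psi> y)" if "continuous_on C f" for f i j
    by (rule param_integrable[OF \<psi>]) (intro continuous_intros that)
  have null_1: "null (\<lambda>_. 1)"
    using mom by (simp add: null_def mult.commute)
  have null_add: "null (\<lambda>y. f y + g y)" if "continuous_on C f" "continuous_on C g" "null f" "null g" for f g
    using that int by (simp add: null_def distrib_right)
  have null_cmult: "null (\<lambda>y. c * f y)" if "null f" for c f
    using that by (simp add: null_def mult.assoc)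
  have null_y: "null (\<lambda>y. y * f y)" if "null f" for f
    unfolding null_def
  proof (intro allI)
    fix i j
    have "(LINT y|M. f y * (y ^ Suc i * cnj y ^ j) * \<psi> y) = 0" using that unfolding null_def by blast
    then show "(LINT y|M. y * f y * (y ^ i * cnj y ^ j) * \<psi> y) = 0" by (simp add: mult_ac)
  qed
  have null_cy: "null (\<lambda>y. cnj y * f y)" if "null f" for f
    unfolding null_def
  proof (intro allI)
    fix i j
    have "(LINT y|M. f y * (y ^ i * cnj y ^ Suc j) * \<psi> y) = 0" using that unfolding null_def by blast
    then show "(LINT y|M. cnj y * f y * (y ^ i * cnj y ^ j) * \<psi> y) = 0" by (simp add: mult_ac)
  qed
  have P_Re: "P Re" and P_Im: "P Im"
  proof -
    have "null (\<lambda>y. 1/2 * (y * f y) + 1/2 * (cnj y * f y))" if "null f" "continuous_on C f" for f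
      by (intro null_add null_cmult null_y null_cy that continuous_intros)
    moreover have "1/2 * (y * f y) + 1/2 * (cnj y * f y) = of_real (Re y) * f y" for y f
    proof -
      have "1/2 * (y * f y) + 1/2 * (cnj y * f y) = 1/2 * (y + cnj y) * f y" by (simp add: algebra_simps)
      then show ?thesis by (simp add: complex_add_cnj)
    qed
    ultimately show "P Re" unfolding P_def by (auto intro: continuous_intros)
    have "null (\<lambda>y. - (\<i>/2) * (y * f y) + \<i>/2 * (cnj y * f y))" if "null f" "continuous_on C f" for f
      by (intro null_add null_cmult null_y null_cy that continuous_intros)
    moreover have "- (\<i>/2) * (y * f y) + \<i>/2 * (cnj y * f y) = of_real (Im y) * f y" for y f
    proof -
      have "- c * (y * f y) + c * (cnj y * f y) = - c * (y - cnj y) * f y" for c by (simp add: algebra_simps)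
      from this[of "\<i>/2"] have "- (\<i>/2) * (y * f y) + \<i>/2 * (cnj y * f y) = - (\<i>/2) * (y - cnj y) * f y" .
      also have "\<dots> = of_real (Im y) * f y" by (simp add: complex_diff_cnj mult.left_commute[of \<i>])
      finally show ?thesis .
    qed
    ultimately show "P Im" unfolding P_def by (auto intro: continuous_intros)
  qed
  have cont_zero: "(LINT y|M. of_real (g y) * \<psi> y) = 0" if g: "continuous_on C g" for g :: "complex \<Rightarrow> real"
  proof -
    have bound: "cmod (LINT y|M. of_real (g y) * \<psi> y) \<le> e * (LINT y|M. cmod (\<psi> y))" if e: "e > 0" for e
    proof -
      have "\<exists>p. P p \<and> (\<forall>x\<in>C. \<bar>g x - p x\<bar> < e)"
      proof (rule Stone_Weierstrass_HOL[OF compact_C _ _ _ _ _ g e])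
        show "P (\<lambda>x. c)" for c by (auto simp: P_def intro: null_cmult)
        show "continuous_on C f" if "P f" for f using that by (simp add: P_def)
        show "P (\<lambda>x. f x + h x)" if "P f \<and> P h" for f h
        proof -
          have "null (\<lambda>y. of_real (f y) * u y + of_real (h y) * u y)" if "continuous_on C u" "null u" for u
            by (rule null_add) (use that \<open>P f \<and> P h\<close> in \<open>auto simp: P_def intro!: continuous_intros\<close>)
          then show ?thesis using that by (auto simp: P_def distrib_right intro: continuous_intros)
        qed
        show "P (\<lambda>x. f x * h x)" if "P f \<and> P h" for f h
        proof -
          have "null (\<lambda>y. of_real (f y) * (of_real (h y) * u y))" if "continuous_on C u" "null u" for u
          proof -
            have f: "\<And>u. continuous_on C u \<Longrightarrow> null u \<Longrightarrow> null (\<lambda>y. of_real (f y) * u y)"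
              and h: "continuous_on C h" "null (\<lambda>y. of_real (h y) * u y)"
              using \<open>P f \<and> P h\<close> that by (auto simp: P_def)
            show ?thesis by (rule f[OF _ h(2)]) (intro continuous_intros h that)
          qed
          then show ?thesis using that by (auto simp: P_def mult.assoc intro: continuous_intros)
        qed
        show "\<exists>f. P f \<and> f x \<noteq> f y" if "x \<in> C \<and> y \<in> C \<and> x \<noteq> y" for x y
          using that P_Re P_Im complex_eqI by blast
      qed
      then obtain p where p: "P p" "\<And>x. x \<in> C \<Longrightarrow> \<bar>g x - p x\<bar> < e" by blast
      have pc: "continuous_on C p" using p(1) by (simp add: P_def)
      have "null (\<lambda>y. of_real (p y) * 1)" using p(1) null_1 continuous_on_const unfolding P_def by blast
      then have "(LINT y|M. of_real (p y) * 1 * (y ^ 0 * cnj y ^ 0) * \<psi> y) = 0" unfolding null_def by blast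
      then have p0: "(LINT y|M. of_real (p y) * \<psi> y) = 0" by simp
      have ig: "integrable M (\<lambda>y. of_real (g y) * \<psi> y)" "integrable M (\<lambda>y. of_real (p y) * \<psi> y)"
        by (rule param_integrable[OF \<psi>], intro continuous_intros g pc)+
      have "(LINT y|M. of_real (g y) * \<psi> y) = (LINT y|M. of_real (g y) * \<psi> y - of_real (p y) * \<psi> y)"
        using ig p0 by simp
      also have "cmod \<dots> \<le> (LINT y|M. cmod (of_real (g y) * \<psi> y - of_real (p y) * \<psi> y))"
        by (rule integral_norm_bound)
      also have "\<dots> \<le> (LINT y|M. e * cmod (\<psi> y))"
      proof (rule integral_mono)
        show "integrable M (\<lambda>y. cmod (of_real (g y) * \<psi> y - of_real (p y) * \<psi> y))" using ig by simp
        show "integrable M (\<lambda>y. e * cmod (\<psi> y))" using \<psi> by simp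
        fix y assume "y \<in> space M"
        then have "\<bar>g y - p y\<bar> < e" using p(2) by (simp add: space_M)
        have "of_real (g y) * \<psi> y - of_real (p y) * \<psi> y = of_real (g y - p y) * \<psi> y" by (simp add: algebra_simps)
        then have "cmod (of_real (g y) * \<psi> y - of_real (p y) * \<psi> y) = \<bar>g y - p y\<bar> * cmod (\<psi> y)"
          by (simp only: norm_mult norm_of_real)
        also have "\<dots> \<le> e * cmod (\<psi> y)" using \<open>\<bar>g y - p y\<bar> < e\<close> by (intro mult_right_mono) auto
        finally show "cmod (of_real (g y) * \<psi> y - of_real (p y) * \<psi> y) \<le> e * cmod (\<psi> y)" .
      qed
      finally show ?thesis by simp
    qed
    define I where "I = (LINT y|M. cmod (\<psi> y))"
    have I: "I \<ge> 0" by (simp add: I_def integral_nonneg_AE)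
    have "cmod (LINT y|M. of_real (g y) * \<psi> y) \<le> 0 + e" if "e > 0" for e
    proof -
      have "e / (I + 1) * I \<le> e" using I that by (simp add: field_simps)
      then show ?thesis using bound[of "e / (I + 1)"] I that unfolding I_def[symmetric] by simp
    qed
    then have "cmod (LINT y|M. of_real (g y) * \<psi> y) \<le> 0" by (rule field_le_epsilon)
    then show ?thesis by simp
  qed
  have closed_zero: "(LINT y:A|M. \<psi> y) = 0" if A: "closed A" "A \<noteq> {}" for A
  proof -
    \<comment> \<open>Continuous functions decreasing to the indicator of the closed set A. The
      empty set is excluded because \<open>infdist\<close> to it is 0 by convention.\<close>
    define g where "g n y = max 0 (1 - real n * infdist y A)" for n y
    have gc: "continuous_on C (g n)" for n unfolding g_def by (intro continuous_intros)
    have g_lim: "(\<lambda>n. g n y) \<longlonglongrightarrow> indicator A y" for y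
    proof (cases "y \<in> A")
      case True
      then show ?thesis by (simp add: g_def)
    next
      case False
      then have d: "infdist y A > 0" using A infdist_pos_not_in_closed by blast
      obtain N where N: "1 / infdist y A < real N" using reals_Archimedean2 by blast
      have "\<forall>\<^sub>F n in sequentially. g n y = indicator A y"
      proof (rule eventually_sequentiallyI[of N])
        fix n assume "N \<le> n"
        then have "1 / infdist y A < real n" using N by linarith
        then have "1 < real n * infdist y A" using d by (simp add: divide_less_eq)
        then show "g n y = indicator A y" using False by (simp add: g_def)
      qed
      then show ?thesis by (rule tendsto_eventually)
    qed
    have mg: "g n \<in> borel_measurable M" for n
      unfolding measurable_cong_sets[OF sets_M refl] by (rule borel_measurable_continuous_on_restrict[OF gc])
    have mA: "indicator A \<in> (borel_measurable M :: (complex \<Rightarrow> real) set)"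
      unfolding measurable_cong_sets[OF sets_M refl] by (rule measurable_restrict_space1) (use A in simp)
    have "(\<lambda>n. LINT y|M. of_real (g n y) * \<psi> y) \<longlonglongrightarrow> (LINT y|M. of_real (indicator A y) * \<psi> y)"
    proof (rule integral_dominated_convergence[where w="\<lambda>y. cmod (\<psi> y)"])
      show "integrable M (\<lambda>y. cmod (\<psi> y))" using \<psi> by simp
      show "AE y in M. (\<lambda>n. of_real (g n y) * \<psi> y) \<longlonglongrightarrow> of_real (indicator A y) * \<psi> y"
        by (rule AE_I2) (intro tendsto_intros g_lim)
      show "AE y in M. norm (of_real (g n y) * \<psi> y) \<le> cmod (\<psi> y)" for n
      proof (rule AE_I2)
        fix y
        have "0 \<le> g n y" "g n y \<le> 1" by (auto simp: g_def infdist_nonneg)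
        then show "norm (of_real (g n y) * \<psi> y) \<le> cmod (\<psi> y)"
          by (simp add: norm_mult mult_left_le_one_le)
      qed
    qed (use mg mA in \<open>auto intro!: borel_measurable_times borel_measurable_of_real\<close>)
    then have "(LINT y|M. of_real (indicator A y) * \<psi> y) = 0"
      unfolding cont_zero[OF gc] using LIMSEQ_unique tendsto_const by blast
    then show ?thesis by (simp add: set_lebesgue_integral_def scaleR_conv_of_real)
  qed
  define Gen where "Gen = (\<lambda>A. A \<inter> C) ` {A. closed A}"
  have setsM: "sets M = sigma_sets C Gen"
  proof -
    have "sets M = (\<lambda>A. A \<inter> C) ` sigma_sets UNIV {A. closed A}"
      unfolding sets_M sets_restrict_space borel_eq_closed by (auto simp: image_def Int_commute)
    also have "\<dots> = sigma_sets C Gen"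
      unfolding Gen_def using sigma_sets_Int[of C UNIV "{A. closed A}"] compact_imp_closed[OF compact_C]
      by (auto simp: Int_commute image_def intro: sigma_sets.Basic)
    finally show ?thesis .
  qed
  have set_int: "set_integrable M A \<psi>" if "A \<in> sets M" for A
    unfolding set_integrable_def using integrable_mult_indicator[OF that \<psi>] .
  have stable: "Int_stable Gen"
  proof (rule Int_stableI)
    fix a b assume "a \<in> Gen" "b \<in> Gen"
    then obtain A B where "a = A \<inter> C" "closed A" "b = B \<inter> C" "closed B" by (auto simp: Gen_def)
    then show "a \<inter> b \<in> Gen" unfolding Gen_def by (intro image_eqI[of _ _ "A \<inter> B"]) auto
  qed
  have Gen_Pow: "Gen \<subseteq> Pow C" by (auto simp: Gen_def)
  have zero: "(LINT y:A|M. \<psi> y) = 0" if "A \<in> sigma_sets C Gen" for A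
    using stable Gen_Pow that
  proof (induction rule: sigma_sets_induct_disjoint)
    case (basic A)
    then obtain B where B: "A = B \<inter> C" "closed B" by (auto simp: Gen_def)
    have "closed A" using B compact_imp_closed[OF compact_C] by auto
    then show ?case using closed_zero[of A] by (cases "A = {}") (auto simp: set_lebesgue_integral_def)
  next
    case empty
    show ?case by (simp add: set_lebesgue_integral_def)
  next
    case (compl A)
    then have A: "A \<in> sets M" by (simp add: setsM)
    have "closed C" using compact_C by (rule compact_imp_closed)
    then have "(LINT y:C|M. \<psi> y) = 0" using closed_zero[of C] by (cases "C = {}") (auto simp: set_lebesgue_integral_def)
    moreover have "(LINT y:(C - A) \<union> A|M. \<psi> y) = (LINT y:C - A|M. \<psi> y) + (LINT y:A|M. \<psi> y)"
    proof (rule set_integral_Un)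
      have "C - A \<in> sets M" using sets.compl_sets[OF A] by (simp add: space_M)
      then show "set_integrable M (C - A) \<psi>" "set_integrable M A \<psi>" using A set_int by auto
    qed auto
    moreover have "(C - A) \<union> A = C" using sets.sets_into_space[OF A] by (auto simp: space_M)
    ultimately show ?case using compl by simp
  next
    case (union A)
    have "(LINT y:(\<Union>i. A i)|M. \<psi> y) = (\<Sum>i. (LINT y:(A i)|M. \<psi> y))"
    proof (rule lebesgue_integral_countable_add)
      show "A i \<in> sets M" for i using union(2) by (auto simp: setsM)
      then show "set_integrable M (\<Union>i. A i) \<psi>" by (intro set_int) auto
      show "A i \<inter> A j = {}" if "i \<noteq> j" for i j using union(1) that by (auto simp: disjoint_family_on_def)
    qed
    then show ?case using union(3) by simp
  qed
  show ?thesis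
    by (rule density_zero[OF \<psi>]) (use zero setsM in blast)
qed

lemma circle_integral:
  fixes f :: "complex \<Rightarrow> complex"
  assumes R: "R > 0" and f: "continuous_on (range (circle_curve R)) f"
  shows "(LINT y|arclength (circle_curve R). f y) = of_real (2 * pi * R) * integral {0..1} (\<lambda>t. f (circle_curve R t))"
proof -
  interpret closed_curve "circle_curve R" by (rule closed_curve_circle[OF R])
  have fc: "continuous_on S (\<lambda>t. f (circle_curve R t))" for S
    by (rule continuous_on_compose2[OF f continuous_on_subset[OF cont]]) auto
  have [measurable]: "(\<lambda>t. f (circle_curve R t)) \<in> borel_measurable borel"
    by (rule borel_measurable_continuous_onI[OF fc])
  have si: "set_integrable lborel {0..1} (\<lambda>t. f (circle_curve R t))"
    by (rule borel_integrable_atLeastAtMost'[OF fc])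
  have "(LINT y|arclength (circle_curve R). f y) = (LINT t|lborel. speed t *\<^sub>R f (circle_curve R t))"
    by (rule integral_arclength[OF borel_measurable_M[OF f]])
  also have "\<dots> = (LINT t|lborel. of_real (2 * pi * R) * (indicator {0..1} t *\<^sub>R f (circle_curve R t)))"
  proof (rule integral_cong_AE)
    show "AE t in lborel. speed t *\<^sub>R f (circle_curve R t) = of_real (2 * pi * R) * (indicator {0..1} t *\<^sub>R f (circle_curve R t))"
      using AE_lborel_singleton[of "1::real"]
    proof eventually_elim
      case (elim t)
      then show ?case using R by (auto simp: indicator_def curve_deriv_circle norm_mult scaleR_conv_of_real)
    qed
  qed measurable
  also have "\<dots> = of_real (2 * pi * R) * (LINT t:{0..1}|lborel. f (circle_curve R t))"
    unfolding set_lebesgue_integral_def by (rule integral_mult_right_zero)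
  also have "(LINT t:{0..1}|lborel. f (circle_curve R t)) = integral {0..1} (\<lambda>t. f (circle_curve R t))"
    by (rule set_borel_integral_eq_integral(2)[OF si])
  finally show ?thesis by simp
qed

lemma integral_periodic_shift:
  fixes g :: "real \<Rightarrow> complex"
  assumes g: "continuous_on UNIV g" and per: "\<And>t. g (t + 1) = g t" and c: "0 \<le> c" "c \<le> 1"
  shows "integral {0..1} (\<lambda>t. g (t - c)) = integral {0..1} g"
proof -
  have int: "g integrable_on {a..b}" for a b
    by (rule integrable_continuous_interval[OF continuous_on_subset[OF g]]) simp
  have "integral {0..1} (\<lambda>t. g (t - c)) = integral {-c..1 - c} g"
    using integral_shift_real_ivl[of "-c" "-c" "1 - c" g] by simp
  also have "\<dots> = integral {-c..0} g + integral {0..1 - c} g"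
    by (rule Henstock_Kurzweil_Integration.integral_combine[symmetric]) (use c int in auto)
  also have "integral {-c..0} g = integral {1 - c..1} g"
    using integral_shift_real_ivl[of "1 - c" 1 1 g] by (simp add: per)
  also have "integral {1 - c..1} g + integral {0..1 - c} g = integral {0..1} g"
    using Henstock_Kurzweil_Integration.integral_combine[of 0 "1 - c" 1 g] c int by (simp add: add.commute)
  finally show ?thesis .
qed

lemma integral_periodic_reflect:
  fixes g :: "real \<Rightarrow> complex"
  assumes per: "\<And>t. g (t + 1) = g t"
  shows "integral {0..1} (\<lambda>t. g (- t)) = integral {0..1} g"
proof -
  have "integral {0..1} (\<lambda>t. g (- t)) = integral {-1..0} g"
    using Henstock_Kurzweil_Integration.integral_reflect_real[of 0 "-1" g] by simp
  also have "\<dots> = integral {0..1} g"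
    using integral_shift_real_ivl[of 0 1 1 g] by (simp add: per)
  finally show ?thesis .
qed

section \<open>Fourier modes of \<open>Phi\<close> between concentric circles\<close>

definition circle_coeff :: "real \<Rightarrow> real \<Rightarrow> real \<Rightarrow> nat \<Rightarrow> complex" where
  "circle_coeff k r R m = integral {0..1} (\<lambda>t. Phi k (circle_curve r t) (of_real R) * cis (- (2 * pi * real m * t)))"

text \<open>For |e| = 1 one has |R e - r| = |r e - R|, so exchanging the roles of the two radii
  leaves the coefficient unchanged; it is always the smaller radius that enters
  \<open>bes_A\<close>.\<close>

lemma circle_coeff_eq:
  fixes k r R :: real and m :: nat
  assumes k: "k > 0" and r: "0 < r" "r < R"
  defines "c \<equiv> graf_const k m * of_real (R * r) ^ m * (deriv ^^ m) (bes_A (kap k)) (of_real (r\<^sup>2)) * (deriv ^^ m) (fund k) (of_real (R\<^sup>2))"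
  shows "circle_coeff k r R m = c" "circle_coeff k R r m = c"
proof -
  have neq: "circle_curve r t \<noteq> of_real R" "circle_curve R t \<noteq> of_real r" for t
    using norm_circle[of r "circle_curve r t"] norm_circle[of R "circle_curve R t"] r by auto
  have swap: "cmod (circle_curve R t - of_real r) = cmod (circle_curve r t - of_real R)" for t
  proof -
    define e where "e = cis (2 * pi * t)"
    have e: "cmod e = 1" "e * cnj e = 1" by (simp_all add: e_def complex_norm_square[symmetric])
    have "of_real R * e - of_real r = - e * cnj (of_real r * e - of_real R)"
      using e(2) by (simp add: algebra_simps)
    then have "cmod (of_real R * e - of_real r) = cmod (of_real r * e - of_real R)"
      using e(1) by (simp only: norm_mult norm_minus_cancel complex_mod_cnj mult_1)
    then show ?thesis by (simp add: circle_curve_def e_def)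
  qed
  show "circle_coeff k r R m = c"
  proof -
    have "Phi k (circle_curve r t) (of_real R) = fund k (of_real ((cmod (of_real R - of_real r * cis (2 * pi * t)))\<^sup>2))" for t
      unfolding Phi_eq_fund[OF k neq(1)] by (simp only: circle_curve_def norm_minus_commute)
    then show ?thesis unfolding circle_coeff_def c_def graf_coefficient[OF k r, symmetric] by (simp only:)
  qed
  then show "circle_coeff k R r m = c"
    unfolding circle_coeff_def Phi_eq_fund[OF k neq(1)] Phi_eq_fund[OF k neq(2)] swap .
qed

lemma Phi_cong: "cmod (x - y) = cmod (x' - y') \<Longrightarrow> Phi k x y = Phi k x' y'"
  by (simp add: Phi_def)

lemma Phi_circle_continuous:
  assumes k: "k > 0" and r: "r > 0" and y: "cmod y \<noteq> r"
  shows "continuous_on (range (circle_curve r)) (\<lambda>x. Phi k x y)"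
proof -
  have "isCont (\<lambda>x. Phi k x y) x" if "x \<in> range (circle_curve r)" for x
    by (rule wirt_at_isCont[OF Phi_wirt(2)[OF k]]) (use norm_circle[OF r that] y in auto)
  then show ?thesis by (intro continuous_at_imp_continuous_on) auto
qed

text \<open>Rotating y onto the positive axis shifts the parameter and produces the phase (cnj y /
  R)^m. The opposite frequency follows by the reflection t -> -t, which replaces y by cnj y.\<close>

lemma circle_coeff_rotate:
  assumes k: "k > 0" and r: "r > 0" "R > 0" "r \<noteq> R" and y: "y \<in> range (circle_curve R)"
  shows "integral {0..1} (\<lambda>t. Phi k (circle_curve r t) y * cis (- (2 * pi * real m * t))) = circle_coeff k r R m * (cnj y / of_real R) ^ m"
    "integral {0..1} (\<lambda>t. Phi k (circle_curve r t) y * cis (2 * pi * real m * t)) = circle_coeff k r R m * (y / of_real R) ^ m"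
proof -
  interpret cr: closed_curve "circle_curve r" by (rule closed_curve_circle[OF r(1)])
  interpret cR: closed_curve "circle_curve R" by (rule closed_curve_circle[OF r(2)])
  have cis_per: "cis (a * (t + 1)) = cis (a * t)" if "cis a = 1" for a t
    using that by (simp add: distrib_left cis_mult[symmetric])
  have cis1: "cis (- (2 * pi * real m)) = 1" "cis (2 * pi * real m) = 1"
    using cis_multiple_2pi[of "real m"] cis_multiple_2pi[of "- real m"] by (auto simp: mult_ac)
  have rot: "integral {0..1} (\<lambda>t. Phi k (circle_curve r t) y * cis (- (2 * pi * real m * t))) = circle_coeff k r R m * (cnj y / of_real R) ^ m"
    if y: "y \<in> range (circle_curve R)" for y
  proof -
    obtain t0 where t0: "0 \<le> t0" "t0 < 1" "y = circle_curve R t0" using y unfolding cR.range_eq by auto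
    define g where "g t = Phi k (circle_curve r t) (of_real R) * cis (- (2 * pi * real m) * t)" for t
    have gc: "continuous_on UNIV g"
      unfolding g_def cis_conv_exp
      by (intro continuous_intros continuous_on_compose2[OF Phi_circle_continuous[OF k r(1), of "of_real R"] cr.cont]) (use r in auto)
    have gp: "g (t + 1) = g t" for t
      unfolding g_def cis_per[OF cis1(1)] by (simp add: cr.periodic)
    have "integral {0..1} (\<lambda>t. Phi k (circle_curve r t) y * cis (- (2 * pi * real m * t)))
        = integral {0..1} (\<lambda>t. g (t - t0) * cis (- (2 * pi * real m * t0)))"
    proof (rule arg_cong[of _ _ "integral {0..1}"], rule ext)
      fix t
      have "circle_curve r t - y = cis (2 * pi * t0) * (circle_curve r (t - t0) - of_real R)"
        unfolding t0(3) circle_curve_def by (simp add: right_diff_distrib cis_mult mult.left_commute[of "cis _"] algebra_simps)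
      then have "cmod (circle_curve r t - y) = cmod (circle_curve r (t - t0) - of_real R)" by (simp add: norm_mult)
      then have "Phi k (circle_curve r t) y = Phi k (circle_curve r (t - t0)) (of_real R)" by (rule Phi_cong)
      moreover have "cis (- (2 * pi * real m * t)) = cis (- (2 * pi * real m) * (t - t0)) * cis (- (2 * pi * real m * t0))"
        by (simp add: cis_mult algebra_simps)
      ultimately show "Phi k (circle_curve r t) y * cis (- (2 * pi * real m * t)) = g (t - t0) * cis (- (2 * pi * real m * t0))"
        by (simp add: g_def)
    qed
    also have "\<dots> = integral {0..1} (\<lambda>t. g (t - t0)) * cis (- (2 * pi * real m * t0))"
      by (rule integral_mult_left)
    also have "integral {0..1} (\<lambda>t. g (t - t0)) = integral {0..1} g"
      by (rule integral_periodic_shift[OF gc gp]) (use t0 in auto)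
    also have "integral {0..1} g = circle_coeff k r R m"
      unfolding circle_coeff_def g_def by (simp add: mult.assoc)
    also have "cis (- (2 * pi * real m * t0)) = (cnj y / of_real R) ^ m"
    proof -
      have "cnj y / of_real R = cis (- (2 * pi * t0))" using r by (simp add: t0(3) circle_curve_def cis_cnj)
      then show ?thesis by (simp add: Complex.DeMoivre mult_ac)
    qed
    finally show ?thesis .
  qed
  show "integral {0..1} (\<lambda>t. Phi k (circle_curve r t) y * cis (- (2 * pi * real m * t))) = circle_coeff k r R m * (cnj y / of_real R) ^ m"
    by (rule rot[OF y])
  have "cnj y \<in> range (circle_curve R)"
  proof -
    obtain t where "y = circle_curve R t" using y by blast
    then have "cnj y = circle_curve R (- t)" by (simp add: circle_curve_def cis_cnj)
    then show ?thesis by blast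
  qed
  note rot_cnj = rot[OF this]
  define f where "f t = Phi k (circle_curve r t) y * cis (2 * pi * real m * t)" for t
  have fp: "f (t + 1) = f t" for t unfolding f_def cis_per[OF cis1(2)] by (simp add: cr.periodic)
  have "f (- t) = Phi k (circle_curve r t) (cnj y) * cis (- (2 * pi * real m * t))" for t
  proof -
    have "circle_curve r (- t) - y = cnj (circle_curve r t - cnj y)" by (simp add: circle_curve_def cis_cnj)
    then have "cmod (circle_curve r (- t) - y) = cmod (circle_curve r t - cnj y)" by (simp only: complex_mod_cnj)
    then have "Phi k (circle_curve r (- t)) y = Phi k (circle_curve r t) (cnj y)" by (rule Phi_cong)
    then show ?thesis by (simp add: f_def)
  qed
  then show "integral {0..1} (\<lambda>t. Phi k (circle_curve r t) y * cis (2 * pi * real m * t)) = circle_coeff k r R m * (y / of_real R) ^ m"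
    using integral_periodic_reflect[of f, OF fp] rot_cnj by (simp add: f_def[symmetric])
qed

lemma Phi_kernel:
  assumes k: "k > 0" and R: "R > 0" and g: "closed_curve g"
  obtains C where "L2_kernel (arclength (circle_curve R)) (arclength g) (Phi k) C"
proof -
  interpret g: closed_curve g by fact
  interpret c: closed_curve "circle_curve R" by (rule closed_curve_circle[OF R])
  obtain \<rho> where \<rho>: "\<rho> > 0" "\<And>x. x \<in> range g \<Longrightarrow> cmod x \<le> \<rho>"
    using compact_imp_bounded[OF g.compact_range] unfolding bounded_pos by blast
  obtain C where C: "\<And>x. cmod x \<le> \<rho> \<Longrightarrow> integrable (arclength (circle_curve R)) (\<lambda>y. (cmod (Phi k x y))\<^sup>2)"
    "\<And>x. cmod x \<le> \<rho> \<Longrightarrow> (LINT y|arclength (circle_curve R). (cmod (Phi k x y))\<^sup>2) \<le> C"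
    using Phi_square_bound[OF k less_imp_le[OF \<rho>(1)] R] by blast
  have "L2_kernel (arclength (circle_curve R)) (arclength g) (Phi k) C"
  proof (intro L2_kernel.intro c.finite_arclength g.finite_arclength L2_kernel_axioms.intro)
    have 1: "(\<lambda>x. x) \<in> borel_measurable (arclength g)" by (rule g.borel_measurable_arclength) simp
    have 2: "(\<lambda>x. x) \<in> borel_measurable (arclength (circle_curve R))" by (rule c.borel_measurable_arclength) simp
    show "(\<lambda>(x, y). Phi k x y) \<in> borel_measurable (arclength g \<Otimes>\<^sub>M arclength (circle_curve R))"
      unfolding case_prod_beta'
      by (rule Phi_borel[OF measurable_compose[OF measurable_fst 1] measurable_compose[OF measurable_snd 2]])
  qed (use C \<rho>(2) in \<open>auto simp: g.space_arclength\<close>)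
  then show ?thesis using that by blast
qed

text \<open>The flag selects frequency m or -m. Without normalisation the same function serves on
  circles of every radius.\<close>

definition circle_mode :: "bool \<Rightarrow> nat \<Rightarrow> complex \<Rightarrow> complex" where
  "circle_mode s m x = (if s then x ^ m else cnj x ^ m)"

lemma circle_mode_L2:
  assumes "R > 0"
  shows "circle_mode s m \<in> L2 (arclength (circle_curve R))"
proof -
  interpret closed_curve "circle_curve R" by (rule closed_curve_circle[OF assms])
  show ?thesis
  proof (rule L2_bounded[OF finite_arclength])
    have "continuous_on (range (circle_curve R)) (circle_mode s m)"
      unfolding circle_mode_def by (cases s) (auto intro!: continuous_intros)
    then show "circle_mode s m \<in> borel_measurable (arclength (circle_curve R))" by (rule borel_measurable_M)
    show "cmod (circle_mode s m x) \<le> R ^ m" if "x \<in> space (arclength (circle_curve R))" for x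
      using norm_circle[OF assms, of x] that by (simp add: space_arclength circle_mode_def norm_power)
  qed
qed

text \<open>Rotation invariance makes the adjoint kernel diagonal in the modes. In the scalar, 2 pi
  r is the speed, and r^m / R^m is the ratio of the sizes of the mode on the two circles.\<close>

lemma adj_circle_mode:
  assumes k: "k > 0" and r: "r > 0" "R > 0" "r \<noteq> R" and y: "y \<in> range (circle_curve R)"
  shows "(LINT x|arclength (circle_curve r). cnj (Phi k x y) * circle_mode s m x)
    = cnj (of_real (2 * pi * r * r ^ m / R ^ m) * circle_coeff k r R m) * circle_mode s m y"
proof -
  have yr: "cmod y \<noteq> r" using norm_circle[OF r(2) y] r by simp
  define \<sigma> :: real where "\<sigma> = (if s then 1 else -1)"
  have cont: "continuous_on (range (circle_curve r)) (\<lambda>x. cnj (Phi k x y) * circle_mode s m x)"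
    unfolding circle_mode_def by (cases s) (auto intro!: continuous_intros Phi_circle_continuous[OF k r(1) yr])
  have mode: "circle_mode s m (circle_curve r t) = of_real (r ^ m) * cnj (cis (- (\<sigma> * (2 * pi * real m * t))))" for t
    by (auto simp: circle_mode_def circle_curve_def \<sigma>_def power_mult_distrib Complex.DeMoivre cis_cnj mult_ac)
  have coeff: "integral {0..1} (\<lambda>t. Phi k (circle_curve r t) y * cis (- (\<sigma> * (2 * pi * real m * t))))
      = circle_coeff k r R m * cnj (circle_mode s m y / of_real (R ^ m))"
    using circle_coeff_rotate[OF k r y, of m] by (auto simp: \<sigma>_def circle_mode_def power_divide)
  have "(LINT x|arclength (circle_curve r). cnj (Phi k x y) * circle_mode s m x)
     = of_real (2 * pi * r) * integral {0..1} (\<lambda>t. cnj (Phi k (circle_curve r t) y) * circle_mode s m (circle_curve r t))"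
    by (rule circle_integral[OF r(1) cont])
  also have "(\<lambda>t. cnj (Phi k (circle_curve r t) y) * circle_mode s m (circle_curve r t))
     = (\<lambda>t. of_real (r ^ m) * cnj (Phi k (circle_curve r t) y * cis (- (\<sigma> * (2 * pi * real m * t)))))"
    unfolding mode by (simp add: fun_eq_iff mult_ac)
  also have "integral {0..1} (\<lambda>t. of_real (r ^ m) * cnj (Phi k (circle_curve r t) y * cis (- (\<sigma> * (2 * pi * real m * t)))))
     = of_real (r ^ m) * cnj (circle_coeff k r R m * cnj (circle_mode s m y / of_real (R ^ m)))"
    unfolding coeff[symmetric] Henstock_Kurzweil_Integration.integral_cnj by (rule integral_mult_right)
  finally show ?thesis by (simp add: mult_ac)
qed

lemma densities_zero:
  assumes k: "k > 0" and R: "0 < R\<^sub>1" "R\<^sub>1 < R\<^sub>2"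
    and ev: "\<not> dirichlet_eigenvalue (k\<^sup>2) (ball 0 R\<^sub>1)"
    and \<psi>1: "\<psi>1 \<in> L2 (arclength (circle_curve R\<^sub>1))" and \<psi>2: "\<psi>2 \<in> L2 (arclength (circle_curve R\<^sub>2))"
    and zero: "\<And>x. R\<^sub>1 < cmod x \<Longrightarrow> cmod x < R\<^sub>2 \<Longrightarrow>
      single_layer k (circle_curve R\<^sub>1) \<psi>1 x + single_layer k (circle_curve R\<^sub>2) \<psi>2 x = 0"
  shows "AE y in arclength (circle_curve R\<^sub>1). \<psi>1 y = 0" "AE y in arclength (circle_curve R\<^sub>2). \<psi>2 y = 0"
proof -
  let ?M1 = "arclength (circle_curve R\<^sub>1)" and ?M2 = "arclength (circle_curve R\<^sub>2)"
  have R2: "R\<^sub>2 > 0" using R by simp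
  define A where "A m r = (deriv ^^ m) (bes_A (kap k)) (of_real (r\<^sup>2))" for m and r :: real
  define F where "F m r = (deriv ^^ m) (fund k) (of_real (r\<^sup>2))" for m and r :: real
  have modes: "L2_inner ?M1 \<psi>1 (circle_mode s m) = 0 \<and> L2_inner ?M2 \<psi>2 (circle_mode s m) = 0" for s m
  proof -
    let ?h = "circle_mode s m"
    define p where "p = L2_inner ?M1 \<psi>1 ?h"
    define q where "q = L2_inner ?M2 \<psi>2 ?h"
    \<comment> \<open>The field vanishes on |x| = r. Its pairing with a mode is moved to the
      densities by the adjoints, which act on the mode as scalars, so r survives only in
      \<open>F m r\<close> and \<open>A m r\<close>.\<close>
    have eq: "F m r * (A m R\<^sub>1 * p) + A m r * (F m R\<^sub>2 * q) = 0" if r: "R\<^sub>1 < r" "r < R\<^sub>2" for r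
    proof -
      have r0: "r > 0" using r R by simp
      let ?N = "arclength (circle_curve r)"
      interpret cr: closed_curve "circle_curve r" by (rule closed_curve_circle[OF r0])
      obtain C1 where C1: "L2_kernel ?M1 ?N (Phi k) C1" using Phi_kernel[OF k R(1) cr.closed_curve_axioms] by blast
      obtain C2 where C2: "L2_kernel ?M2 ?N (Phi k) C2" using Phi_kernel[OF k R2 cr.closed_curve_axioms] by blast
      interpret K1: L2_kernel ?M1 ?N "Phi k" C1 by fact
      interpret K2: L2_kernel ?M2 ?N "Phi k" C2 by fact
      have h: "?h \<in> L2 ?N" by (rule circle_mode_L2[OF r0])
      have inner: "L2_inner M f (LL) = cnj c * L2_inner M f ?h"
        if "\<And>y. y \<in> space M \<Longrightarrow> LL y = c * ?h y" for M f LL c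
      proof -
        have "L2_inner M f LL = (LINT y|M. cnj c * (f y * cnj (?h y)))"
          unfolding L2_inner_def by (rule Bochner_Integration.integral_cong) (auto simp: that)
        then show ?thesis by (simp add: L2_inner_def)
      qed
      have 1: "L2_inner ?N (K1.op \<psi>1) ?h = of_real (2 * pi * r * r ^ m / R\<^sub>1 ^ m) * circle_coeff k r R\<^sub>1 m * p"
      proof -
        interpret c: closed_curve "circle_curve R\<^sub>1" by (rule closed_curve_circle[OF R(1)])
        have "K1.adj ?h y = cnj (of_real (2 * pi * r * r ^ m / R\<^sub>1 ^ m) * circle_coeff k r R\<^sub>1 m) * ?h y" if "y \<in> space ?M1" for y
          unfolding K1.adj_def by (rule adj_circle_mode[OF k r0 R(1)]) (use r that in \<open>auto simp: c.space_arclength\<close>)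
        from inner[OF this] show ?thesis unfolding K1.inner_adj[OF \<psi>1 h] p_def by simp
      qed
      have 2: "L2_inner ?N (K2.op \<psi>2) ?h = of_real (2 * pi * r * r ^ m / R\<^sub>2 ^ m) * circle_coeff k r R\<^sub>2 m * q"
      proof -
        interpret c: closed_curve "circle_curve R\<^sub>2" by (rule closed_curve_circle[OF R2])
        have "K2.adj ?h y = cnj (of_real (2 * pi * r * r ^ m / R\<^sub>2 ^ m) * circle_coeff k r R\<^sub>2 m) * ?h y" if "y \<in> space ?M2" for y
          unfolding K2.adj_def by (rule adj_circle_mode[OF k r0 R2]) (use r that in \<open>auto simp: c.space_arclength\<close>)
        from inner[OF this] show ?thesis unfolding K2.inner_adj[OF \<psi>2 h] q_def by simp
      qed
      have "L2_inner ?N (K1.op \<psi>1) ?h + L2_inner ?N (K2.op \<psi>2) ?h = L2_inner ?N (\<lambda>x. K1.op \<psi>1 x + K2.op \<psi>2 x) ?h"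
        by (rule L2_inner_add[symmetric]) (use K1.op_L2[OF \<psi>1] K2.op_L2[OF \<psi>2] h in auto)
      also have "\<dots> = (LINT x|?N. 0)"
        unfolding L2_inner_def
      proof (rule Bochner_Integration.integral_cong)
        fix x assume "x \<in> space ?N"
        then have "cmod x = r" using norm_circle[OF r0] by (simp add: cr.space_arclength)
        then have "K1.op \<psi>1 x + K2.op \<psi>2 x = 0"
          using zero[of x] r by (simp add: K1.op_def K2.op_def single_layer_def)
        then show "(K1.op \<psi>1 x + K2.op \<psi>2 x) * cnj (?h x) = 0" by simp
      qed simp
      finally have sum: "of_real (2 * pi * r * r ^ m / R\<^sub>1 ^ m) * circle_coeff k r R\<^sub>1 m * p
          + of_real (2 * pi * r * r ^ m / R\<^sub>2 ^ m) * circle_coeff k r R\<^sub>2 m * q = 0"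
        unfolding 1 2 by simp
      \<comment> \<open>A factor common to both terms: the powers of the radii
        \<open>R\<^sub>1\<close> and \<open>R\<^sub>2\<close> in the coefficients cancel against the
        denominators of the adjoint scalars.\<close>
      define c where "c = of_real (2 * pi * r * r ^ m * r ^ m) * graf_const k m"
      have c: "c \<noteq> 0" using r0 graf_const_nonzero[OF k] by (simp add: c_def)
      have "of_real (2 * pi * r * r ^ m / R\<^sub>1 ^ m) * circle_coeff k r R\<^sub>1 m * p = c * (F m r * (A m R\<^sub>1 * p))"
        using circle_coeff_eq(2)[OF k R(1) r(1), of m] R(1) by (simp add: c_def A_def F_def power_mult_distrib)
      moreover have "of_real (2 * pi * r * r ^ m / R\<^sub>2 ^ m) * circle_coeff k r R\<^sub>2 m * q = c * (A m r * (F m R\<^sub>2 * q))"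
        using circle_coeff_eq(1)[OF k r0 r(2), of m] R2 by (simp add: c_def A_def F_def power_mult_distrib)
      ultimately have "c * (F m r * (A m R\<^sub>1 * p) + A m r * (F m R\<^sub>2 * q)) = 0"
        using sum by (simp add: distrib_left)
      then show ?thesis using c by (metis mult_eq_0_iff)
    qed
    have "A m R\<^sub>1 * p = 0 \<and> F m R\<^sub>2 * q = 0"
    proof (rule fund_bes_A_independent[OF k, of "R\<^sub>1\<^sup>2" "R\<^sub>2\<^sup>2"])
      show "R\<^sub>1\<^sup>2 < R\<^sub>2\<^sup>2" using R by (intro power_strict_mono) auto
      fix x assume x: "R\<^sub>1\<^sup>2 < x" "x < R\<^sub>2\<^sup>2"
      have "x > 0" using x(1) by (metis le_less_trans zero_le_power2)
      then have "R\<^sub>1 < sqrt x" "sqrt x < R\<^sub>2" "(sqrt x)\<^sup>2 = x"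
        using x R R2 by (auto intro: real_less_rsqrt real_less_lsqrt)
      then show "A m R\<^sub>1 * p * (deriv ^^ m) (fund k) (of_real x) + F m R\<^sub>2 * q * (deriv ^^ m) (bes_A (kap k)) (of_real x) = 0"
        using eq[of "sqrt x"] by (simp add: A_def F_def mult_ac del: of_real_power)
    qed simp
    moreover have "A m R\<^sub>1 \<noteq> 0" unfolding A_def by (rule not_eigenvalue_bes_A[OF k R(1) ev])
    moreover have "F m R\<^sub>2 \<noteq> 0" unfolding F_def by (rule fund_higher_deriv_nonzero[OF k]) (use R2 in simp)
    ultimately show ?thesis by (simp add: p_def q_def)
  qed
  have AE: "AE y in arclength (circle_curve R). \<psi> y = 0"
    if R: "R > 0" and \<psi>: "\<psi> \<in> L2 (arclength (circle_curve R))"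
      and modes: "\<And>s m. L2_inner (arclength (circle_curve R)) \<psi> (circle_mode s m) = 0" for R \<psi>
  proof -
    interpret closed_curve "circle_curve R" by (rule closed_curve_circle[OF R])
    show ?thesis
    proof (rule AE_zero_if_moments_zero[OF finite_arclength L2_integrable[OF finite_arclength \<psi>]])
      fix i j
      \<comment> \<open>On the circle y cnj y = R^2, so every monomial collapses to a multiple of
        one pure power; the conjugate in \<open>L2_inner\<close> decides the flag.\<close>
      have red: "\<exists>s m c. \<forall>y\<in>range (circle_curve R). y ^ i * cnj y ^ j = c * cnj (circle_mode s m y)"
      proof (cases "i \<le> j")
        case True
        have "y ^ i * cnj y ^ j = of_real ((R\<^sup>2) ^ i) * cnj (circle_mode True (j - i) y)" if "y \<in> range (circle_curve R)" for y
        proof -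
          have "y * cnj y = of_real (R\<^sup>2)" using norm_circle[OF R that] complex_norm_square[of y] by simp
          moreover have "y ^ i * cnj y ^ j = (y * cnj y) ^ i * cnj y ^ (j - i)"
            using True by (simp add: power_mult_distrib mult.assoc flip: power_add)
          ultimately show ?thesis by (simp add: circle_mode_def)
        qed
        then show ?thesis by blast
      next
        case False
        have "y ^ i * cnj y ^ j = of_real ((R\<^sup>2) ^ j) * cnj (circle_mode False (i - j) y)" if "y \<in> range (circle_curve R)" for y
        proof -
          have "y * cnj y = of_real (R\<^sup>2)" using norm_circle[OF R that] complex_norm_square[of y] by simp
          moreover have "y ^ i * cnj y ^ j = (y * cnj y) ^ j * y ^ (i - j)"
            using False by (simp add: power_mult_distrib mult_ac flip: power_add)
          ultimately show ?thesis by (simp add: circle_mode_def)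
        qed
        then show ?thesis by blast
      qed
      then obtain s m c where smc: "\<And>y. y \<in> range (circle_curve R) \<Longrightarrow> y ^ i * cnj y ^ j = c * cnj (circle_mode s m y)" by blast
      have "(LINT y|arclength (circle_curve R). \<psi> y * (y ^ i * cnj y ^ j))
         = (LINT y|arclength (circle_curve R). c * (\<psi> y * cnj (circle_mode s m y)))"
        by (rule Bochner_Integration.integral_cong) (auto simp: smc space_arclength mult_ac)
      also have "\<dots> = c * L2_inner (arclength (circle_curve R)) \<psi> (circle_mode s m)" by (simp add: L2_inner_def)
      finally show "(LINT y|arclength (circle_curve R). \<psi> y * (y ^ i * cnj y ^ j)) = 0" by (simp add: modes)
    qed
  qed
  show "AE y in ?M1. \<psi>1 y = 0" by (rule AE[OF R(1) \<psi>1]) (use modes in blast)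
  show "AE y in ?M2. \<psi>2 y = 0" by (rule AE[OF R2 \<psi>2]) (use modes in blast)
qed


section \<open>The single-layer operator\<close>

lemma (in closed_curve) continuous_L2:
  fixes f :: "complex \<Rightarrow> complex"
  assumes f: "continuous_on (range g) f"
  shows "f \<in> L2 (arclength g)"
proof -
  obtain B where "\<forall>y\<in>f ` range g. cmod y \<le> B"
    using compact_imp_bounded[OF compact_continuous_image[OF f compact_range]] bounded_iff by blast
  then show ?thesis
    by (intro L2_bounded[OF finite_arclength borel_measurable_M[OF f]]) (auto simp: space_arclength)
qed

lemma L2_inner_add_right:
  assumes "f \<in> L2 M" "g \<in> L2 M" "h \<in> L2 M"
  shows "L2_inner M h (\<lambda>x. f x + g x) = L2_inner M h f + L2_inner M h g"
  using L2_inner_add[OF assms] L2_inner_cnj[of M h "\<lambda>x. f x + g x"] L2_inner_cnj[of M h f] L2_inner_cnj[of M h g]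
  by (simp add: complex_eq_iff)

lemma L2_inner_scale_right: "L2_inner M h (\<lambda>x. c * f x) = cnj c * L2_inner M h f"
  unfolding L2_inner_def by (simp add: mult.left_commute[of _ "cnj c"])

lemma prod_inner_cong_AE:
  assumes "AE x in fst X. fst g x = fst g' x" "AE x in snd X. snd g x = snd g' x"
    and "f \<in> prod_L2 X" "g \<in> prod_L2 X" "g' \<in> prod_L2 X"
  shows "prod_inner X f g = prod_inner X f g'"
  unfolding prod_inner_def
  using assms by (intro arg_cong2[where f="(+)"] L2_inner_cong) (auto simp: prod_L2_def)

lemma prod_norm_eq_0_iff:
  assumes "f \<in> prod_L2 X"
  shows "prod_norm X f = 0 \<longleftrightarrow> (AE x in fst X. fst f x = 0) \<and> (AE x in snd X. snd f x = 0)"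
  using assms L2_norm_eq_0_iff[of "fst f" "fst X"] L2_norm_eq_0_iff[of "snd f" "snd X"]
  by (auto simp: prod_norm_def prod_L2_def sum_power2_eq_zero_iff)

lemma L2_adjointI:
  assumes "g \<in> prod_L2 X" "\<And>f. f \<in> prod_L2 X \<Longrightarrow> prod_inner Y (T f) h = prod_inner X f g"
  shows "L2_adjoint X Y T h \<in> prod_L2 X"
    "\<And>f. f \<in> prod_L2 X \<Longrightarrow> prod_inner Y (T f) h = prod_inner X f (L2_adjoint X Y T h)"
proof -
  have "\<exists>g. g \<in> prod_L2 X \<and> (\<forall>f\<in>prod_L2 X. prod_inner Y (T f) h = prod_inner X f g)" using assms by blast
  from someI_ex[OF this] show "L2_adjoint X Y T h \<in> prod_L2 X"
    "\<And>f. f \<in> prod_L2 X \<Longrightarrow> prod_inner Y (T f) h = prod_inner X f (L2_adjoint X Y T h)"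
    unfolding L2_adjoint_def by blast+
qed

locale single_layer_operator =
  g1: closed_curve \<gamma>\<^sub>1 + g2: closed_curve \<gamma>\<^sub>2 for \<gamma>\<^sub>1 \<gamma>\<^sub>2 +
  fixes k R\<^sub>1 R\<^sub>2 :: real
  assumes k: "k > 0" and R1: "R\<^sub>1 > 0" and R2: "R\<^sub>2 > 0"
begin

abbreviation "X \<equiv> space_X R\<^sub>1 R\<^sub>2"
abbreviation "Y \<equiv> space_Y \<gamma>\<^sub>1 \<gamma>\<^sub>2"
abbreviation "S \<equiv> S_op k R\<^sub>1 R\<^sub>2"
abbreviation "Sadj \<equiv> L2_adjoint X Y S"
abbreviation ipX :: "complex fun_pair \<Rightarrow> complex fun_pair \<Rightarrow> real" where "ipX f g \<equiv> Re (prod_inner X f g)"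
abbreviation ipY :: "complex fun_pair \<Rightarrow> complex fun_pair \<Rightarrow> real" where "ipY f g \<equiv> Re (prod_inner Y f g)"

sublocale c1: closed_curve "circle_curve R\<^sub>1" by (rule closed_curve_circle[OF R1])
sublocale c2: closed_curve "circle_curve R\<^sub>2" by (rule closed_curve_circle[OF R2])
sublocale X: real_semi_inner "prod_L2 X" pair_scale ipX by (rule real_semi_inner_prod_L2)
sublocale Y: real_semi_inner "prod_L2 Y" pair_scale ipY by (rule real_semi_inner_prod_L2)

lemma mem_X: "f \<in> prod_L2 X \<longleftrightarrow> fst f \<in> L2 (arclength (circle_curve R\<^sub>1)) \<and> snd f \<in> L2 (arclength (circle_curve R\<^sub>2))"
  by (simp add: prod_L2_def space_X_def mem_Times_iff)

lemma mem_Y: "f \<in> prod_L2 Y \<longleftrightarrow> fst f \<in> L2 (arclength \<gamma>\<^sub>1) \<and> snd f \<in> L2 (arclength \<gamma>\<^sub>2)"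
  by (simp add: prod_L2_def space_Y_def mem_Times_iff)

lemma inner_X: "prod_inner X f g = L2_inner (arclength (circle_curve R\<^sub>1)) (fst f) (fst g) + L2_inner (arclength (circle_curve R\<^sub>2)) (snd f) (snd g)"
  by (simp add: prod_inner_def space_X_def)

lemma inner_Y: "prod_inner Y f g = L2_inner (arclength \<gamma>\<^sub>1) (fst f) (fst g) + L2_inner (arclength \<gamma>\<^sub>2) (snd f) (snd g)"
  by (simp add: prod_inner_def space_Y_def)

lemma kernel:
  assumes "closed_curve g"
  obtains C1 C2 where "L2_kernel (arclength (circle_curve R\<^sub>1)) (arclength g) (Phi k) C1"
    "L2_kernel (arclength (circle_curve R\<^sub>2)) (arclength g) (Phi k) C2"
  using Phi_kernel[OF k R1 assms] Phi_kernel[OF k R2 assms] by metis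

lemma potential_L2:
  assumes g: "closed_curve g" and f: "f \<in> prod_L2 X"
  shows "(\<lambda>x. single_layer k (circle_curve R\<^sub>1) (fst f) x + single_layer k (circle_curve R\<^sub>2) (snd f) x) \<in> L2 (arclength g)"
proof -
  obtain C1 C2 where "L2_kernel (arclength (circle_curve R\<^sub>1)) (arclength g) (Phi k) C1"
    "L2_kernel (arclength (circle_curve R\<^sub>2)) (arclength g) (Phi k) C2" using kernel[OF g] by blast
  then interpret K1: L2_kernel "arclength (circle_curve R\<^sub>1)" "arclength g" "Phi k" C1
    + K2: L2_kernel "arclength (circle_curve R\<^sub>2)" "arclength g" "Phi k" C2 .
  have op: "single_layer k (circle_curve R\<^sub>1) = K1.op" "single_layer k (circle_curve R\<^sub>2) = K2.op"
    by (simp_all add: single_layer_def K1.op_def K2.op_def fun_eq_iff)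
  show ?thesis
    unfolding op by (rule L2_add) (use f in \<open>auto simp: mem_X intro: K1.op_L2 K2.op_L2\<close>)
qed

lemma S_mem: "f \<in> prod_L2 X \<Longrightarrow> S f \<in> prod_L2 Y"
  using potential_L2[OF g1.closed_curve_axioms] potential_L2[OF g2.closed_curve_axioms]
  by (simp add: S_op_def mem_Y)

lemma S_diff:
  assumes "f \<in> prod_L2 X" "g \<in> prod_L2 X"
  shows "S (f - g) = S f - S g"
proof -
  have "single_layer k (circle_curve R\<^sub>1) (fst (f - g)) x = single_layer k (circle_curve R\<^sub>1) (fst f) x - single_layer k (circle_curve R\<^sub>1) (fst g) x" for x
    using assms single_layer_integrable[OF k R1, of "fst f" x] single_layer_integrable[OF k R1, of "fst g" x]
    by (simp add: single_layer_def mem_X right_diff_distrib)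
  moreover have "single_layer k (circle_curve R\<^sub>2) (snd (f - g)) x = single_layer k (circle_curve R\<^sub>2) (snd f) x - single_layer k (circle_curve R\<^sub>2) (snd g) x" for x
    using assms single_layer_integrable[OF k R2, of "snd f" x] single_layer_integrable[OF k R2, of "snd g" x]
    by (simp add: single_layer_def mem_X right_diff_distrib)
  ultimately show ?thesis by (simp add: S_op_def fun_eq_iff)
qed

lemma potential_adjoint:
  assumes g: "closed_curve g" and h: "h \<in> L2 (arclength g)"
  obtains a1 a2 where "(a1, a2) \<in> prod_L2 X"
    "\<And>f. f \<in> prod_L2 X \<Longrightarrow>
      L2_inner (arclength g) (\<lambda>x. single_layer k (circle_curve R\<^sub>1) (fst f) x + single_layer k (circle_curve R\<^sub>2) (snd f) x) h
      = prod_inner X f (a1, a2)"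
proof -
  obtain C1 C2 where "L2_kernel (arclength (circle_curve R\<^sub>1)) (arclength g) (Phi k) C1"
    "L2_kernel (arclength (circle_curve R\<^sub>2)) (arclength g) (Phi k) C2" using kernel[OF g] by blast
  then interpret K1: L2_kernel "arclength (circle_curve R\<^sub>1)" "arclength g" "Phi k" C1
    + K2: L2_kernel "arclength (circle_curve R\<^sub>2)" "arclength g" "Phi k" C2 .
  have op: "single_layer k (circle_curve R\<^sub>1) = K1.op" "single_layer k (circle_curve R\<^sub>2) = K2.op"
    by (simp_all add: single_layer_def K1.op_def K2.op_def fun_eq_iff)
  show ?thesis
  proof (rule that[of "K1.adj h" "K2.adj h"])
    show "(K1.adj h, K2.adj h) \<in> prod_L2 X"
      using K1.adj_L2[OF h] K2.adj_L2[OF h] by (simp add: prod_L2_def space_X_def)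
    fix f assume "f \<in> prod_L2 X"
    then have f: "fst f \<in> L2 (arclength (circle_curve R\<^sub>1))" "snd f \<in> L2 (arclength (circle_curve R\<^sub>2))"
      by (auto simp: prod_L2_def space_X_def)
    show "L2_inner (arclength g) (\<lambda>x. single_layer k (circle_curve R\<^sub>1) (fst f) x + single_layer k (circle_curve R\<^sub>2) (snd f) x) h
      = prod_inner X f (K1.adj h, K2.adj h)"
      unfolding op L2_inner_add[OF K1.op_L2[OF f(1)] K2.op_L2[OF f(2)] h] K1.inner_adj[OF f(1) h] K2.inner_adj[OF f(2) h]
      by (simp add: prod_inner_def space_X_def)
  qed
qed

lemma Sadj:
  assumes h: "h \<in> prod_L2 Y"
  shows "Sadj h \<in> prod_L2 X" "\<And>f. f \<in> prod_L2 X \<Longrightarrow> prod_inner Y (S f) h = prod_inner X f (Sadj h)"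
proof -
  have h': "fst h \<in> L2 (arclength \<gamma>\<^sub>1)" "snd h \<in> L2 (arclength \<gamma>\<^sub>2)"
    using h by (auto simp: prod_L2_def space_Y_def)
  obtain a1 a2 where a: "(a1, a2) \<in> prod_L2 X" "\<And>f. f \<in> prod_L2 X \<Longrightarrow>
      L2_inner (arclength \<gamma>\<^sub>1) (\<lambda>x. single_layer k (circle_curve R\<^sub>1) (fst f) x + single_layer k (circle_curve R\<^sub>2) (snd f) x) (fst h)
      = prod_inner X f (a1, a2)" using potential_adjoint[OF g1.closed_curve_axioms h'(1)] by blast
  obtain b1 b2 where b: "(b1, b2) \<in> prod_L2 X" "\<And>f. f \<in> prod_L2 X \<Longrightarrow>
      L2_inner (arclength \<gamma>\<^sub>2) (\<lambda>x. single_layer k (circle_curve R\<^sub>1) (fst f) x + single_layer k (circle_curve R\<^sub>2) (snd f) x) (snd h)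
      = prod_inner X f (b1, b2)" using potential_adjoint[OF g2.closed_curve_axioms h'(2)] by blast
  let ?g = "(\<lambda>x. a1 x + b1 x, \<lambda>x. a2 x + b2 x)"
  have g: "?g \<in> prod_L2 X" using a(1) b(1) by (auto simp: prod_L2_def intro: L2_add)
  have eq: "prod_inner Y (S f) h = prod_inner X f ?g" if f: "f \<in> prod_L2 X" for f
  proof -
    have "prod_inner Y (S f) h = prod_inner X f (a1, a2) + prod_inner X f (b1, b2)"
      using a(2)[OF f] b(2)[OF f] by (simp add: inner_Y S_op_def)
    also have "\<dots> = prod_inner X f ?g"
      using a(1) b(1) f by (simp add: inner_X mem_X L2_inner_add_right)
    finally show ?thesis .
  qed
  show "Sadj h \<in> prod_L2 X" "\<And>f. f \<in> prod_L2 X \<Longrightarrow> prod_inner Y (S f) h = prod_inner X f (Sadj h)"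
    using L2_adjointI[where T=S and Y=Y, OF g eq] by blast+
qed

text \<open>The Tikhonov equation holds almost everywhere and involves chosen representatives of
  adjoint values; pairing with \<open>f\<close> is insensitive to both.\<close>

lemma tikhonov_weak:
  assumes t: "tikhonov_solution X Y S \<alpha> v \<phi>" and v: "v \<in> prod_L2 Y" and f: "f \<in> prod_L2 X"
  shows "\<alpha> * ipX f \<phi> + ipY (S f) (S \<phi> - v) = 0"
proof -
  have \<phi>: "\<phi> \<in> prod_L2 X" using t by (simp add: tikhonov_solution_def)
  define a where "a = Sadj (S \<phi>)"
  have a: "a \<in> prod_L2 X" "prod_inner Y (S f) (S \<phi>) = prod_inner X f a"
    unfolding a_def using Sadj[OF S_mem[OF \<phi>]] f by auto
  define l where "l = (\<lambda>x. of_real \<alpha> * fst \<phi> x + fst a x, \<lambda>x. of_real \<alpha> * snd \<phi> x + snd a x)"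
  have l: "l \<in> prod_L2 X"
    using \<phi> a(1) by (simp add: l_def mem_X L2_add L2_scale)
  have "prod_inner X f l = prod_inner X f (Sadj v)"
    by (rule prod_inner_cong_AE) (use t f l Sadj(1)[OF v] in \<open>auto simp: tikhonov_solution_def l_def a_def\<close>)
  moreover have "prod_inner X f l = of_real \<alpha> * prod_inner X f \<phi> + prod_inner X f a"
    using f \<phi> a(1) by (simp add: l_def inner_X mem_X L2_inner_add_right L2_scale L2_inner_scale_right distrib_left)
  ultimately have "of_real \<alpha> * prod_inner X f \<phi> + prod_inner Y (S f) (S \<phi>) = prod_inner Y (S f) v"
    using Sadj(2)[OF v f] a(2) by simp
  then have "Re (of_real \<alpha> * prod_inner X f \<phi> + prod_inner Y (S f) (S \<phi>)) = Re (prod_inner Y (S f) v)" by simp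
  then show ?thesis
    using Y.ip_diff_right[OF S_mem[OF \<phi>] v S_mem[OF f]] by simp
qed

lemma dense_range_adjoint:
  assumes inj: "\<And>f. f \<in> prod_L2 X \<Longrightarrow> prod_norm Y (S f) = 0 \<Longrightarrow> prod_norm X f = 0"
    and \<phi>: "\<phi> \<in> prod_L2 X" and e: "e > 0"
  shows "\<exists>h\<in>prod_L2 Y. prod_norm X (\<phi> - Sadj h) < e"
proof -
  define W where "W = {g \<in> prod_L2 X. \<exists>h\<in>prod_L2 Y. \<forall>f\<in>prod_L2 X. ipY (S f) h = ipX f g}"
  have W_adj: "Sadj h \<in> W" if "h \<in> prod_L2 Y" for h
  proof -
    have "\<forall>f\<in>prod_L2 X. ipY (S f) h = ipX f (Sadj h)" using Sadj(2)[OF that] by simp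
    then show ?thesis unfolding W_def using Sadj(1)[OF that] that by blast
  qed
  have "\<exists>g\<in>W. X.nrm (\<phi> - g) < e"
  proof (rule X.dense_if_orthogonal_null[OF _ _ _ _ _ _ \<phi> e])
    show "W \<subseteq> prod_L2 X" by (auto simp: W_def)
    show "W \<noteq> {}" using W_adj[OF S_mem[OF \<phi>]] by blast
    show "f + g \<in> W" if fg: "f \<in> W" "g \<in> W" for f g
    proof -
      obtain h where h: "h \<in> prod_L2 Y" "\<And>u. u \<in> prod_L2 X \<Longrightarrow> ipY (S u) h = ipX u f" using fg(1) by (auto simp: W_def)
      obtain h' where h': "h' \<in> prod_L2 Y" "\<And>u. u \<in> prod_L2 X \<Longrightarrow> ipY (S u) h' = ipX u g" using fg(2) by (auto simp: W_def)
      have "ipY (S u) (h + h') = ipX u (f + g)" if u: "u \<in> prod_L2 X" for u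
        using fg Y.ip_add_right[OF h(1) h'(1) S_mem[OF u]] X.ip_add_right[of f g u] h(2)[OF u] h'(2)[OF u] u
        by (auto simp: W_def)
      then show ?thesis using fg X.add_mem Y.add_mem[OF h(1) h'(1)] unfolding W_def by blast
    qed
    show "pair_scale c f \<in> W" if f: "f \<in> W" for f c
    proof -
      obtain h where h: "h \<in> prod_L2 Y" "\<And>u. u \<in> prod_L2 X \<Longrightarrow> ipY (S u) h = ipX u f" using f by (auto simp: W_def)
      have "ipY (S u) (pair_scale c h) = ipX u (pair_scale c f)" if u: "u \<in> prod_L2 X" for u
        using f Y.ip_sc_right[OF h(1) S_mem[OF u]] X.ip_sc_right[of f u] h(2)[OF u] u by (auto simp: W_def)
      then show ?thesis using f X.sc_mem Y.sc_mem[OF h(1)] unfolding W_def by blast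
    qed
    show "\<exists>h\<in>prod_L2 X. (\<lambda>n. X.nrm (s n - h)) \<longlonglongrightarrow> 0"
      if "\<And>n. s n \<in> prod_L2 X" "\<And>e. e > 0 \<Longrightarrow> \<exists>N. \<forall>m\<ge>N. \<forall>n\<ge>N. X.nrm (s m - s n) < e" for s :: "nat \<Rightarrow> complex fun_pair"
      unfolding nrm_prod_L2
      by (rule prod_L2_complete) (use that c1.finite_arclength c2.finite_arclength in \<open>auto simp: space_X_def nrm_prod_L2\<close>)
    show "X.nrm f = 0" if f: "f \<in> prod_L2 X" and o: "\<And>g. g \<in> W \<Longrightarrow> ipX f g = 0" for f
    proof -
      \<comment> \<open>Orthogonality is tested with the single element
        \<open>Sadj (S f)\<close>.\<close>
      have "ipY (S f) (S f) = 0" using o[OF W_adj[OF S_mem[OF f]]] Sadj(2)[OF S_mem[OF f] f] by simp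
      then have "Y.nrm (S f) = 0" by (simp add: Y.nrm_def)
      then show ?thesis using inj[OF f] by (simp only: nrm_prod_L2)
    qed
  qed
  then obtain g h where g: "g \<in> prod_L2 X" "X.nrm (\<phi> - g) < e" and h: "h \<in> prod_L2 Y"
    "\<And>f. f \<in> prod_L2 X \<Longrightarrow> ipY (S f) h = ipX f g" by (auto simp: W_def)
  \<comment> \<open>Two representatives of the same adjoint value differ by a null pair, so
    \<open>g\<close> may be exchanged for \<open>Sadj h\<close>.\<close>
  define p where "p = g - Sadj h"
  have p: "p \<in> prod_L2 X" unfolding p_def by (intro X.diff_mem g Sadj h)
  have "ipX p p = ipX p g - ipX p (Sadj h)"
    unfolding p_def by (rule X.ip_diff_right) (use g(1) Sadj(1)[OF h(1)] p in \<open>auto simp: p_def\<close>)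
  also have "\<dots> = 0" using h(2)[OF p] Sadj(2)[OF h(1) p] by simp
  finally have "X.nrm p = 0" by (simp add: X.nrm_def)
  then have "X.nrm (\<phi> - Sadj h) < e"
    using X.nrm_triangle_diff[OF \<phi> g(1) Sadj(1)[OF h(1)]] g(2) by (simp add: p_def)
  then show ?thesis using h(1) unfolding nrm_prod_L2 by blast
qed

end

text \<open>
  A density pair in the kernel of the operator generates a field that vanishes on \<open>\<Gamma>\<^sub>1 \<union> \<Gamma>\<^sub>2\<close>, hence
  between the two curves, hence by continuation in the whole annulus between the circles.
\<close>

lemma single_layer_operator_injective:
  assumes op: "single_layer_operator \<gamma>\<^sub>1 \<gamma>\<^sub>2 k R\<^sub>1 R\<^sub>2"
    and \<Omega>\<^sub>1: "open \<Omega>\<^sub>1" "frontier \<Omega>\<^sub>1 = range \<gamma>\<^sub>1"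
    and \<Omega>\<^sub>2: "open \<Omega>\<^sub>2" "frontier \<Omega>\<^sub>2 = range \<gamma>\<^sub>2"
    and \<Gamma>: "range \<gamma>\<^sub>1 \<inter> range \<gamma>\<^sub>2 = {}"
    and nested: "ball 0 R\<^sub>1 \<subseteq> \<Omega>\<^sub>1" "\<Omega>\<^sub>1 \<subseteq> \<Omega>\<^sub>2" "\<Omega>\<^sub>2 \<subseteq> ball 0 R\<^sub>2"
    and ev: "\<not> dirichlet_eigenvalue (k\<^sup>2) (ball 0 R\<^sub>1)" "\<not> dirichlet_eigenvalue (k\<^sup>2) (\<Omega>\<^sub>2 - closure \<Omega>\<^sub>1)"
    and f: "f \<in> prod_L2 (space_X R\<^sub>1 R\<^sub>2)" and zero: "prod_norm (space_Y \<gamma>\<^sub>1 \<gamma>\<^sub>2) (S_op k R\<^sub>1 R\<^sub>2 f) = 0"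
  shows "prod_norm (space_X R\<^sub>1 R\<^sub>2) f = 0"
proof -
  interpret single_layer_operator \<gamma>\<^sub>1 \<gamma>\<^sub>2 k R\<^sub>1 R\<^sub>2 by fact
  define v where "v x = single_layer k (circle_curve R\<^sub>1) (fst f) x + single_layer k (circle_curve R\<^sub>2) (snd f) x" for x
  have f1: "fst f \<in> L2 (arclength (circle_curve R\<^sub>1))" and f2: "snd f \<in> L2 (arclength (circle_curve R\<^sub>2))"
    using f by (auto simp: prod_L2_def space_X_def)
  have i1: "integrable (arclength (circle_curve R\<^sub>1)) (fst f)" by (rule L2_integrable[OF c1.finite_arclength f1])
  have i2: "integrable (arclength (circle_curve R\<^sub>2)) (snd f)" by (rule L2_integrable[OF c2.finite_arclength f2])
  have vc: "continuous_on A v" for A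
    unfolding v_def by (intro continuous_on_add single_layer_continuous k R1 R2 f1 f2)
  have ae: "AE x in arclength \<gamma>\<^sub>1. v x = 0" "AE x in arclength \<gamma>\<^sub>2. v x = 0"
  proof -
    have "(AE x in fst Y. fst (S f) x = 0) \<and> (AE x in snd Y. snd (S f) x = 0)"
      using zero prod_norm_eq_0_iff[OF S_mem[OF f]] by blast
    then show "AE x in arclength \<gamma>\<^sub>1. v x = 0" "AE x in arclength \<gamma>\<^sub>2. v x = 0"
      unfolding space_Y_def S_op_def v_def fst_conv snd_conv by blast+
  qed
  have v\<Gamma>: "v x = 0" if "x \<in> range \<gamma>\<^sub>1 \<union> range \<gamma>\<^sub>2" for x
    using that g1.continuous_AE_zero[OF vc ae(1)] g2.continuous_AE_zero[OF vc ae(2)] by blast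
  define G where "G = \<Omega>\<^sub>2 - closure \<Omega>\<^sub>1"
  have G: "open G" unfolding G_def using \<Omega>\<^sub>2(1) by (intro open_Diff) auto
  have frontier_G: "frontier G \<subseteq> range \<gamma>\<^sub>1 \<union> range \<gamma>\<^sub>2"
  proof -
    have "frontier G \<subseteq> frontier \<Omega>\<^sub>2 \<union> frontier (- closure \<Omega>\<^sub>1)"
      unfolding G_def Diff_eq by (rule frontier_Int_subset)
    also have "frontier (- closure \<Omega>\<^sub>1) = closure \<Omega>\<^sub>1 - interior (closure \<Omega>\<^sub>1)"
      by (simp add: frontier_complement) (simp add: frontier_def)
    also have "\<dots> \<subseteq> frontier \<Omega>\<^sub>1"
      using interior_mono[OF closure_subset[of \<Omega>\<^sub>1]] unfolding frontier_def by blast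
    finally show ?thesis using \<Omega>\<^sub>1(2) \<Omega>\<^sub>2(2) by blast
  qed
  have G_bound: "R\<^sub>1 < cmod x \<and> cmod x < R\<^sub>2" if "x \<in> G" for x
  proof
    \<comment> \<open>Removing the closure of the inner domain keeps G off the closed inner disc,
      hence off the circle where the potential is singular.\<close>
    have "cball 0 R\<^sub>1 \<subseteq> closure \<Omega>\<^sub>1" using closure_mono[OF nested(1)] R1 by simp
    then have "x \<notin> cball 0 R\<^sub>1" using that by (auto simp: G_def)
    then show "R\<^sub>1 < cmod x" by simp
    show "cmod x < R\<^sub>2" using that nested(3) by (auto simp: G_def)
  qed
  have "helmholtz_solution (k\<^sup>2) G v"
  proof (rule wirt_helmholtz_solution[OF _ G vc])
    show "wirt_helmholtz (k\<^sup>2) G v"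
      unfolding v_def
      by (intro wirt_helmholtz_add wirt_helmholtz_mono[OF single_layer_helmholtz[OF k R1 i1]]
          wirt_helmholtz_mono[OF single_layer_helmholtz[OF k R2 i2]]) (use G_bound in auto)
  qed
  then have v0: "v x = 0" if "x \<in> G" for x
    using ev(2) that v\<Gamma> frontier_G unfolding dirichlet_eigenvalue_def G_def[symmetric] by blast
  \<comment> \<open>Continuation needs a starting point. If G were empty, disjointness of the curves
    would make the outer domain equal to the closure of the inner one, so it would be open, closed,
    nonempty and bounded. A point of G also yields \<open>R\<^sub>1 < R\<^sub>2\<close>.\<close>
  have "G \<noteq> {}"
  proof
    assume "G = {}"
    then have sub: "\<Omega>\<^sub>2 \<subseteq> closure \<Omega>\<^sub>1" by (auto simp: G_def)
    have cl: "closure \<Omega>\<^sub>1 = \<Omega>\<^sub>1 \<union> range \<gamma>\<^sub>1" "closure \<Omega>\<^sub>2 = \<Omega>\<^sub>2 \<union> range \<gamma>\<^sub>2"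
      using \<Omega>\<^sub>1(2) \<Omega>\<^sub>2(2) closure_Un_frontier[of \<Omega>\<^sub>1] closure_Un_frontier[of \<Omega>\<^sub>2] by simp_all
    have "range \<gamma>\<^sub>1 \<subseteq> \<Omega>\<^sub>2" using closure_mono[OF nested(2)] \<Gamma> unfolding cl by blast
    then have "\<Omega>\<^sub>2 = closure \<Omega>\<^sub>1" using sub nested(2) cl(1) by blast
    then have "closed \<Omega>\<^sub>2" by simp
    then have "\<Omega>\<^sub>2 = {} \<or> \<Omega>\<^sub>2 = UNIV" using \<Omega>\<^sub>2(1) clopen by blast
    moreover have "0 \<in> \<Omega>\<^sub>2" using nested(1,2) R1 centre_in_ball by blast
    moreover have "bounded \<Omega>\<^sub>2" using nested(3) bounded_ball bounded_subset by blast
    ultimately show False using not_bounded_UNIV by blast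
  qed
  then obtain x0 where x0: "x0 \<in> G" by blast
  then have R: "R\<^sub>1 < R\<^sub>2" using G_bound by fastforce
  have ann: "v x = 0" if "R\<^sub>1 < cmod x" "cmod x < R\<^sub>2" for x
    unfolding v_def
    by (rule annulus_continuation[OF k R1 R i1 i2 G x0 _ _ _ that]) (use v0 G_bound[OF x0] in \<open>auto simp: v_def\<close>)
  have "AE y in arclength (circle_curve R\<^sub>1). fst f y = 0" "AE y in arclength (circle_curve R\<^sub>2). snd f y = 0"
    using densities_zero[OF k R1 R ev(1) f1 f2] ann by (auto simp: v_def)
  then show ?thesis using prod_norm_eq_0_iff[OF f] unfolding space_X_def fst_conv snd_conv by blast
qed

theorem theorem3p2:
  fixes k R\<^sub>1 R\<^sub>2 \<epsilon>\<^sub>0 C\<^sub>0 \<epsilon> \<delta>\<^sub>0 :: real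
    and D \<Omega>\<^sub>1 \<Omega>\<^sub>2 :: "complex set"
    and \<gamma>\<^sub>D \<gamma>\<^sub>1 \<gamma>\<^sub>2 :: "real \<Rightarrow> complex"
    and z :: complex
    and us :: "complex \<Rightarrow> complex"
    and \<phi>s :: "complex fun_pair"
    and u\<delta> \<phi>\<delta> :: "real \<Rightarrow> complex fun_pair"
    and \<alpha> :: "real \<Rightarrow> real"
  defines "X \<equiv> space_X R\<^sub>1 R\<^sub>2"
    and "Y \<equiv> space_Y \<gamma>\<^sub>1 \<gamma>\<^sub>2"
    and "S \<equiv> S_op k R\<^sub>1 R\<^sub>2"
    and "Sadj \<equiv> L2_adjoint (space_X R\<^sub>1 R\<^sub>2) (space_Y \<gamma>\<^sub>1 \<gamma>\<^sub>2) (S_op k R\<^sub>1 R\<^sub>2)"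
    and "u \<equiv> exact_data k z us"
  assumes k: "k > 0"
    and radii: "R\<^sub>1 > 0" "R\<^sub>2 > 0"
    and D: "open D" "connected D" "simply_connected D"
    and D_boundary: "Ck_curve 2 \<gamma>\<^sub>D" "regular_jordan_curve \<gamma>\<^sub>D" "frontier D = range \<gamma>\<^sub>D"
    and \<Omega>\<^sub>1: "open \<Omega>\<^sub>1" "frontier \<Omega>\<^sub>1 = range \<gamma>\<^sub>1"
    and \<Omega>\<^sub>2: "open \<Omega>\<^sub>2" "frontier \<Omega>\<^sub>2 = range \<gamma>\<^sub>2"
    and \<Gamma>\<^sub>1: "\<forall>n. Ck_curve n \<gamma>\<^sub>1" "regular_jordan_curve \<gamma>\<^sub>1"
    and \<Gamma>\<^sub>2: "\<forall>n. Ck_curve n \<gamma>\<^sub>2" "regular_jordan_curve \<gamma>\<^sub>2"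
    and \<Gamma>: "range \<gamma>\<^sub>1 \<inter> range \<gamma>\<^sub>2 = {}" "range \<gamma>\<^sub>1 \<subseteq> D" "range \<gamma>\<^sub>2 \<subseteq> D"
    and nested: "ball 0 R\<^sub>1 \<subseteq> \<Omega>\<^sub>1" "\<Omega>\<^sub>1 \<subseteq> \<Omega>\<^sub>2" "\<Omega>\<^sub>2 \<subseteq> D" "D \<subseteq> ball 0 R\<^sub>2"
    and not_eigenvalue: "\<not> dirichlet_eigenvalue (k\<^sup>2) (ball 0 R\<^sub>1)"
      "\<not> dirichlet_eigenvalue (k\<^sup>2) D"
      "\<not> dirichlet_eigenvalue (k\<^sup>2) (\<Omega>\<^sub>2 - closure \<Omega>\<^sub>1)"
    and z: "z \<in> ball 0 R\<^sub>1"
    and us: "scattered_field k D z us"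
    and eps: "0 < \<epsilon>\<^sub>0" "\<epsilon>\<^sub>0 < 1" "0 < C\<^sub>0" "\<epsilon> = C\<^sub>0 * \<epsilon>\<^sub>0"
    and densities: "\<phi>s \<in> prod_L2 X"
      "L2_norm (arclength \<gamma>\<^sub>1)
         (\<lambda>x. single_layer k (circle_curve R\<^sub>1) (fst \<phi>s) x - Phi k x z) < \<epsilon>\<^sub>0"
      "L2_norm (arclength \<gamma>\<^sub>D)
         (\<lambda>x. single_layer k (circle_curve R\<^sub>2) (snd \<phi>s) x - us x) < \<epsilon>\<^sub>0"
    and data_error: "prod_norm Y (S \<phi>s - u) < C\<^sub>0 * \<epsilon>\<^sub>0"
    and \<delta>\<^sub>0: "0 < \<delta>\<^sub>0" "\<delta>\<^sub>0 \<le> 1"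
    and noisy: "\<forall>\<delta>. 0 < \<delta> \<and> \<delta> < \<delta>\<^sub>0 \<longrightarrow>
      u\<delta> \<delta> \<in> prod_L2 Y \<and> prod_norm Y (u - u\<delta> \<delta>) \<le> \<delta> \<and> \<delta> + \<epsilon> \<le> prod_norm Y (u\<delta> \<delta>)"
    and regularised: "\<forall>\<delta>. 0 < \<delta> \<and> \<delta> < \<delta>\<^sub>0 \<longrightarrow>
      \<alpha> \<delta> > 0 \<and> tikhonov_solution X Y S (\<alpha> \<delta>) (u\<delta> \<delta>) (\<phi>\<delta> \<delta>) \<and>
      prod_norm Y (S (\<phi>\<delta> \<delta>) - u\<delta> \<delta>) = \<delta> + \<epsilon>"
  shows "(\<exists>h\<in>prod_L2 Y. prod_norm X (\<phi>s - Sadj h) < \<epsilon>) \<and>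
    (\<forall>h\<in>prod_L2 Y. \<forall>E. prod_norm X (\<phi>s - Sadj h) < \<epsilon> \<and> prod_norm Y h \<le> E \<longrightarrow>
      (\<forall>\<delta>. 0 < \<delta> \<and> \<delta> < \<delta>\<^sub>0 \<longrightarrow>
        prod_norm X (\<phi>\<delta> \<delta> - \<phi>s) \<le> 2 * \<epsilon> + 2 * sqrt ((\<delta> + \<epsilon>) * E)))"
proof -
  interpret g1: closed_curve \<gamma>\<^sub>1 using \<Gamma>\<^sub>1 by (intro closed_curveI) auto
  interpret g2: closed_curve \<gamma>\<^sub>2 using \<Gamma>\<^sub>2 by (intro closed_curveI) auto
  interpret L: single_layer_operator \<gamma>\<^sub>1 \<gamma>\<^sub>2 k R\<^sub>1 R\<^sub>2
    by standard (use k radii in auto)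
  have inj: "prod_norm L.X f = 0" if "f \<in> prod_L2 L.X" "prod_norm L.Y (L.S f) = 0" for f
    by (rule single_layer_operator_injective[OF L.single_layer_operator_axioms \<Omega>\<^sub>1 \<Omega>\<^sub>2 \<Gamma>(1) nested(1,2) _ not_eigenvalue(1,3) that])
      (use nested in blast)
  have \<phi>s: "\<phi>s \<in> prod_L2 L.X" using densities(1) by (simp add: X_def)
  have \<epsilon>: "\<epsilon> > 0" using eps by simp
  \<comment> \<open>The source lies inside both open domains, hence off their boundaries, so the
    exact data are continuous on the curves and belong to Y.\<close>
  have z_off: "z \<notin> range \<gamma>\<^sub>1" "z \<notin> range \<gamma>\<^sub>2"
  proof -
    have "z \<in> \<Omega>\<^sub>1" "z \<in> \<Omega>\<^sub>2" using z nested(1,2) by blast+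
    then show "z \<notin> range \<gamma>\<^sub>1" "z \<notin> range \<gamma>\<^sub>2"
      using \<Omega>\<^sub>1 \<Omega>\<^sub>2 by (metis DiffE frontier_def interior_open)+
  qed
  have u_cont: "continuous_on A (\<lambda>x. Phi k x z + us x)" if "A \<subseteq> D" "z \<notin> A" for A
  proof (rule continuous_on_add)
    show "continuous_on A (\<lambda>x. Phi k x z)"
      by (rule continuous_at_imp_continuous_on, rule ballI, rule wirt_at_isCont[OF Phi_wirt(2)[OF k]]) (use that in auto)
    have "continuous_on (closure D) us" using us by (simp add: scattered_field_def helmholtz_solution_def)
    then show "continuous_on A us" using that closure_subset by (blast intro: continuous_on_subset)
  qed
  have u: "u \<in> prod_L2 L.Y"
    using g1.continuous_L2[OF u_cont[OF \<Gamma>(2) z_off(1)]] g2.continuous_L2[OF u_cont[OF \<Gamma>(3) z_off(2)]]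
    by (simp add: u_def exact_data_def prod_L2_def space_Y_def)
  have "\<exists>h\<in>prod_L2 L.Y. prod_norm L.X (\<phi>s - L.Sadj h) < \<epsilon>"
    by (rule L.dense_range_adjoint[OF inj \<phi>s \<epsilon>])
  moreover have "prod_norm L.X (\<phi>\<delta> \<delta> - \<phi>s) \<le> 2 * \<epsilon> + 2 * sqrt ((\<delta> + \<epsilon>) * E)"
    if h: "h \<in> prod_L2 L.Y" "prod_norm L.X (\<phi>s - L.Sadj h) < \<epsilon>" "prod_norm L.Y h \<le> E" and \<delta>: "0 < \<delta>" "\<delta> < \<delta>\<^sub>0" for h E \<delta>
  proof -
    have noise: "u\<delta> \<delta> \<in> prod_L2 L.Y" "prod_norm L.Y (u - u\<delta> \<delta>) \<le> \<delta>"
      using noisy \<delta> by (auto simp: Y_def)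
    have tik: "\<alpha> \<delta> > 0" "tikhonov_solution L.X L.Y L.S (\<alpha> \<delta>) (u\<delta> \<delta>) (\<phi>\<delta> \<delta>)" "prod_norm L.Y (L.S (\<phi>\<delta> \<delta>) - u\<delta> \<delta>) = \<delta> + \<epsilon>"
      using regularised \<delta> by (auto simp: X_def Y_def S_def)
    have \<phi>\<delta>: "\<phi>\<delta> \<delta> \<in> prod_L2 L.X" using tik(2) by (simp add: tikhonov_solution_def)
    \<comment> \<open>Approximation error \<epsilon> and noise \<delta> add up to the discrepancy
      level, so \<open>\<phi>s\<close> meets the residual bound that the regularised solution
      attains with equality.\<close>
    have "L.Y.nrm (L.S \<phi>s - u\<delta> \<delta>) \<le> L.Y.nrm (L.S \<phi>s - u) + L.Y.nrm (u - u\<delta> \<delta>)"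
      by (rule L.Y.nrm_triangle_diff[OF L.S_mem[OF \<phi>s] u noise(1)])
    then have err: "prod_norm L.Y (L.S \<phi>s - u\<delta> \<delta>) \<le> \<delta> + \<epsilon>"
      using data_error noise(2) eps(4) unfolding nrm_prod_L2 by (simp add: Y_def S_def)
    have "real_semi_inner.nrm L.ipX (\<phi>\<delta> \<delta> - \<phi>s) \<le> 2 * \<epsilon> + 2 * sqrt ((\<delta> + \<epsilon>) * E)"
    proof (rule tikhonov_source_bound[OF L.X.real_semi_inner_axioms L.Y.real_semi_inner_axioms, of L.S "\<phi>\<delta> \<delta>" \<phi>s "u\<delta> \<delta>" h "L.Sadj h"])
      show "L.ipY (L.S f) h = L.ipX f (L.Sadj h)" if "f \<in> prod_L2 L.X" for f
        using L.Sadj(2)[OF h(1) that] by simp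
      show "\<alpha> \<delta> * L.ipX f (\<phi>\<delta> \<delta>) + L.ipY (L.S f) (L.S (\<phi>\<delta> \<delta>) - u\<delta> \<delta>) = 0" if "f \<in> prod_L2 L.X" for f
        by (rule L.tikhonov_weak[OF tik(2) noise(1) that])
    qed (use L.S_mem L.S_diff \<phi>\<delta> \<phi>s noise h L.Sadj(1)[OF h(1)] tik err in \<open>auto simp: nrm_prod_L2\<close>)
    then show ?thesis unfolding nrm_prod_L2 .
  qed
  ultimately show ?thesis
    unfolding X_def Y_def S_def Sadj_def by blast
qed

end
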